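(* Let $X$ be a complex Hilbert space, $Y$ a Hilbert space, $A_0:\mathcal{D}(A_0)\to X$ a strictly positive self-adjoint operator and $C\in\mathcal{L}(X,Y)$ such that $C^*C\in\mathcal{L}(\mathcal{D}(A_0^2))\cap\mathcal{L}(\mathcal{D}(A_0))$. Assume that the pair $(iA_0,C)$ is exactly observable in time $\tau>0$ and set $\eta:=\|\mathbb{L}_\tau\|_{\mathcal{L}(X)}<1$. Let $(X_h)_{h>0}$ be a family of finite-dimensional subspaces of $\mathcal{D}(A_0^{1/2})$ satisfying the approximation property stated in the context with exponent $\theta>0$, let $\Delta t>0$ be a time step with $\tau=K\Delta t$, $K$ a positive integer, and $t_k=k\Delta t$ for $0\le k\le K$. Let $z_0\in\mathcal{D}(A_0^2)$ be the initial value of the system $\dot z(t)=iA_0z(t)$ for $t\ge0$, $z(0)=z_0$, with output $y(t)=Cz(t)$ for $t\in[0,\tau]$, let $y_h^k\in Y$, $0\le k\le K$, be approximations of $y(t_k)$, let $N_{h,\Delta t}$ be a positive integer (truncation parameter), and let $$z_{0,h,\Delta t}=\sum_{n=0}^{N_{h,\Delta t}}\mathbb{L}_{h,\Delta t,K}^{n}\,(z_h^-)^0.$$ Then there exist $M>0$ (independent of $\tau$, of $z_0$ and of the discretization parameters $h$ and $\Delta t$), $h^*>0$ and $\Delta t^*>0$ such that for all $h\in(0,h^* )$ and all $\Delta t\in(0,\Delta t^* )$ $$\|z_0-z_{0,h,\Delta t}\|\le M\left[\left(\frac{\eta^{N_{h,\Delta t}+1}}{1-\eta}+(h^\theta+\Delta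 t)(1+\tau)N_{h,\Delta t}^2\right)\|z_0\|_2+N_{h,\Delta t}\,\Delta t\sum_{\ell=0}^{K}\|C^*(y(t_\ell)-y_h^\ell)\|\right].$$
   Context: Notation. $\langle\cdot,\cdot\rangle$ and $\|\cdot\|$ are the inner product and norm of $X$; $\|\varphi\|_\alpha=\|A_0^\alpha\varphi\|$ is the norm of $\mathcal{D}(A_0^\alpha)$, and $\langle\varphi,\psi\rangle_{1/2}=\langle A_0^{1/2}\varphi,A_0^{1/2}\psi\rangle$. Exact observability of $(iA_0,C)$ in time $\tau$: there is $k_\tau>0$ such that $\int_0^\tau\|y(t)\|^2dt\ge k_\tau^2\|z_0\|^2$ for all $z_0\in\mathcal{D}(A_0)$, where $y(t)=Cz(t)$, $\dot z=iA_0z$, $z(0)=z_0$. Semigroups. $\mathbb{T}^+$ and $\mathbb{T}^-$ are the $C_0$-semigroups on $X$ generated by $iA_0-C^*C$ and $-iA_0-C^*C$ respectively, and $\mathbb{L}_\tau=\mathbb{T}^-_\tau\mathbb{T}^+_\tau$. Under exact observability in time $\tau$ it is known that $\|\mathbb{L}_\tau\|_{\mathcal{L}(X)}<1$. Galerkin spaces. $X_h\subset\mathcal{D}(A_0^{1/2})$ is endowed with the norm of $X$. $\pi_h$ is the orthogonal projection from $\mathcal{D}(A_0^{1/2})$ (with inner product $\langle\cdot,\cdot\rangle_{1/2}$) onto $X_h$. Approximation property: there exist $M>0$, $\theta>0$, $h^*>0$ such that $\|\pi_h\varphi-\varphi\|\le Mh^\theta\|\varphi\|_{1/2}$ for all $\varphi\in\mathcal{D}(A_0^{1/2})$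 and all $h\in(0,h^* )$. Fully discrete scheme. Put $D_tq^k=(q^k-q^{k-1})/\Delta t$. Given $q_{0,h}\in X_h$ and $F_h^k\in X$, let $(q_h^k)_{0\le k\le K}\subset X_h$ solve, for $1\le k\le K$ and all $\varphi_h\in X_h$, $$(S^\pm)\qquad\langle D_tq_h^k,\varphi_h\rangle=\pm i\langle q_h^k,\varphi_h\rangle_{1/2}-\langle C^*Cq_h^k,\varphi_h\rangle+\langle F_h^k,\varphi_h\rangle,\qquad q_h^0=q_{0,h}.$$ Discrete semigroups. For $q_0\in\mathcal{D}(A_0^{1/2})$, $\mathbb{T}^\pm_{h,\Delta t,k}q_0:=q_h^k$, where $(q_h^k)$ solves $(S^\pm)$ with $F_h^k=0$ for all $k$ and $q_{0,h}=\pi_hq_0$; and $\mathbb{L}_{h,\Delta t,K}=\mathbb{T}^-_{h,\Delta t,K}\mathbb{T}^+_{h,\Delta t,K}$. Discrete observers. $(z_h^+)^k:=q_h^k$, where $(q_h^k)$ solves $(S^+)$ with $F_h^k=C^*y_h^k$ and $q_h^0=0$. $(z_h^-)^k:=q_h^{K-k}$, where $(q_h^k)$ solves $(S^-)$ with $F_h^k=C^*y_h^{K-k}$ and $q_h^0=(z_h^+)^K$. *)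

theory Defs
  imports "HOL-Analysis.Analysis"
begin

section \<open>Complex Hilbert spaces\<close>

text \<open>
  A complex Hilbert space is presented on top of the library's real Hilbert spaces: the real inner
  product is the real part of the complex one, so norm, topology and completeness are the library's.
  The complex inner product is linear in its \<^emph>\<open>first\<close> argument and conjugate-linear in the second.
\<close>

class complex_hilbert = real_inner + complete_space +
  fixes cscale :: "complex \<Rightarrow> 'a \<Rightarrow> 'a" (infixr "*\<^sub>C" 75)
    and cinner :: "'a \<Rightarrow> 'a \<Rightarrow> complex"
  assumes cscale_add_right: "c *\<^sub>C (x + y) = c *\<^sub>C x + c *\<^sub>C y"
    and cscale_add_left: "(c + d) *\<^sub>C x = c *\<^sub>C x + d *\<^sub>C x"
    and cscale_cscale: "c *\<^sub>C d *\<^sub>C x = (c * d) *\<^sub>C x"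
    and cscale_of_real: "complex_of_real r *\<^sub>C x = r *\<^sub>R x"
    and cinner_commute: "cinner x y = cnj (cinner y x)"
    and cinner_add_left: "cinner (x + y) z = cinner x z + cinner y z"
    and cinner_cscale_left: "cinner (c *\<^sub>C x) y = c * cinner x y"
    and Re_cinner: "Re (cinner x y) = inner x y"

global_interpretation cvec: vector_space "cscale :: complex \<Rightarrow> 'a \<Rightarrow> 'a::complex_hilbert"
proof
  fix x :: 'a
  show "1 *\<^sub>C x = x" using cscale_of_real[of 1 x] by simp
qed (simp_all add: cscale_add_right cscale_add_left cscale_cscale)

definition bounded_clinear :: "('a::complex_hilbert \<Rightarrow> 'b::complex_hilbert) \<Rightarrow> bool" where
  "bounded_clinear T \<longleftrightarrow> bounded_linear T \<and> (\<forall>c x. T (c *\<^sub>C x) = c *\<^sub>C T x)"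

definition cadjoint :: "('a::complex_hilbert \<Rightarrow> 'b::complex_hilbert) \<Rightarrow> 'b \<Rightarrow> 'a" where
  "cadjoint T = (THE S. \<forall>x y. cinner (T x) y = cinner x (S y))"


section \<open>Unbounded operators\<close>

text \<open>
  An unbounded operator is given by its domain \<open>D\<close> and a total function \<open>A\<close>, whose values
  outside \<open>D\<close> are irrelevant.
\<close>

text \<open>The last conjunct says that the graph of the adjoint coincides with the graph of the operator.\<close>

definition selfadjoint_op :: "'a::complex_hilbert set \<Rightarrow> ('a \<Rightarrow> 'a) \<Rightarrow> bool" where
  "selfadjoint_op D A \<longleftrightarrow>
     cvec.subspace D \<and> closure D = UNIV \<and>
     (\<forall>x\<in>D. \<forall>y\<in>D. A (x + y) = A x + A y) \<and>
     (\<forall>c. \<forall>x\<in>D. A (c *\<^sub>C x) = c *\<^sub>C A x) \<and>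
     {(y, w). \<forall>x\<in>D. cinner (A x) y = cinner x w} = {(y, A y) |y. y \<in> D}"

definition strictly_positive_op :: "'a::complex_hilbert set \<Rightarrow> ('a \<Rightarrow> 'a) \<Rightarrow> bool" where
  "strictly_positive_op D A \<longleftrightarrow> (\<exists>m>0. \<forall>x\<in>D. Re (cinner (A x) x) \<ge> m * (norm x)\<^sup>2)"

definition sq_dom :: "'a set \<Rightarrow> ('a \<Rightarrow> 'a) \<Rightarrow> 'a set" where
  "sq_dom D A = {x \<in> D. A x \<in> D}"

text \<open>\<open>(Dh, Ah)\<close> is the (unique) positive self-adjoint square root of \<open>(D, A)\<close>.\<close>

definition is_sqrt_op ::
    "'a::complex_hilbert set \<Rightarrow> ('a \<Rightarrow> 'a) \<Rightarrow> 'a set \<Rightarrow> ('a \<Rightarrow> 'a) \<Rightarrow> bool" where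
  "is_sqrt_op D A Dh Ah \<longleftrightarrow>
     selfadjoint_op Dh Ah \<and> (\<forall>x\<in>Dh. Re (cinner (Ah x) x) \<ge> 0) \<and>
     sq_dom Dh Ah = D \<and> (\<forall>x\<in>D. Ah (Ah x) = A x)"

text \<open>\<open>Q\<close> restricts to a bounded operator on \<open>D\<close> equipped with the norm \<open>\<lambda>x. norm (A x)\<close>.\<close>

definition bounded_on_dom :: "'a::complex_hilbert set \<Rightarrow> ('a \<Rightarrow> 'a) \<Rightarrow> ('a \<Rightarrow> 'a) \<Rightarrow> bool" where
  "bounded_on_dom D A Q \<longleftrightarrow>
     (\<forall>x\<in>D. Q x \<in> D) \<and> (\<exists>c. \<forall>x\<in>D. norm (A (Q x)) \<le> c * norm (A x))"


section \<open>Semigroups and observability\<close>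

definition c0_semigroup :: "(real \<Rightarrow> 'a::complex_hilbert \<Rightarrow> 'a) \<Rightarrow> bool" where
  "c0_semigroup T \<longleftrightarrow>
     (\<forall>t\<ge>0. bounded_clinear (T t)) \<and> (\<forall>x. T 0 x = x) \<and>
     (\<forall>s\<ge>0. \<forall>t\<ge>0. \<forall>x. T (s + t) x = T s (T t x)) \<and>
     (\<forall>x. ((\<lambda>t. T t x) \<longlongrightarrow> x) (at_right 0))"

definition is_semigroup_generated_by ::
    "(real \<Rightarrow> 'a::complex_hilbert \<Rightarrow> 'a) \<Rightarrow> 'a set \<Rightarrow> ('a \<Rightarrow> 'a) \<Rightarrow> bool" where
  "is_semigroup_generated_by T D G \<longleftrightarrow>
     c0_semigroup T \<and>
     (\<forall>x w. ((\<lambda>t. (1 / t) *\<^sub>R (T t x - x)) \<longlongrightarrow> w) (at_right 0) \<longleftrightarrow> x \<in> D \<and> w = G x)"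

definition solves_iA ::
    "'a::complex_hilbert set \<Rightarrow> ('a \<Rightarrow> 'a) \<Rightarrow> 'a \<Rightarrow> (real \<Rightarrow> 'a) \<Rightarrow> bool" where
  "solves_iA D A z0 z \<longleftrightarrow>
     z 0 = z0 \<and>
     (\<forall>t\<ge>0. z t \<in> D \<and> (z has_vector_derivative \<i> *\<^sub>C A (z t)) (at t within {0..}))"

definition exactly_observable ::
    "'a::complex_hilbert set \<Rightarrow> ('a \<Rightarrow> 'a) \<Rightarrow> ('a \<Rightarrow> 'b::complex_hilbert) \<Rightarrow> real \<Rightarrow> bool" where
  "exactly_observable D A C \<tau> \<longleftrightarrow>
     (\<exists>k>0. \<forall>z0\<in>D. \<forall>z. solves_iA D A z0 z \<longrightarrow>
        integral {0..\<tau>} (\<lambda>t. (norm (C (z t)))\<^sup>2) \<ge> k\<^sup>2 * (norm z0)\<^sup>2)"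


section \<open>Galerkin discretization\<close>

text \<open>Below, \<open>Ah\<close> on \<open>Dh\<close> is the square root of the operator and \<open>V\<close> is a Galerkin space.\<close>

definition half_proj :: "('a::complex_hilbert \<Rightarrow> 'a) \<Rightarrow> 'a set \<Rightarrow> 'a \<Rightarrow> 'a" where
  "half_proj Ah V \<phi> = (THE p. p \<in> V \<and> (\<forall>\<psi>\<in>V. cinner (Ah (\<phi> - p)) (Ah \<psi>) = 0))"

definition galerkin_space :: "'a::complex_hilbert set \<Rightarrow> 'a set \<Rightarrow> bool" where
  "galerkin_space Dh V \<longleftrightarrow>
     (\<exists>B. finite B \<and> V = cvec.span B) \<and> V \<subseteq> Dh"

definition approximation_property ::
    "'a::complex_hilbert set \<Rightarrow> ('a \<Rightarrow> 'a) \<Rightarrow> (real \<Rightarrow> 'a set) \<Rightarrow> real \<Rightarrow> bool" where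
  "approximation_property Dh Ah Xh \<theta> \<longleftrightarrow>
     (\<exists>M>0. \<exists>hs>0. \<forall>\<phi>\<in>Dh. \<forall>h. 0 < h \<and> h < hs \<longrightarrow>
        norm (half_proj Ah (Xh h) \<phi> - \<phi>) \<le> M * h powr \<theta> * norm (Ah \<phi>))"

text \<open>
  The parameter \<open>c\<close> is \<open>\<i>\<close> for the forward scheme (sign plus) and \<open>-\<i>\<close> for the backward scheme
  (sign minus). Sequences are total functions on \<open>nat\<close>; values at indices beyond \<open>K\<close> are irrelevant.
\<close>

definition solves_scheme ::
    "complex \<Rightarrow> ('a::complex_hilbert \<Rightarrow> 'a) \<Rightarrow> ('a \<Rightarrow> 'b::complex_hilbert) \<Rightarrow> 'a set \<Rightarrow> real \<Rightarrow>
     nat \<Rightarrow> (nat \<Rightarrow> 'a) \<Rightarrow> 'a \<Rightarrow> (nat \<Rightarrow> 'a) \<Rightarrow> bool" where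
  "solves_scheme c Ah C V dt K F q0 q \<longleftrightarrow>
     (\<forall>k\<le>K. q k \<in> V) \<and> q 0 = q0 \<and>
     (\<forall>k\<in>{1..K}. \<forall>\<phi>\<in>V.
        cinner ((1 / dt) *\<^sub>R (q k - q (k - 1))) \<phi> =
          c * cinner (Ah (q k)) (Ah \<phi>) - cinner (cadjoint C (C (q k))) \<phi> + cinner (F k) \<phi>)"

text \<open>The value at time index \<open>k\<close> of the solution of the scheme; it is determined by the first \<open>k\<close> steps.\<close>

definition scheme_sol ::
    "complex \<Rightarrow> ('a::complex_hilbert \<Rightarrow> 'a) \<Rightarrow> ('a \<Rightarrow> 'b::complex_hilbert) \<Rightarrow> 'a set \<Rightarrow> real \<Rightarrow>
     (nat \<Rightarrow> 'a) \<Rightarrow> 'a \<Rightarrow> nat \<Rightarrow> 'a" where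
  "scheme_sol c Ah C V dt F q0 k =
     (THE x. \<exists>q. solves_scheme c Ah C V dt k F q0 q \<and> q k = x)"

definition disc_semigroup ::
    "complex \<Rightarrow> ('a::complex_hilbert \<Rightarrow> 'a) \<Rightarrow> ('a \<Rightarrow> 'b::complex_hilbert) \<Rightarrow> 'a set \<Rightarrow> real \<Rightarrow>
     nat \<Rightarrow> 'a \<Rightarrow> 'a" where
  "disc_semigroup c Ah C V dt k q0 = scheme_sol c Ah C V dt (\<lambda>_. 0) (half_proj Ah V q0) k"

definition disc_L ::
    "('a::complex_hilbert \<Rightarrow> 'a) \<Rightarrow> ('a \<Rightarrow> 'b::complex_hilbert) \<Rightarrow> 'a set \<Rightarrow> real \<Rightarrow> nat \<Rightarrow> 'a \<Rightarrow> 'a" where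
  "disc_L Ah C V dt K =
     disc_semigroup (- \<i>) Ah C V dt K \<circ> disc_semigroup \<i> Ah C V dt K"

definition observer_plus ::
    "('a::complex_hilbert \<Rightarrow> 'a) \<Rightarrow> ('a \<Rightarrow> 'b::complex_hilbert) \<Rightarrow> 'a set \<Rightarrow> real \<Rightarrow>
     (nat \<Rightarrow> 'b) \<Rightarrow> nat \<Rightarrow> 'a" where
  "observer_plus Ah C V dt yh k = scheme_sol \<i> Ah C V dt (\<lambda>j. cadjoint C (yh j)) 0 k"

definition observer_minus ::
    "('a::complex_hilbert \<Rightarrow> 'a) \<Rightarrow> ('a \<Rightarrow> 'b::complex_hilbert) \<Rightarrow> 'a set \<Rightarrow> real \<Rightarrow> nat \<Rightarrow>
     (nat \<Rightarrow> 'b) \<Rightarrow> nat \<Rightarrow> 'a" where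
  "observer_minus Ah C V dt K yh k =
     scheme_sol (- \<i>) Ah C V dt (\<lambda>j. cadjoint C (yh (K - j))) (observer_plus Ah C V dt yh K) (K - k)"

definition reconstruction ::
    "('a::complex_hilbert \<Rightarrow> 'a) \<Rightarrow> ('a \<Rightarrow> 'b::complex_hilbert) \<Rightarrow> 'a set \<Rightarrow> real \<Rightarrow> nat \<Rightarrow>
     (nat \<Rightarrow> 'b) \<Rightarrow> nat \<Rightarrow> 'a" where
  "reconstruction Ah C V dt K yh N =
     (\<Sum>n=0..N. (disc_L Ah C V dt K ^^ n) (observer_minus Ah C V dt K yh 0))"

end

theory Submission
  imports Defs
begin

text \<open>
  Write \<open>Q = C\<^sup>* C\<close>, \<open>G\<^sup>\<plusminus> = \<plusminus> i A - Q\<close> and \<open>L = T\<^sup>- T\<^sup>+\<close>, the semigroups being taken at time \<open>\<tau>\<close>.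
  The free motion \<open>z\<close> solves each observer equation, run forward and then backward, with the exact output as
  data. The error of the observers therefore evolves under the damped semigroups, and the backward observer ends in
  \<open>z0 - L z0\<close>. The truncated Neumann series applied to this vector telescopes to
  \<open>r\<^sub>N = z0 - L\<^sup>N\<^sup>+\<^sup>1 z0\<close>, so that without discretisation the error is at most \<open>\<eta>\<^sup>N\<^sup>+\<^sup>1\<close> times the norm
  of \<open>z0\<close>. Exact observability enters through \<open>\<eta> < 1\<close> (\<open>observable_decay\<close>): the energy dissipated by the damped
  motion controls its distance to the free motion, hence the observed energy of the latter, hence the initial norm.

  The discretisation error rests on three facts. Implicit Euler is unconditionally stable, because the skew part of the
  equation is invisible in the energy identity (\<open>stability\<close>). It is consistent: on a vector \<open>x\<close> of the domain of \<open>A\<^sup>2\<close>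
  the projected semigroups and their discrete counterparts differ by a multiple of
  \<open>\<tau> (h\<^sup>\<theta> + dt) \<parallel>A\<^sup>2 x\<parallel>\<close> (\<open>consistency\<close>). And the two Neumann sums obey the same affine recursion
  \<open>r \<mapsto> (z0 - L z0) + L r\<close>, up to discretisation, and the discrete operator is a contraction, so their distance
  is at most \<open>N + 1\<close> times the error of the observers plus the sum over \<open>n < N\<close> of the consistency errors at \<open>r\<^sub>n\<close>
  (\<open>reconstruction_error\<close>).

  This leaves the size of \<open>A\<^sup>2 r\<^sub>n\<close>. The commutator of \<open>A\<close> with either semigroup is bounded uniformly in time, since
  the semigroup commutes with its own generator and \<open>Q\<close> is bounded. The norms of \<open>L\<^sup>n z0\<close>, \<open>A L\<^sup>n z0\<close> and
  \<open>A\<^sup>2 L\<^sup>n z0\<close> thus satisfy a triangular system of recursions with factor \<open>\<eta> < 1\<close>, and the last of them sum to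
  at most \<open>S \<parallel>A\<^sup>2 z0\<parallel>\<close> (\<open>power_orbit_sum\<close>). The constant \<open>S\<close> depends on \<open>\<tau>\<close> through \<open>\<eta>\<close>, whereas the constant of
  the theorem must not. This is resolved by \<open>orbit_sum_absorbed\<close>: either \<open>\<eta> \<le> 1/2\<close> and \<open>S\<close> is bounded outright, or
  \<open>N \<ge> S\<close> and \<open>S\<close> is absorbed by \<open>N\<close>, or \<open>N < S\<close> and the term \<open>\<eta>\<^sup>N\<^sup>+\<^sup>1 / (1 - \<eta>)\<close> is bounded below, so that it
  dominates for all sufficiently fine discretisations, where the threshold may depend on \<open>\<tau>\<close>.

  Two pieces of operator theory are developed on the way. The group generated by \<open>i A\<close> is the limit of the Euler products
  \<open>(1 - i (t / 2\<^sup>n) A)\<^sup>-\<^sup>1\<close> to the power \<open>2\<^sup>n\<close>; it supplies the free motions that observability speaks about.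
  The differentiability of the orbits of a semigroup given by its generator is obtained from the uniform boundedness
  principle.
\<close>

section \<open>Complex Hilbert spaces\<close>

lemma cscale_simps [simp]:
  "c *\<^sub>C (0::'a::complex_hilbert) = 0" "0 *\<^sub>C (x::'a) = 0" "1 *\<^sub>C x = x"
  "(- 1) *\<^sub>C x = - x" "c *\<^sub>C (- x) = - (c *\<^sub>C x)" "(- c) *\<^sub>C x = - (c *\<^sub>C x)"
  "\<i> *\<^sub>C \<i> *\<^sub>C x = - x"
  by (simp_all add: cscale_cscale)

lemma cscale_diff_right: "c *\<^sub>C (x - y) = c *\<^sub>C x - c *\<^sub>C (y::'a::complex_hilbert)"
  by (rule cvec.scale_right_diff_distrib)

lemma cscale_scaleR: "c *\<^sub>C r *\<^sub>R x = r *\<^sub>R c *\<^sub>C (x::'a::complex_hilbert)"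
  by (simp add: cscale_of_real[symmetric] cscale_cscale mult.commute)

lemma cinner_add_right: "cinner x (y + z) = cinner x y + cinner x (z::'a::complex_hilbert)"
  by (metis cinner_add_left cinner_commute complex_cnj_add)

lemma cinner_cscale_right: "cinner x (c *\<^sub>C y) = cnj c * cinner x (y::'a::complex_hilbert)"
  by (metis cinner_commute cinner_cscale_left complex_cnj_mult)

lemma cinner_minus_left: "cinner (- x) y = - cinner x (y::'a::complex_hilbert)"
  using cinner_cscale_left[of "-1" x y] by simp

lemma cinner_minus_right: "cinner x (- y) = - cinner x (y::'a::complex_hilbert)"
  using cinner_cscale_right[of x "-1" y] by simp

lemma cinner_diff_left: "cinner (x - y) z = cinner x z - cinner y (z::'a::complex_hilbert)"
  using cinner_add_left[of x "- y" z] by (simp add: cinner_minus_left)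

lemma cinner_diff_right: "cinner x (y - z) = cinner x y - cinner x (z::'a::complex_hilbert)"
  using cinner_add_right[of x y "- z"] by (simp add: cinner_minus_right)

lemma cinner_zero_left [simp]: "cinner 0 (x::'a::complex_hilbert) = 0"
  using cinner_cscale_left[of 0 0 x] by simp

lemma cinner_zero_right [simp]: "cinner (x::'a::complex_hilbert) 0 = 0"
  using cinner_cscale_right[of x 0 0] by simp

lemma cinner_scaleR_left: "cinner (r *\<^sub>R x) y = of_real r * cinner x (y::'a::complex_hilbert)"
  by (simp add: cscale_of_real[symmetric] cinner_cscale_left)

lemma Im_cinner_self [simp]: "Im (cinner x (x::'a::complex_hilbert)) = 0"
  using arg_cong[OF cinner_commute[of x x], of Im] by simp

lemma cinner_self: "cinner x (x::'a::complex_hilbert) = of_real ((norm x)\<^sup>2)"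
  by (simp add: complex_eq_iff Re_cinner power2_norm_eq_inner)

lemma norm_cscale: "norm (c *\<^sub>C x) = cmod c * norm (x::'a::complex_hilbert)"
proof -
  have "cinner (c *\<^sub>C x) (c *\<^sub>C x) = (c * cnj c) * cinner x x"
    by (simp add: cinner_cscale_left cinner_cscale_right mult_ac)
  then have "complex_of_real ((norm (c *\<^sub>C x))\<^sup>2) = of_real ((cmod c * norm x)\<^sup>2)"
    by (simp add: cinner_self complex_norm_square[symmetric] power_mult_distrib)
  then have "(norm (c *\<^sub>C x))\<^sup>2 = (cmod c * norm x)\<^sup>2"
    using of_real_eq_iff by blast
  then show ?thesis by (simp add: power2_eq_iff_nonneg)
qed

lemma bounded_linear_cscale: "bounded_linear (\<lambda>x::'a::complex_hilbert. c *\<^sub>C x)"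
  by (rule bounded_linear_intro[where K = "cmod c"])
     (simp_all add: cscale_add_right cscale_scaleR norm_cscale mult.commute)

lemmas tendsto_cscale [tendsto_intros] = bounded_linear.tendsto[OF bounded_linear_cscale]

section \<open>Orthogonal projections and adjoints\<close>

text \<open>Completeness replaces compactness here: minimising sequences for the norm on a convex set are Cauchy.\<close>

lemma nearest_point_exists:
  fixes S :: "'a::{real_inner,complete_space} set"
  assumes "convex S" "closed S" "S \<noteq> {}"
  shows "\<exists>p\<in>S. \<forall>s\<in>S. norm p \<le> norm s"
proof -
  define d where "d = Inf (norm ` S)"
  have bdd: "bdd_below (norm ` S)" by (rule bdd_belowI[of _ 0]) auto
  have d_le: "d \<le> norm s" if "s \<in> S" for s
    unfolding d_def using bdd that by (simp add: cInf_lower)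
  have d0: "0 \<le> d" unfolding d_def using assms by (auto intro: cInf_greatest)
  have "\<exists>s\<in>S. norm s < d + inverse (real (Suc n))" for n
    using cInf_lessD[of "norm ` S" "d + inverse (real (Suc n))"] assms(3)
    unfolding d_def by auto
  then obtain f where f: "f n \<in> S" "norm (f n) < d + inverse (real (Suc n))" for n by metis
  \<comment> \<open>The midpoint of two near-minimisers lies in the set, so the parallelogram law
    forces their distance to be small.\<close>
  have par: "(norm (f m - f n))\<^sup>2 \<le> 2 * (norm (f m))\<^sup>2 + 2 * (norm (f n))\<^sup>2 - 4 * d\<^sup>2" for m n
  proof -
    have "(1/2) *\<^sub>R f m + (1/2) *\<^sub>R f n \<in> S"
      using assms(1) f by (intro convexD) auto
    then have "d \<le> norm ((1/2) *\<^sub>R (f m + f n))" using d_le by (simp add: scaleR_add_right)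
    then have "2 * d \<le> norm (f m + f n)" by simp
    then have "(2 * d)\<^sup>2 \<le> (norm (f m + f n))\<^sup>2" using d0 by (intro power_mono) auto
    moreover have "(norm (f m + f n))\<^sup>2 + (norm (f m - f n))\<^sup>2 = 2 * (norm (f m))\<^sup>2 + 2 * (norm (f n))\<^sup>2"
      by (simp add: power2_norm_eq_inner inner_add inner_diff inner_commute algebra_simps)
    ultimately show ?thesis by (simp add: power2_eq_square)
  qed
  have lim: "(\<lambda>n. norm (f n)) \<longlonglongrightarrow> d"
  proof (rule tendsto_sandwich)
    show "\<forall>\<^sub>F n in sequentially. d \<le> norm (f n)" using d_le f by auto
    show "\<forall>\<^sub>F n in sequentially. norm (f n) \<le> d + inverse (real (Suc n))"
      by (intro always_eventually allI less_imp_le f(2))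
    show "(\<lambda>n. d + inverse (real (Suc n))) \<longlonglongrightarrow> d"
      using tendsto_add[OF tendsto_const LIMSEQ_inverse_real_of_nat, of d] by simp
  qed simp
  have "Cauchy f"
  proof (rule metric_CauchyI)
    fix e :: real assume "0 < e"
    have "(\<lambda>n. (norm (f n))\<^sup>2) \<longlonglongrightarrow> d\<^sup>2" by (intro tendsto_intros lim)
    then have "\<forall>\<^sub>F n in sequentially. (norm (f n))\<^sup>2 < d\<^sup>2 + e\<^sup>2 / 4"
      using \<open>0 < e\<close> by (intro order_tendstoD(2)) auto
    then obtain N where N: "\<And>n. n \<ge> N \<Longrightarrow> (norm (f n))\<^sup>2 < d\<^sup>2 + e\<^sup>2 / 4"
      by (auto simp: eventually_sequentially)
    have "dist (f m) (f n) < e" if "m \<ge> N" "n \<ge> N" for m n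
    proof -
      have "(norm (f m - f n))\<^sup>2 < e\<^sup>2" using par[of m n] N[OF that(1)] N[OF that(2)] by linarith
      then show ?thesis using \<open>0 < e\<close> by (auto simp: dist_norm intro: power2_less_imp_less)
    qed
    then show "\<exists>M. \<forall>m\<ge>M. \<forall>n\<ge>M. dist (f m) (f n) < e" by blast
  qed
  then obtain p where p: "f \<longlonglongrightarrow> p" using Cauchy_convergent convergent_def by blast
  have "p \<in> S" using closed_sequentially[OF assms(2)] f(1) p by blast
  moreover have "norm p = d" using LIMSEQ_unique[OF tendsto_norm[OF p] lim] .
  ultimately show ?thesis using d_le by auto
qed

lemma orthogonal_projection_exists:
  fixes S :: "'a::{real_inner,complete_space} set"
  assumes "subspace S" "closed S"
  shows "\<exists>p\<in>S. \<forall>s\<in>S. inner (x - p) s = 0"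
proof -
  have "convex ((\<lambda>s. x - s) ` S)"
  proof -
    have "convex S" using assms(1) by (rule subspace_imp_convex)
    then have "convex ((+) x ` ((*\<^sub>R) (-1) ` S))" by (intro convex_translation convex_scaling)
    then show ?thesis by (simp add: image_image)
  qed
  moreover have "closed ((\<lambda>s. x - s) ` S)"
  proof -
    have "closed ((+) x ` (uminus ` S))" by (intro closed_translation closed_negations assms)
    then show ?thesis by (simp add: image_image)
  qed
  moreover have "0 \<in> S" using assms subspace_0 by blast
  ultimately obtain p where p: "p \<in> S" "\<And>s. s \<in> S \<Longrightarrow> norm (x - p) \<le> norm (x - s)"
    using nearest_point_exists[of "(\<lambda>s. x - s) ` S"] by blast
  have "inner (x - p) s = 0" if "s \<in> S" for s
  proof (cases "s = 0")
    case False
    \<comment> \<open>Moving the minimiser by the component of the residual along \<open>s\<close> cannot decrease the norm.\<close>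
    define a where "a = inner (x - p) s / (norm s)\<^sup>2"
    have "p + a *\<^sub>R s \<in> S" using p that assms(1) by (intro subspace_add subspace_scale)
    then have "norm (x - p) \<le> norm (x - p - a *\<^sub>R s)" using p(2) by (simp add: algebra_simps)
    then have "(norm (x - p))\<^sup>2 \<le> (norm (x - p - a *\<^sub>R s))\<^sup>2" by (intro power_mono) auto
    also have "\<dots> = (norm (x - p))\<^sup>2 - 2 * a * inner (x - p) s + a\<^sup>2 * (norm s)\<^sup>2"
      unfolding power2_norm_eq_inner inner_diff_left[of "x - p"] inner_diff_right[of _ "x - p"]
      using inner_commute[of s "x - p"] by (simp add: power2_eq_square)
    also have "\<dots> = (norm (x - p))\<^sup>2 - (inner (x - p) s)\<^sup>2 / (norm s)\<^sup>2"
      using False by (simp add: a_def power2_eq_square field_simps)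
    finally show ?thesis using False by (simp add: divide_le_0_iff)
  qed simp
  then show ?thesis using p(1) by blast
qed

text \<open>Up to scaling, the representing vector is the component orthogonal to the kernel of any vector outside the kernel.\<close>

lemma riesz_representation:
  fixes f :: "'a::{real_inner,complete_space} \<Rightarrow> real"
  assumes "bounded_linear f"
  shows "\<exists>w. \<forall>x. f x = inner x w"
proof (cases "\<forall>x. f x = 0")
  case True
  then show ?thesis by (intro exI[of _ 0]) simp
next
  case False
  interpret f: bounded_linear f by fact
  obtain x where x: "f x \<noteq> 0" using False by blast
  have "subspace {y. f y = 0}" by (auto simp: subspace_def f.add f.scaleR f.zero)
  moreover have "closed {y. f y = 0}"
    by (intro closed_Collect_eq continuous_intros f.continuous_on)
  ultimately obtain p where p: "f p = 0" "\<And>s. f s = 0 \<Longrightarrow> inner (x - p) s = 0"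
    using orthogonal_projection_exists[of "{y. f y = 0}" x] by blast
  define u where "u = x - p"
  have fu: "f u = f x" by (simp add: u_def f.diff p)
  then have u: "u \<noteq> 0" using x f.zero by metis
  have "f y = inner y ((f u / (norm u)\<^sup>2) *\<^sub>R u)" for y
  proof -
    have "f (y - (f y / f u) *\<^sub>R u) = 0" using x fu by (simp add: f.diff f.scaleR)
    then have "inner u (y - (f y / f u) *\<^sub>R u) = 0" using p(2) u_def by blast
    then have "inner u y = (f y / f u) * (norm u)\<^sup>2"
      by (simp add: inner_diff power2_norm_eq_inner)
    then show ?thesis using x fu u by (simp add: inner_commute)
  qed
  then show ?thesis by blast
qed

lemma cinner_eqI:
  fixes x y :: "'a::complex_hilbert"
  assumes "\<And>z. cinner z x = cinner z y"
  shows "x = y"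
proof -
  have "inner (x - y) (x - y) = 0"
    using assms[of "x - y"] by (metis Re_cinner cancel_comm_monoid_add_class.diff_cancel inner_diff_right)
  then show ?thesis by simp
qed

lemma bounded_clinear_imp: "bounded_clinear T \<Longrightarrow> bounded_linear T"
  by (simp add: bounded_clinear_def)

text \<open>The adjoint is a definite description, so its existence has to be shown: Riesz representation gives it for the
  real inner product, and the imaginary part of a pairing is minus the real part after rotating the first argument by \<open>\<i>\<close>.\<close>

lemma cinner_cadjoint:
  fixes T :: "'a::complex_hilbert \<Rightarrow> 'b::complex_hilbert"
  assumes "bounded_clinear T"
  shows "cinner (T x) y = cinner x (cadjoint T y)"
proof -
  interpret T: bounded_linear T using assms by (rule bounded_clinear_imp)
  have "\<exists>w. \<forall>x. inner (T x) y = inner x w" for y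
    by (rule riesz_representation) (intro bounded_linear_compose[OF bounded_linear_inner_left] T.bounded_linear)
  then obtain S where S: "inner (T x) y = inner x (S y)" for x y by metis
  have cS: "cinner (T x) y = cinner x (S y)" for x y
  proof (rule complex_eqI)
    show "Re (cinner (T x) y) = Re (cinner x (S y))" by (simp add: Re_cinner S)
    have "inner (T (\<i> *\<^sub>C x)) y = inner (\<i> *\<^sub>C x) (S y)" by (rule S)
    then have "Re (cinner (\<i> *\<^sub>C T x) y) = Re (cinner (\<i> *\<^sub>C x) (S y))"
      using assms by (simp add: Re_cinner bounded_clinear_def)
    then show "Im (cinner (T x) y) = Im (cinner x (S y))" by (simp add: cinner_cscale_left)
  qed
  have "cadjoint T = S"
    unfolding cadjoint_def
  proof (rule the_equality)
    fix S' assume S': "\<forall>x y. cinner (T x) y = cinner x (S' y)"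
    show "S' = S" by (rule ext, rule cinner_eqI) (metis S' cS)
  qed (use cS in blast)
  then show ?thesis using cS by simp
qed

lemma cadjoint_add:
  assumes "bounded_clinear T" shows "cadjoint T (x + y) = cadjoint T x + cadjoint T y"
  by (rule cinner_eqI) (simp add: cinner_cadjoint[OF assms, symmetric] cinner_add_right)

lemma cadjoint_cscale:
  assumes "bounded_clinear T" shows "cadjoint T (c *\<^sub>C y) = c *\<^sub>C cadjoint T y"
  by (rule cinner_eqI) (simp add: cinner_cadjoint[OF assms, symmetric] cinner_cscale_right)

lemma cadjoint_diff:
  assumes "bounded_clinear T" shows "cadjoint T (x - y) = cadjoint T x - cadjoint T y"
  by (rule cinner_eqI) (simp add: cinner_cadjoint[OF assms, symmetric] cinner_diff_right)

lemma bounded_clinear_cadjoint: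
  fixes T :: "'a::complex_hilbert \<Rightarrow> 'b::complex_hilbert"
  assumes "bounded_clinear T"
  shows "bounded_clinear (cadjoint T)"
proof -
  interpret T: bounded_linear T using assms by (rule bounded_clinear_imp)
  obtain K where K: "K \<ge> 0" "\<And>x. norm (T x) \<le> norm x * K" using T.nonneg_bounded by blast
  have "norm (cadjoint T y) \<le> norm y * K" for y
  proof -
    have "(norm (cadjoint T y))\<^sup>2 = Re (cinner (cadjoint T y) (cadjoint T y))" by (simp add: cinner_self)
    also have "\<dots> = inner (T (cadjoint T y)) y" by (simp add: cinner_cadjoint[OF assms, symmetric] Re_cinner)
    also have "\<dots> \<le> norm (T (cadjoint T y)) * norm y" by (rule norm_cauchy_schwarz)
    also have "\<dots> \<le> (norm (cadjoint T y) * K) * norm y" by (intro mult_right_mono K) simp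
    finally have "norm (cadjoint T y) * norm (cadjoint T y) \<le> norm (cadjoint T y) * (norm y * K)"
      by (simp add: power2_eq_square mult_ac)
    then show ?thesis using K(1) by (cases "norm (cadjoint T y) = 0") (auto simp: mult_le_cancel_left)
  qed
  moreover have "cadjoint T (r *\<^sub>R y) = r *\<^sub>R cadjoint T y" for r y
    by (simp add: cscale_of_real[symmetric] cadjoint_cscale[OF assms])
  ultimately show ?thesis unfolding bounded_clinear_def
    by (auto simp: cadjoint_cscale[OF assms] cadjoint_add[OF assms] intro!: bounded_linear_intro[where K = K])
qed

section \<open>Galerkin projection and the implicit Euler scheme\<close>

definition antilinear_on :: "'a::complex_hilbert set \<Rightarrow> ('a \<Rightarrow> complex) \<Rightarrow> bool" where
  "antilinear_on V l \<longleftrightarrow>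
     (\<forall>x\<in>V. \<forall>y\<in>V. l (x + y) = l x + l y) \<and> (\<forall>c. \<forall>x\<in>V. l (c *\<^sub>C x) = cnj c * l x)"

definition sesquilinear_on :: "'a::complex_hilbert set \<Rightarrow> ('a \<Rightarrow> 'a \<Rightarrow> complex) \<Rightarrow> bool" where
  "sesquilinear_on V a \<longleftrightarrow>
     (\<forall>z\<in>V. (\<forall>x\<in>V. \<forall>y\<in>V. a (x + y) z = a x z + a y z) \<and> (\<forall>c. \<forall>x\<in>V. a (c *\<^sub>C x) z = c * a x z))
     \<and> (\<forall>x\<in>V. antilinear_on V (a x))"

lemma antilinear_on_subset: "antilinear_on V l \<Longrightarrow> W \<subseteq> V \<Longrightarrow> antilinear_on W l"
  unfolding antilinear_on_def by blast

lemma sesquilinear_on_subset: "sesquilinear_on V a \<Longrightarrow> W \<subseteq> V \<Longrightarrow> sesquilinear_on W a"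
  unfolding sesquilinear_on_def antilinear_on_def by blast

text \<open>A finite-dimensional Lax--Milgram lemma, which yields both the Galerkin projection and the steps of the scheme. Adding one vector \<open>b\<close> to the spanning set is a step of
  Gaussian elimination: \<open>b\<close> is corrected by an element \<open>u\<close> of the old span such that \<open>b - u\<close> is annihilated
  by the old test vectors, and the pivot \<open>a (b - u) b = a (b - u) (b - u)\<close> is nonzero by definiteness.\<close>

lemma definite_form_solvable:
  fixes a :: "'a::complex_hilbert \<Rightarrow> 'a \<Rightarrow> complex"
  assumes "finite B" "sesquilinear_on (cvec.span B) a"
    and "\<And>x. x \<in> cvec.span B \<Longrightarrow> a x x = 0 \<Longrightarrow> x = 0"
    and "antilinear_on (cvec.span B) l"
  shows "\<exists>x\<in>cvec.span B. \<forall>\<phi>\<in>cvec.span B. a x \<phi> = l \<phi>"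
  using assms
proof (induction B arbitrary: l rule: finite_induct)
  case empty
  have "l 0 = 0" using empty.prems(3) unfolding antilinear_on_def
    by (metis cscale_simps(2) complex_cnj_zero mult_zero_left cvec.span_zero)
  moreover have "a 0 0 = 0" using empty.prems(1) unfolding sesquilinear_on_def
    by (metis cscale_simps(2) mult_zero_left cvec.span_zero)
  ultimately show ?case by simp
next
  case (insert b B)
  let ?V = "cvec.span B" and ?W = "cvec.span (insert b B)"
  have VW: "?V \<subseteq> ?W" by (intro cvec.span_mono) auto
  note IH = insert.IH[OF sesquilinear_on_subset[OF insert.prems(1) VW]]
  have def: "x = 0" if "x \<in> ?V" "a x x = 0" for x using insert.prems(2) that VW by blast
  show ?case
  proof (cases "b \<in> ?V")
    case True
    then have "?W = ?V" by (rule cvec.span_redundant)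
    then show ?thesis using IH[OF def] insert.prems(3) by simp
  next
    case False
    have bW: "b \<in> ?W" by (simp add: cvec.span_base)
    have anti: "antilinear_on ?W (a x)" if "x \<in> ?W" for x
      using insert.prems(1) that unfolding sesquilinear_on_def by blast
    obtain x0 where x0: "x0 \<in> ?V" "\<And>\<phi>. \<phi> \<in> ?V \<Longrightarrow> a x0 \<phi> = l \<phi>"
      using IH[OF def antilinear_on_subset[OF insert.prems(3) VW]] by blast
    obtain u where u: "u \<in> ?V" "\<And>\<phi>. \<phi> \<in> ?V \<Longrightarrow> a u \<phi> = a b \<phi>"
      using IH[OF def antilinear_on_subset[OF anti[OF bW] VW]] by blast
    define d where "d = b - u"
    have uW: "u \<in> ?W" using u VW by blast
    have dW: "d \<in> ?W" unfolding d_def by (intro cvec.span_diff bW uW)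
    have addl: "a (x + y) z = a x z + a y z" if "x \<in> ?W" "y \<in> ?W" "z \<in> ?W" for x y z
      using insert.prems(1) that unfolding sesquilinear_on_def by blast
    have scl: "a (c *\<^sub>C x) z = c * a x z" if "x \<in> ?W" "z \<in> ?W" for c x z
      using insert.prems(1) that unfolding sesquilinear_on_def by blast
    have addr: "f (x + y) = f x + f y" if "antilinear_on ?W f" "x \<in> ?W" "y \<in> ?W" for f x y
      using that unfolding antilinear_on_def by blast
    have scr: "f (c *\<^sub>C x) = cnj c * f x" if "antilinear_on ?W f" "x \<in> ?W" for f c x
      using that unfolding antilinear_on_def by blast
    have d0: "a d \<phi> = 0" if "\<phi> \<in> ?V" for \<phi>
    proof -
      have "b = d + u" by (simp add: d_def)
      then have "a b \<phi> = a d \<phi> + a u \<phi>" using addl[OF dW uW] that VW by blast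
      then show ?thesis using u that by simp
    qed
    have "a d d = a d b"
    proof -
      have "b = d + u" by (simp add: d_def)
      then have "a d b = a d d + a d u" using addr[OF anti[OF dW] dW uW] by metis
      then show ?thesis using d0[OF u(1)] by simp
    qed
    moreover have "d \<noteq> 0" using False u(1) by (auto simp: d_def)
    ultimately have pivot: "a d b \<noteq> 0" using insert.prems(2)[OF dW] by auto
    define t where "t = (l b - a x0 b) / a d b"
    define x where "x = x0 + t *\<^sub>C d"
    have x0W: "x0 \<in> ?W" using x0 VW by blast
    have tdW: "t *\<^sub>C d \<in> ?W" using dW by (rule cvec.span_scale)
    have ax: "a x z = a x0 z + t * a d z" if "z \<in> ?W" for z
      unfolding x_def using addl[OF x0W tdW that] scl[OF dW that] by simp
    have xW: "x \<in> ?W" unfolding x_def by (intro cvec.span_add x0W tdW)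
    have axb: "a x b = l b" using ax[OF bW] pivot by (simp add: t_def)
    have "a x \<phi> = l \<phi>" if \<phi>: "\<phi> \<in> ?W" for \<phi>
    proof -
      obtain k where k: "\<phi> - k *\<^sub>C b \<in> ?V" using \<phi> cvec.span_breakdown_eq by metis
      define s where "s = \<phi> - k *\<^sub>C b"
      have s: "s \<in> ?V" "s \<in> ?W" "\<phi> = k *\<^sub>C b + s" using k VW by (auto simp: s_def)
      have kb: "k *\<^sub>C b \<in> ?W" using bW by (rule cvec.span_scale)
      have "a x \<phi> = cnj k * a x b + a x s"
        unfolding s(3) using addr[OF anti[OF xW] kb s(2)] scr[OF anti[OF xW] bW] by simp
      also have "a x s = l s" using ax[OF s(2)] d0[OF s(1)] x0(2)[OF s(1)] by simp
      also have "cnj k * a x b + l s = l \<phi>"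
        unfolding s(3) using addr[OF insert.prems(3) kb s(2)] scr[OF insert.prems(3) bW] axb by simp
      finally show ?thesis .
    qed
    then show ?thesis using xW by blast
  qed
qed

text \<open>On the form domain only the form \<open>cinner (Ah x) (Ah y)\<close> matters to the Galerkin method; injectivity of \<open>Ah\<close>
  makes it definite.\<close>

locale definite_half_op =
  fixes Dh :: "'a::complex_hilbert set" and Ah :: "'a \<Rightarrow> 'a"
  assumes subspace_Dh: "cvec.subspace Dh"
    and Ah_add: "\<lbrakk>x \<in> Dh; y \<in> Dh\<rbrakk> \<Longrightarrow> Ah (x + y) = Ah x + Ah y"
    and Ah_cscale: "x \<in> Dh \<Longrightarrow> Ah (c *\<^sub>C x) = c *\<^sub>C Ah x"
    and Ah_inj: "\<lbrakk>x \<in> Dh; Ah x = 0\<rbrakk> \<Longrightarrow> x = 0"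
begin

lemma Dh_diff: "x \<in> Dh \<Longrightarrow> y \<in> Dh \<Longrightarrow> x - y \<in> Dh"
  by (rule cvec.subspace_diff[OF subspace_Dh])

lemma Ah_diff: "\<lbrakk>x \<in> Dh; y \<in> Dh\<rbrakk> \<Longrightarrow> Ah (x - y) = Ah x - Ah y"
  using Ah_add[of "x - y" y] by (simp add: Dh_diff)

end

locale galerkin = definite_half_op Dh Ah
  for Dh :: "'a::complex_hilbert set" and Ah +
  fixes V :: "'a set"
  assumes V: "galerkin_space Dh V"
begin

lemma VD: "x \<in> V \<Longrightarrow> x \<in> Dh"
  using V unfolding galerkin_space_def by blast

lemma subspace_V: "cvec.subspace V"
  using V unfolding galerkin_space_def using cvec.subspace_span by blast

lemma V_diff: "x \<in> V \<Longrightarrow> y \<in> V \<Longrightarrow> x - y \<in> V"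
  by (rule cvec.subspace_diff[OF subspace_V])

lemma V_add: "x \<in> V \<Longrightarrow> y \<in> V \<Longrightarrow> x + y \<in> V"
  by (rule cvec.subspace_add[OF subspace_V])

lemma V_zero: "0 \<in> V"
  by (rule cvec.subspace_0[OF subspace_V])

lemma solvable:
  assumes "sesquilinear_on V a" "\<And>x. x \<in> V \<Longrightarrow> a x x = 0 \<Longrightarrow> x = 0" "antilinear_on V l"
  shows "\<exists>x\<in>V. \<forall>\<phi>\<in>V. a x \<phi> = l \<phi>"
proof -
  obtain B where "finite B" "V = cvec.span B" using V unfolding galerkin_space_def by blast
  then show ?thesis using definite_form_solvable[of B a l] assms by simp
qed

lemma Ah_cinner_add:
  "x \<in> Dh \<Longrightarrow> y \<in> Dh \<Longrightarrow> cinner (Ah (x + y)) w = cinner (Ah x) w + cinner (Ah y) w"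
  "x \<in> Dh \<Longrightarrow> y \<in> Dh \<Longrightarrow> cinner w (Ah (x + y)) = cinner w (Ah x) + cinner w (Ah y)"
  "x \<in> Dh \<Longrightarrow> cinner (Ah (c *\<^sub>C x)) w = c * cinner (Ah x) w"
  "x \<in> Dh \<Longrightarrow> cinner w (Ah (c *\<^sub>C x)) = cnj c * cinner w (Ah x)"
  "x \<in> Dh \<Longrightarrow> y \<in> Dh \<Longrightarrow> cinner (Ah (x - y)) w = cinner (Ah x) w - cinner (Ah y) w"
  by (simp_all add: Ah_add Ah_diff Ah_cscale cinner_add_left cinner_add_right cinner_cscale_left
      cinner_cscale_right cinner_diff_left)

lemma half_proj_unique:
  assumes "\<phi> \<in> Dh" "p \<in> V" "\<And>\<psi>. \<psi> \<in> V \<Longrightarrow> cinner (Ah (\<phi> - p)) (Ah \<psi>) = 0"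
  shows "half_proj Ah V \<phi> = p"
  unfolding half_proj_def
proof (rule the_equality)
  fix p' assume p': "p' \<in> V \<and> (\<forall>\<psi>\<in>V. cinner (Ah (\<phi> - p')) (Ah \<psi>) = 0)"
  have d: "p' - p \<in> V" using p' assms(2) V_diff by blast
  have "cinner (Ah (p' - p)) (Ah (p' - p)) = cinner (Ah (\<phi> - p)) (Ah (p' - p)) - cinner (Ah (\<phi> - p')) (Ah (p' - p))"
    using assms(1,2) p' by (simp add: Ah_diff VD cinner_diff_left)
  also have "\<dots> = 0" using assms(3) p' d by simp
  finally have "Ah (p' - p) = 0" by (simp add: cinner_self)
  then have "p' - p = 0" using Ah_inj VD d by blast
  then show "p' = p" by simp
qed (use assms in blast)

lemma half_proj:
  assumes "\<phi> \<in> Dh"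
  shows "half_proj Ah V \<phi> \<in> V"
    and "\<psi> \<in> V \<Longrightarrow> cinner (Ah (\<phi> - half_proj Ah V \<phi>)) (Ah \<psi>) = 0"
proof -
  have "\<exists>p\<in>V. \<forall>\<psi>\<in>V. cinner (Ah p) (Ah \<psi>) = cinner (Ah \<phi>) (Ah \<psi>)"
  proof (rule solvable)
    show "sesquilinear_on V (\<lambda>p \<psi>. cinner (Ah p) (Ah \<psi>))"
      unfolding sesquilinear_on_def antilinear_on_def by (simp add: Ah_cinner_add VD)
    show "x = 0" if "x \<in> V" "cinner (Ah x) (Ah x) = 0" for x
      using that Ah_inj VD by (simp add: cinner_self)
    show "antilinear_on V (\<lambda>\<psi>. cinner (Ah \<phi>) (Ah \<psi>))"
      unfolding antilinear_on_def by (simp add: Ah_cinner_add VD)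
  qed
  then obtain p where p: "p \<in> V" "\<And>\<psi>. \<psi> \<in> V \<Longrightarrow> cinner (Ah (\<phi> - p)) (Ah \<psi>) = 0"
    using assms by (auto simp: Ah_cinner_add VD)
  then have "half_proj Ah V \<phi> = p" using assms half_proj_unique by blast
  then show "half_proj Ah V \<phi> \<in> V"
    and "\<psi> \<in> V \<Longrightarrow> cinner (Ah (\<phi> - half_proj Ah V \<phi>)) (Ah \<psi>) = 0" using p by auto
qed

lemma half_proj_cinner:
  assumes "\<phi> \<in> Dh" "\<psi> \<in> V"
  shows "cinner (Ah (half_proj Ah V \<phi>)) (Ah \<psi>) = cinner (Ah \<phi>) (Ah \<psi>)"
  using half_proj(2)[OF assms] half_proj(1)[OF assms(1)] assms by (simp add: Ah_cinner_add VD)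

lemma half_proj_id: "x \<in> V \<Longrightarrow> half_proj Ah V x = x"
proof (rule half_proj_unique)
  have "Ah 0 = 0" using Ah_cscale[of 0 0] cvec.subspace_0[OF subspace_Dh] by simp
  then show "cinner (Ah (x - x)) (Ah \<psi>) = 0" for \<psi> by simp
qed (auto intro: VD)

lemma half_proj_diff:
  assumes "x \<in> Dh" "y \<in> Dh"
  shows "half_proj Ah V (x - y) = half_proj Ah V x - half_proj Ah V y"
proof (rule half_proj_unique)
  fix \<psi> assume \<psi>: "\<psi> \<in> V"
  have "half_proj Ah V x \<in> Dh" "half_proj Ah V y \<in> Dh" using half_proj(1) assms VD by auto
  then show "cinner (Ah (x - y - (half_proj Ah V x - half_proj Ah V y))) (Ah \<psi>) = 0"
    using half_proj_cinner[OF _ \<psi>] assms by (simp add: Ah_diff Dh_diff cinner_diff_left)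
qed (use assms half_proj(1) in \<open>auto intro: V_diff Dh_diff\<close>)

end

locale euler_scheme = galerkin Dh Ah V
  for Dh :: "'a::complex_hilbert set" and Ah V +
  fixes C :: "'a \<Rightarrow> 'b::complex_hilbert" and dt :: real and c :: complex
  assumes C: "bounded_clinear C" and dt: "dt > 0" and c: "Re c = 0"
begin

abbreviation "Q x \<equiv> cadjoint C (C x)"
abbreviation "sol \<equiv> scheme_sol c Ah C V dt"
abbreviation "solves \<equiv> solves_scheme c Ah C V dt"

lemma C_add: "C (x + y) = C x + C y" and C_diff: "C (x - y) = C x - C y"
  and C_cscale: "C (a *\<^sub>C x) = a *\<^sub>C C x" and C_zero: "C 0 = 0"
  using C linear_simps[OF bounded_clinear_imp[OF C]] by (auto simp: bounded_clinear_def)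

lemma Q_add: "Q (x + y) = Q x + Q y" and Q_diff: "Q (x - y) = Q x - Q y"
  and Q_cscale: "Q (a *\<^sub>C x) = a *\<^sub>C Q x"
  by (simp_all add: C_add C_diff C_cscale cadjoint_add[OF C] cadjoint_diff[OF C] cadjoint_cscale[OF C])

lemma Re_Q_nonneg: "Re (cinner (Q x) x) \<ge> 0"
proof -
  have "cinner x (Q x) = cinner (C x) (C x)" by (simp add: cinner_cadjoint[OF C])
  then show ?thesis by (metis Re_cinner inner_commute inner_ge_zero)
qed

definition step_form :: "'a \<Rightarrow> 'a \<Rightarrow> complex" where
  "step_form x \<phi> = of_real (1 / dt) * cinner x \<phi> - c * cinner (Ah x) (Ah \<phi>) + cinner (Q x) \<phi>"

text \<open>The skew term drops out of the real part and the damping has a favourable sign.\<close>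

lemma step_form_coercive: "(norm x)\<^sup>2 / dt \<le> Re (step_form x x)"
  unfolding step_form_def using Re_Q_nonneg[of x] c by (simp add: cinner_self)

lemma sesquilinear_step_form: "sesquilinear_on V step_form"
  unfolding sesquilinear_on_def antilinear_on_def step_form_def
  by (simp add: Ah_cinner_add VD Q_add Q_cscale cinner_add_left cinner_add_right
      cinner_cscale_left cinner_cscale_right algebra_simps)

lemma step_exists:
  "\<exists>x\<in>V. \<forall>\<phi>\<in>V. step_form x \<phi> = cinner f \<phi>"
proof (rule solvable[OF sesquilinear_step_form])
  show "x = 0" if "x \<in> V" "step_form x x = 0" for x
    using step_form_coercive[of x] that dt by (simp add: divide_le_0_iff)
qed (simp add: antilinear_on_def cinner_add_right cinner_cscale_right)

lemma step_iff:
  "cinner ((1 / dt) *\<^sub>R (x - y)) \<phi> = c * cinner (Ah x) (Ah \<phi>) - cinner (Q x) \<phi> + cinner f \<phi>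
   \<longleftrightarrow> step_form x \<phi> = cinner ((1 / dt) *\<^sub>R y + f) \<phi>"
  unfolding step_form_def
  by (auto simp: cinner_scaleR_left cinner_diff_left cinner_add_left algebra_simps)

text \<open>Each step is a solvable linear problem for the next iterate, and the recursion produces one sequence that solves
  the scheme up to every length \<open>K\<close>.\<close>

lemma solves_exists:
  assumes "q0 \<in> V"
  shows "\<exists>q. \<forall>K. solves K F q0 q"
proof -
  define s where "s k y = (SOME x. x \<in> V \<and> (\<forall>\<phi>\<in>V. step_form x \<phi> = cinner ((1 / dt) *\<^sub>R y + F k) \<phi>))" for k y
  have s: "s k y \<in> V \<and> (\<forall>\<phi>\<in>V. step_form (s k y) \<phi> = cinner ((1 / dt) *\<^sub>R y + F k) \<phi>)" for k y
    unfolding s_def by (rule someI_ex) (use step_exists[of "(1 / dt) *\<^sub>R y + F k"] in blast)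
  define q where "q = rec_nat q0 (\<lambda>k y. s (Suc k) y)"
  have q: "q 0 = q0" "q (Suc k) = s (Suc k) (q k)" for k by (simp_all add: q_def)
  have "q k \<in> V" for k by (cases k) (simp_all add: q assms s)
  moreover have "step_form (q k) \<phi> = cinner ((1 / dt) *\<^sub>R q (k - 1) + F k) \<phi>" if "k \<ge> 1" "\<phi> \<in> V" for k \<phi>
    using that s by (cases k) (auto simp: q)
  ultimately show ?thesis
    unfolding solves_scheme_def step_iff using q(1) by (intro exI[of _ q]) auto
qed

lemma solves_restrict: "solves K F q0 q \<Longrightarrow> k \<le> K \<Longrightarrow> solves k F q0 q"
  unfolding solves_scheme_def by auto

lemma solves_diff:
  assumes "solves K F p0 p" "solves K G q0 q"
  shows "solves K (\<lambda>k. F k - G k) (p0 - q0) (\<lambda>k. p k - q k)"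
proof -
  have eq: "cinner ((1/dt) *\<^sub>R (p k - q k - (p (k-1) - q (k-1)))) \<phi> =
     c * cinner (Ah (p k - q k)) (Ah \<phi>) - cinner (Q (p k - q k)) \<phi> + cinner (F k - G k) \<phi>"
    if "k \<in> {1..K}" "\<phi> \<in> V" for k \<phi>
  proof -
    have "p k \<in> Dh" "q k \<in> Dh" using assms that VD unfolding solves_scheme_def by auto
    moreover have "cinner ((1/dt) *\<^sub>R (p k - p (k-1))) \<phi> = c * cinner (Ah (p k)) (Ah \<phi>) - cinner (Q (p k)) \<phi> + cinner (F k) \<phi>"
      using assms(1) that unfolding solves_scheme_def by blast
    moreover have "cinner ((1/dt) *\<^sub>R (q k - q (k-1))) \<phi> = c * cinner (Ah (q k)) (Ah \<phi>) - cinner (Q (q k)) \<phi> + cinner (G k) \<phi>"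
      using assms(2) that unfolding solves_scheme_def by blast
    moreover have "(1/dt) *\<^sub>R (p k - q k - (p (k-1) - q (k-1)))
       = (1/dt) *\<^sub>R (p k - p (k-1)) - (1/dt) *\<^sub>R (q k - q (k-1))"
      by (simp add: algebra_simps)
    ultimately show ?thesis
      by (simp only: cinner_diff_left Ah_cinner_add Q_diff) (simp add: algebra_simps)
  qed
  show ?thesis using assms eq unfolding solves_scheme_def by (auto intro: V_diff)
qed

text \<open>Testing the \<open>k\<close>-th equation with the iterate itself removes the skew term and leaves an increment
  of norm at most \<open>dt * norm (F k)\<close>; this unconditional stability is why implicit Euler is used.\<close>

lemma stability:
  assumes "solves K F q0 q"
  shows "norm (q K) \<le> norm q0 + dt * (\<Sum>k=1..K. norm (F k))"
proof -
  have step: "norm (q k) \<le> norm (q (k - 1)) + dt * norm (F k)" if k: "k \<in> {1..K}" for k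
  proof -
    have V: "q k \<in> V" using assms k unfolding solves_scheme_def by auto
    then have "step_form (q k) (q k) = cinner ((1 / dt) *\<^sub>R q (k - 1) + F k) (q k)"
      using assms k unfolding solves_scheme_def step_iff by blast
    then have "(norm (q k))\<^sup>2 / dt \<le> inner ((1 / dt) *\<^sub>R q (k - 1) + F k) (q k)"
      using step_form_coercive[of "q k"] by (simp add: Re_cinner)
    also have "\<dots> \<le> norm ((1 / dt) *\<^sub>R q (k - 1) + F k) * norm (q k)" by (rule norm_cauchy_schwarz)
    also have "\<dots> \<le> ((1 / dt) * norm (q (k - 1)) + norm (F k)) * norm (q k)"
      using dt by (intro mult_right_mono order_trans[OF norm_triangle_ineq]) auto
    finally have "norm (q k) * norm (q k) \<le> (norm (q (k - 1)) + dt * norm (F k)) * norm (q k)"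
      using dt by (simp add: field_simps power2_eq_square)
    moreover have "0 \<le> norm (q (k - 1)) + dt * norm (F k)" using dt by simp
    ultimately show ?thesis
      by (cases "norm (q k) = 0") (auto simp: mult_le_cancel_right)
  qed
  have "norm (q j) \<le> norm q0 + dt * (\<Sum>k=1..j. norm (F k))" if "j \<le> K" for j
    using that
  proof (induction j)
    case 0
    then show ?case using assms unfolding solves_scheme_def by simp
  next
    case (Suc j)
    then show ?case using step[of "Suc j"] by (simp add: algebra_simps)
  qed
  then show ?thesis by blast
qed

text \<open>Two runs with the same data differ by a run with zero data, which vanishes by stability. So the value
  selected at index \<open>k\<close> agrees with any run of length at least \<open>k\<close>.\<close>

lemma sol_eq:
  assumes "solves K F q0 q" "k \<le> K"
  shows "sol F q0 k = q k"
  unfolding scheme_sol_def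
proof (rule the_equality)
  show "\<exists>q'. solves k F q0 q' \<and> q' k = q k" using solves_restrict[OF assms] by blast
next
  fix x assume "\<exists>q'. solves k F q0 q' \<and> q' k = x"
  then obtain q' where q': "solves k F q0 q'" "q' k = x" by blast
  have "norm (q' k - q k) \<le> norm (q0 - q0) + dt * (\<Sum>k=1..k. norm (F k - F k))"
    by (rule stability[OF solves_diff[OF q'(1) solves_restrict[OF assms]]])
  then show "x = q k" using q'(2) by simp
qed

lemma sol_solves:
  assumes "q0 \<in> V"
  shows "solves K F q0 (sol F q0)"
proof -
  obtain q where q: "\<And>K. solves K F q0 q" using solves_exists[OF assms] by blast
  then have "sol F q0 = q" using sol_eq by blast
  then show ?thesis using q by simp
qed

lemma sol_in_V: "q0 \<in> V \<Longrightarrow> sol F q0 k \<in> V"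
  using sol_solves[of q0 k F] unfolding solves_scheme_def by blast

lemma disc_semigroup_diff:
  assumes "x \<in> V" "y \<in> V"
  shows "disc_semigroup c Ah C V dt K (x - y) = disc_semigroup c Ah C V dt K x - disc_semigroup c Ah C V dt K y"
proof -
  have "solves K (\<lambda>k. 0 - 0) (x - y) (\<lambda>k. sol (\<lambda>_. 0) x k - sol (\<lambda>_. 0) y k)"
    by (rule solves_diff[OF sol_solves sol_solves]) (use assms in auto)
  then show ?thesis
    unfolding disc_semigroup_def using sol_eq[OF _ order_refl] assms by (simp add: half_proj_id V_diff)
qed

lemma disc_semigroup_in_V: "x \<in> Dh \<Longrightarrow> disc_semigroup c Ah C V dt K x \<in> V"
  unfolding disc_semigroup_def by (rule sol_in_V[OF half_proj(1)])

lemma disc_semigroup_contraction: "x \<in> V \<Longrightarrow> norm (disc_semigroup c Ah C V dt K x) \<le> norm x"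
  unfolding disc_semigroup_def using stability[OF sol_solves[of x K "\<lambda>_. 0"]] by (simp add: half_proj_id)

end

section \<open>Self-adjoint operators and the unitary group\<close>

locale selfadjoint =
  fixes D :: "'a::complex_hilbert set" and A :: "'a \<Rightarrow> 'a"
  assumes sa: "selfadjoint_op D A"
begin

lemma subspace_D: "cvec.subspace D"
  and dense: "closure D = UNIV"
  and A_add: "\<lbrakk>x \<in> D; y \<in> D\<rbrakk> \<Longrightarrow> A (x + y) = A x + A y"
  and A_cscale: "x \<in> D \<Longrightarrow> A (c *\<^sub>C x) = c *\<^sub>C A x"
  using sa unfolding selfadjoint_op_def by auto

lemma graph: "(\<forall>x\<in>D. cinner (A x) y = cinner x w) \<longleftrightarrow> y \<in> D \<and> w = A y"
proof -
  have "(y, w) \<in> {(y, w). \<forall>x\<in>D. cinner (A x) y = cinner x w} \<longleftrightarrow> (y, w) \<in> {(y, A y) |y. y \<in> D}"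
    using sa unfolding selfadjoint_op_def by simp
  then show ?thesis by auto
qed

lemma D_zero: "0 \<in> D"
  and D_add: "x \<in> D \<Longrightarrow> y \<in> D \<Longrightarrow> x + y \<in> D"
  and D_diff: "x \<in> D \<Longrightarrow> y \<in> D \<Longrightarrow> x - y \<in> D"
  and D_cscale: "x \<in> D \<Longrightarrow> c *\<^sub>C x \<in> D"
  using subspace_D by (auto intro: cvec.subspace_0 cvec.subspace_add cvec.subspace_diff cvec.subspace_scale)

lemma D_scaleR: "x \<in> D \<Longrightarrow> r *\<^sub>R x \<in> D"
  using D_cscale[of x "of_real r"] by (simp add: cscale_of_real)

lemma A_scaleR: "x \<in> D \<Longrightarrow> A (r *\<^sub>R x) = r *\<^sub>R A x"
  using A_cscale[of x "of_real r"] by (simp add: cscale_of_real)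

lemma A_diff: "\<lbrakk>x \<in> D; y \<in> D\<rbrakk> \<Longrightarrow> A (x - y) = A x - A y"
  using A_add[of "x - y" y] by (simp add: D_diff)

lemma A_zero: "A 0 = 0"
  using A_diff[OF D_zero D_zero] by simp

lemma symmetric: "x \<in> D \<Longrightarrow> y \<in> D \<Longrightarrow> cinner (A x) y = cinner x (A y)"
  using graph by blast

lemma Im_A_self:
  assumes "x \<in> D" shows "Im (cinner (A x) x) = 0"
proof -
  have "cinner (A x) x = cnj (cinner (A x) x)"
    using symmetric[OF assms assms] cinner_commute[of x "A x"] by simp
  from arg_cong[OF this, of Im] show ?thesis by simp
qed

lemma inner_skew: "x \<in> D \<Longrightarrow> Re c = 0 \<Longrightarrow> inner (c *\<^sub>C A x) x = 0"
  unfolding Re_cinner[symmetric] by (simp add: cinner_cscale_left Im_A_self)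

text \<open>The symmetry relation passes to the limit, and a vector satisfying it lies in the domain because the graph of
  the adjoint is no larger than that of the operator.\<close>

lemma closed_graph:
  assumes "\<And>n. f n \<in> D" "f \<longlonglongrightarrow> x" "(\<lambda>n. A (f n)) \<longlonglongrightarrow> w"
  shows "x \<in> D \<and> A x = w"
proof -
  have "cinner (A y) x = cinner y w" if y: "y \<in> D" for y
  proof -
    have re: "inner (A y') x = inner y' w" if y': "y' \<in> D" for y'
    proof -
      have "inner (A y') (f n) = inner y' (A (f n))" for n
        using symmetric[OF y' assms(1)] by (metis Re_cinner)
      then have "(\<lambda>n. inner (A y') (f n)) \<longlonglongrightarrow> inner y' w"
        using assms(3) by (auto intro!: tendsto_intros)
      moreover have "(\<lambda>n. inner (A y') (f n)) \<longlonglongrightarrow> inner (A y') x"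
        using assms(2) by (auto intro!: tendsto_intros)
      ultimately show ?thesis by (rule LIMSEQ_unique[symmetric])
    qed
    have "Re (cinner (\<i> *\<^sub>C A y) x) = Re (cinner (\<i> *\<^sub>C y) w)"
      using re[OF D_cscale[OF y, of \<i>]] A_cscale[OF y] by (simp add: Re_cinner)
    then show ?thesis using re[OF y] by (auto simp: cinner_cscale_left Re_cinner intro: complex_eqI)
  qed
  then show ?thesis using graph[of x w] by auto
qed

lemma resolvent_norm:
  assumes "x \<in> D"
  shows "(norm (x - (\<i> * of_real e) *\<^sub>C A x))\<^sup>2 = (norm x)\<^sup>2 + e\<^sup>2 * (norm (A x))\<^sup>2"
proof -
  have "inner ((\<i> * of_real e) *\<^sub>C A x) x = 0" by (rule inner_skew[OF assms]) simp
  then have "(norm (x - (\<i> * of_real e) *\<^sub>C A x))\<^sup>2 = (norm x)\<^sup>2 + (norm ((\<i> * of_real e) *\<^sub>C A x))\<^sup>2"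
    unfolding power2_norm_eq_inner by (simp add: inner_diff inner_commute)
  then show ?thesis by (simp add: norm_cscale norm_mult power_mult_distrib)
qed

text \<open>By the preceding identity the operator \<open>1 - \<i> e A\<close> is bounded below, so its range is closed; the orthogonal
  projection onto the range is then the identity.\<close>

lemma resolvent_surj:
  assumes e: "e \<noteq> 0"
  shows "\<exists>x\<in>D. x - (\<i> * of_real e) *\<^sub>C A x = y"
proof -
  define k where "k = \<i> * complex_of_real e"
  define R where "R = (\<lambda>x. x - k *\<^sub>C A x) ` D"
  have "subspace R"
  proof (unfold subspace_def, intro conjI ballI allI)
    show "0 \<in> R" unfolding R_def by (rule image_eqI[of _ _ 0]) (simp_all add: A_zero D_zero)
    show "x + y \<in> R" if xy: "x \<in> R" "y \<in> R" for x y
    proof -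
      obtain u v where uv: "u \<in> D" "v \<in> D" "x = u - k *\<^sub>C A u" "y = v - k *\<^sub>C A v"
        using xy unfolding R_def by blast
      show ?thesis unfolding R_def
        by (rule image_eqI[of _ _ "u + v"]) (simp_all add: uv A_add D_add cscale_add_right)
    qed
    show "r *\<^sub>R x \<in> R" if x: "x \<in> R" for r x
    proof -
      obtain u where u: "u \<in> D" "x = u - k *\<^sub>C A u" using x unfolding R_def by blast
      show ?thesis unfolding R_def
        by (rule image_eqI[of _ _ "r *\<^sub>R u"]) (simp_all add: u A_scaleR D_scaleR cscale_scaleR scaleR_diff_right)
    qed
  qed
  moreover have "closed R"
  proof (unfold closed_sequential_limits, intro allI impI)
    fix f l assume "(\<forall>n. f n \<in> R) \<and> f \<longlonglongrightarrow> l"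
    then have f: "\<And>n. f n \<in> R" "f \<longlonglongrightarrow> l" by auto
    have "\<forall>n. \<exists>u. u \<in> D \<and> f n = u - k *\<^sub>C A u" using f(1) unfolding R_def by auto
    then obtain u where u: "\<And>n. u n \<in> D" "\<And>n. f n = u n - k *\<^sub>C A (u n)" by metis
    have "norm (u m - u n) \<le> norm (f m - f n)" for m n
    proof -
      have "f m - f n = (u m - u n) - (\<i> * of_real e) *\<^sub>C A (u m - u n)"
        by (simp add: u A_diff cscale_diff_right k_def)
      then have "(norm (f m - f n))\<^sup>2 = (norm (u m - u n))\<^sup>2 + e\<^sup>2 * (norm (A (u m - u n)))\<^sup>2"
        by (simp only: resolvent_norm[OF D_diff[OF u(1) u(1)]])
      then have "(norm (u m - u n))\<^sup>2 \<le> (norm (f m - f n))\<^sup>2" by simp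
      then show ?thesis by (rule power2_le_imp_le) simp
    qed
    then have le: "dist (u m) (u n) \<le> dist (f m) (f n)" for m n by (simp add: dist_norm)
    have "Cauchy f" using f(2) by (rule LIMSEQ_imp_Cauchy)
    have "Cauchy u"
    proof (rule metric_CauchyI)
      fix r :: real assume "0 < r"
      then obtain M where "\<And>m n. m \<ge> M \<Longrightarrow> n \<ge> M \<Longrightarrow> dist (f m) (f n) < r"
        using metric_CauchyD[OF \<open>Cauchy f\<close>] by blast
      then show "\<exists>M. \<forall>m\<ge>M. \<forall>n\<ge>M. dist (u m) (u n) < r"
        by (intro exI[of _ M] allI impI) (rule le_less_trans[OF le])
    qed
    then have "convergent u" by (rule Cauchy_convergent)
    then obtain p where p: "u \<longlonglongrightarrow> p" unfolding convergent_def by blast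
    have Au: "A (u n) = (1 / k) *\<^sub>C (u n - f n)" for n
      using e by (simp add: u cscale_cscale k_def)
    have "(\<lambda>n. A (u n)) \<longlonglongrightarrow> (1 / k) *\<^sub>C (p - l)"
      unfolding Au by (intro tendsto_intros p f)
    then have "p \<in> D" "A p = (1 / k) *\<^sub>C (p - l)" using closed_graph[OF u(1) p] by auto
    then have "l = p - k *\<^sub>C A p" using e by (simp add: cscale_cscale k_def)
    then show "l \<in> R" using \<open>p \<in> D\<close> unfolding R_def by blast
  qed
  ultimately obtain p where p: "p \<in> R" "\<And>s. s \<in> R \<Longrightarrow> inner (y - p) s = 0"
    using orthogonal_projection_exists by blast
  \<comment> \<open>A vector orthogonal to the range is an eigenvector with a non-real eigenvalue, hence zero.\<close>
  define q where "q = y - p"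
  have "cinner (A x) q = cinner x ((\<i> / of_real e) *\<^sub>C q)" if x: "x \<in> D" for x
  proof -
    have re: "Re (cinner (x' - k *\<^sub>C A x') q) = 0" if "x' \<in> D" for x'
      using p(2)[of "x' - k *\<^sub>C A x'"] that unfolding R_def q_def by (auto simp: Re_cinner inner_commute)
    have "Re (\<i> * cinner (x - k *\<^sub>C A x) q) = 0"
      using re[OF D_cscale[OF x, of \<i>]]
      by (simp add: A_cscale x cinner_cscale_left cinner_diff_left algebra_simps)
    then have "cinner (x - k *\<^sub>C A x) q = 0" using re[OF x] by (auto intro: complex_eqI)
    then have "cinner x q = k * cinner (A x) q" by (simp add: cinner_diff_left cinner_cscale_left)
    then show ?thesis using e by (simp add: cinner_cscale_right k_def field_simps)
  qed
  then have q: "q \<in> D" "A q = (\<i> / of_real e) *\<^sub>C q" using graph[of q "(\<i> / of_real e) *\<^sub>C q"] by auto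
  then have "Im (cinner (A q) q) = (norm q)\<^sup>2 / e"
    by (simp add: cinner_cscale_left cinner_self)
  then have "q = 0" using Im_A_self[OF q(1)] e by simp
  then have "y \<in> R" using p(1) q_def by simp
  then show ?thesis unfolding R_def k_def by auto
qed

text \<open>The step of the implicit Euler method for \<open>z' = \<i> A z\<close>. The value \<open>e = 0\<close> is included as the identity
  so that the approximants of the group at time zero need no special treatment.\<close>

definition res :: "real \<Rightarrow> 'a \<Rightarrow> 'a" where
  "res e y = (if e = 0 then y else (THE x. x \<in> D \<and> x - (\<i> * of_real e) *\<^sub>C A x = y))"

lemma resolvent_inj:
  assumes "x \<in> D" "x' \<in> D" "x - (\<i> * of_real e) *\<^sub>C A x = x' - (\<i> * of_real e) *\<^sub>C A x'"
  shows "x = x'"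
proof -
  have "(x - x') - (\<i> * of_real e) *\<^sub>C A (x - x') = 0"
    using assms by (simp add: A_diff cscale_diff_right algebra_simps)
  then have "(norm (x - x'))\<^sup>2 + e\<^sup>2 * (norm (A (x - x')))\<^sup>2 = 0"
    using resolvent_norm[OF D_diff[OF assms(1,2)], of e] by simp
  then show ?thesis by (simp add: add_nonneg_eq_0_iff)
qed

lemma res:
  assumes "e \<noteq> 0 \<or> y \<in> D"
  shows "res e y \<in> D" "res e y - (\<i> * of_real e) *\<^sub>C A (res e y) = y"
proof -
  have *: "res e y \<in> D \<and> res e y - (\<i> * of_real e) *\<^sub>C A (res e y) = y"
  proof (cases "e = 0")
    case False
    obtain x where x: "x \<in> D" "x - (\<i> * of_real e) *\<^sub>C A x = y" using resolvent_surj[OF False] by blast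
    then have "res e y = x" unfolding res_def using False resolvent_inj[OF _ x(1)]
      by (auto intro!: the_equality)
    then show ?thesis using x by simp
  qed (use assms in \<open>auto simp: res_def\<close>)
  then show "res e y \<in> D" "res e y - (\<i> * of_real e) *\<^sub>C A (res e y) = y" by auto
qed

lemma res_eqI: "x \<in> D \<Longrightarrow> x - (\<i> * of_real e) *\<^sub>C A x = y \<Longrightarrow> res e y = x"
  using res[of e y] resolvent_inj[of "res e y" x e] by (cases "e = 0") (auto simp: res_def)

text \<open>The linear contractions that commute with \<open>A\<close>. Resolvents belong to this class, it is stable under products and
  pointwise limits, and a member is determined by its values on the dense domain of \<open>A\<^sup>2\<close>.\<close>

definition commuting :: "('a \<Rightarrow> 'a) \<Rightarrow> bool" where
  "commuting T \<longleftrightarrow> (\<forall>x y. T (x + y) = T x + T y) \<and> (\<forall>c x. T (c *\<^sub>C x) = c *\<^sub>C T x)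
     \<and> (\<forall>x. norm (T x) \<le> norm x) \<and> (\<forall>x\<in>D. T x \<in> D \<and> A (T x) = T (A x))"

lemma commutingD:
  assumes "commuting T"
  shows "T (x + y) = T x + T y" "T (c *\<^sub>C x) = c *\<^sub>C T x" "norm (T x) \<le> norm x"
    "x \<in> D \<Longrightarrow> T x \<in> D" "x \<in> D \<Longrightarrow> A (T x) = T (A x)" "T (x - y) = T x - T y" "T 0 = 0"
proof -
  show add: "T (x + y) = T x + T y" and sc: "T (c *\<^sub>C x) = c *\<^sub>C T x" for x y c
    using assms unfolding commuting_def by blast+
  show "T (x - y) = T x - T y" using add[of "x - y" y] by (simp add: algebra_simps)
  show "T 0 = 0" using sc[of 0 0] by simp
qed (use assms in \<open>auto simp: commuting_def\<close>)

lemma commuting_comp: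
  assumes "commuting S" "commuting T"
  shows "commuting (S \<circ> T)"
  unfolding commuting_def comp_def
  using commutingD(1,2,4,5)[OF assms(1)] commutingD(1,2,4,5)[OF assms(2)]
    order_trans[OF commutingD(3)[OF assms(1)] commutingD(3)[OF assms(2)]]
  by simp

lemma commuting_funpow:
  "commuting T \<Longrightarrow> commuting (T ^^ k)"
proof (induction k)
  case 0
  show ?case by (simp add: commuting_def)
next
  case (Suc k)
  show ?case
    unfolding funpow.simps by (rule commuting_comp[OF Suc.prems Suc.IH[OF Suc.prems]])
qed

lemma commuting_res: "commuting (res e)"
proof (cases "e = 0")
  case False
  let ?k = "\<i> * complex_of_real e"
  note r = res[OF disjI1[OF False]]
  have "res e (x + y) = res e x + res e y" for x y
  proof (rule res_eqI)
    have "res e x + res e y - ?k *\<^sub>C A (res e x + res e y)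
       = (res e x - ?k *\<^sub>C A (res e x)) + (res e y - ?k *\<^sub>C A (res e y))"
      by (simp add: A_add r(1) cscale_add_right algebra_simps)
    then show "res e x + res e y - ?k *\<^sub>C A (res e x + res e y) = x + y" by (simp only: r)
  qed (simp add: r D_add)
  moreover have "res e (c *\<^sub>C x) = c *\<^sub>C res e x" for c x
  proof (rule res_eqI)
    have "c *\<^sub>C res e x - ?k *\<^sub>C A (c *\<^sub>C res e x) = c *\<^sub>C (res e x - ?k *\<^sub>C A (res e x))"
      by (simp add: A_cscale r(1) cscale_diff_right cscale_cscale mult.commute)
    then show "c *\<^sub>C res e x - ?k *\<^sub>C A (c *\<^sub>C res e x) = c *\<^sub>C x" by (simp only: r(2))
  qed (simp add: r D_cscale)
  moreover have "norm (res e x) \<le> norm x" for x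
    by (rule power2_le_imp_le) (use resolvent_norm[OF r(1), of x e] in \<open>simp_all add: r\<close>)
  moreover have "res e x \<in> D \<and> A (res e x) = res e (A x)" if x: "x \<in> D" for x
  proof -
    let ?y = "res e x"
    have Ay: "A ?y = (1 / ?k) *\<^sub>C (?y - x)"
    proof -
      have "?y - x = ?k *\<^sub>C A ?y" using r(2)[of x] by (simp add: algebra_simps)
      then show ?thesis using False by (simp add: cscale_cscale)
    qed
    then have AyD: "A ?y \<in> D" using r(1) x by (simp add: D_cscale D_diff)
    have "res e (A x) = A ?y"
    proof (rule res_eqI[OF AyD])
      have "A ?y - ?k *\<^sub>C A (A ?y) = A (?y - ?k *\<^sub>C A ?y)"
        by (simp add: A_diff A_cscale AyD r(1) D_cscale)
      then show "A ?y - ?k *\<^sub>C A (A ?y) = A x" by (simp only: r(2))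
    qed
    then show ?thesis using r by simp
  qed
  ultimately show ?thesis unfolding commuting_def by blast
qed (simp add: commuting_def res_def)

lemma res_near_id:
  assumes "x \<in> D" shows "norm (res e x - x) \<le> \<bar>e\<bar> * norm (A x)"
proof -
  have "res e x - x = (\<i> * of_real e) *\<^sub>C A (res e x)" using res(2)[of e x] assms by (simp add: algebra_simps)
  also have "A (res e x) = res e (A x)" using commutingD(5)[OF commuting_res assms] .
  finally have "norm (res e x - x) = \<bar>e\<bar> * norm (res e (A x))" by (simp add: norm_cscale norm_mult)
  also have "\<dots> \<le> \<bar>e\<bar> * norm (A x)"
    by (intro mult_left_mono commutingD(3)[OF commuting_res]) simp
  finally show ?thesis .
qed

lemma commuting_sq_dom:
  assumes "commuting T" "x \<in> sq_dom D A"
  shows "T x \<in> sq_dom D A" "A (A (T x)) = T (A (A x))"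
  using assms commutingD[OF assms(1)] by (auto simp: sq_dom_def)

text \<open>Both sides solve \<open>(1 - \<i> (a + b) A) w = x\<close> up to the term \<open>a b A\<^sup>2 w\<close>, which is all that distinguishes
  one large Euler step from two smaller ones.\<close>

lemma res_split:
  assumes "x \<in> sq_dom D A"
  shows "norm (res (a + b) x - res a (res b x)) \<le> \<bar>a * b\<bar> * norm (A (A x))"
proof -
  define w where "w = res a (res b x)"
  have comm: "commuting (res a \<circ> res b)"
    by (intro commuting_comp commuting_res)
  have w: "w \<in> D" "A w \<in> D" "A (A w) = res a (res b (A (A x)))"
    using commuting_sq_dom[OF comm assms] by (auto simp: w_def sq_dom_def)
  have xD: "x \<in> D" using assms by (simp add: sq_dom_def)
  have bD: "res b x \<in> D" using res[of b x] xD by simp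
  have wa: "w - (\<i> * of_real a) *\<^sub>C A w = res b x" using res(2)[of a "res b x"] bD by (simp add: w_def)
  have "x = res b x - (\<i> * of_real b) *\<^sub>C A (res b x)" using res(2)[of b x] xD by simp
  also have "\<dots> = w - (\<i> * of_real a) *\<^sub>C A w - (\<i> * of_real b) *\<^sub>C (A w - (\<i> * of_real a) *\<^sub>C A (A w))"
    unfolding wa[symmetric] by (simp add: A_diff A_cscale w D_cscale)
  also have "\<dots> = w - (\<i> * of_real (a + b)) *\<^sub>C A w - (a * b) *\<^sub>R A (A w)"
    by (simp add: cscale_diff_right cscale_cscale cscale_add_left cscale_of_real[symmetric] algebra_simps)
  finally have "w - (\<i> * of_real (a + b)) *\<^sub>C A w = x + (a * b) *\<^sub>R A (A w)" by (simp add: algebra_simps)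
  then have "res (a + b) (x + (a * b) *\<^sub>R A (A w)) = w" using w res_eqI by blast
  then have "w - res (a + b) x = res (a + b) ((a * b) *\<^sub>R A (A w))"
    using commutingD(1)[OF commuting_res] by (metis add_diff_cancel_left')
  then have "norm (w - res (a + b) x) \<le> norm ((a * b) *\<^sub>R A (A w))"
    using commutingD(3)[OF commuting_res] by metis
  also have "\<dots> \<le> \<bar>a * b\<bar> * norm (A (A x))"
    unfolding w(3) norm_scaleR
    using commutingD(3)[OF comm, of "A (A x)"] by (intro mult_left_mono) auto
  finally show ?thesis by (simp add: w_def norm_minus_commute)
qed

text \<open>In the telescoping sum of the difference of two powers every factor is a contraction commuting with \<open>A\<close>, so
  each of the \<open>k\<close> terms is at most the one-step bound at \<open>x\<close>.\<close>

lemma power_comparison: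
  assumes S: "commuting S" and T: "commuting T"
    and close: "\<And>y. y \<in> sq_dom D A \<Longrightarrow> norm (S y - T y) \<le> c * norm (A (A y))"
    and c: "c \<ge> 0" and x: "x \<in> sq_dom D A"
  shows "norm ((S ^^ k) x - (T ^^ k) x) \<le> real k * c * norm (A (A x))"
proof (induction k)
  case (Suc k)
  let ?y = "(T ^^ k) x"
  have Tk: "commuting (T ^^ k)" by (rule commuting_funpow[OF T])
  have "(S ^^ Suc k) x - (T ^^ Suc k) x = S ((S ^^ k) x - ?y) + (S ?y - T ?y)"
    by (simp add: commutingD(6)[OF S])
  then have "norm ((S ^^ Suc k) x - (T ^^ Suc k) x) \<le> norm (S ((S ^^ k) x - ?y)) + norm (S ?y - T ?y)"
    using norm_triangle_ineq by metis
  also have "\<dots> \<le> norm ((S ^^ k) x - ?y) + c * norm (A (A ?y))"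
    by (intro add_mono commutingD(3)[OF S] close commuting_sq_dom[OF Tk x])
  also have "\<dots> \<le> real k * c * norm (A (A x)) + c * norm (A (A x))"
    unfolding commuting_sq_dom(2)[OF Tk x]
    by (intro add_mono Suc.IH mult_left_mono c commutingD(3)[OF Tk])
  finally show ?case by (simp add: algebra_simps)
qed simp

text \<open>Halving the step at each stage makes consecutive approximants comparable by splitting every Euler step in two,
  with differences that form a geometric series.\<close>

definition approx :: "nat \<Rightarrow> real \<Rightarrow> 'a \<Rightarrow> 'a" where
  "approx n t = res (t / 2 ^ n) ^^ (2 ^ n)"

definition group :: "real \<Rightarrow> 'a \<Rightarrow> 'a" where
  "group t x = lim (\<lambda>n. approx n t x)"

lemma commuting_approx: "commuting (approx n t)"
  unfolding approx_def by (intro commuting_funpow commuting_res)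

lemma approx_succ:
  assumes "x \<in> sq_dom D A"
  shows "norm (approx n t x - approx (Suc n) t x) \<le> (t\<^sup>2 / 2 ^ (n + 2)) * norm (A (A x))"
proof -
  let ?e = "t / 2 ^ Suc n"
  have e2: "t / 2 ^ n = ?e + ?e" by simp
  have eq: "approx (Suc n) t = (res ?e \<circ> res ?e) ^^ (2 ^ n)"
  proof -
    have "res ?e \<circ> res ?e = res ?e ^^ 2" by (auto simp: numeral_2_eq_2)
    then show ?thesis unfolding approx_def by (simp only: funpow_mult power_Suc)
  qed
  have "norm ((res (t / 2 ^ n) ^^ (2 ^ n)) x - ((res ?e \<circ> res ?e) ^^ (2 ^ n)) x)
    \<le> real (2 ^ n) * \<bar>?e * ?e\<bar> * norm (A (A x))"
    by (rule power_comparison)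
      (use assms res_split[of _ ?e ?e] in \<open>auto simp del: power_Suc simp: e2 intro!: commuting_comp commuting_res\<close>)
  also have "real (2 ^ n) * \<bar>?e * ?e\<bar> = t\<^sup>2 / 2 ^ (n + 2)"
    by (simp add: power2_eq_square abs_mult field_simps)
  finally show ?thesis unfolding eq unfolding approx_def .
qed

lemma approx_diff:
  assumes "x \<in> sq_dom D A"
  shows "norm (approx n t x - approx (n + k) t x) \<le> t\<^sup>2 * (1 / 2 ^ (n + 1) - 1 / 2 ^ (n + k + 1)) * norm (A (A x))"
proof (induction k)
  case (Suc k)
  have "norm (approx n t x - approx (n + Suc k) t x)
     \<le> norm (approx n t x - approx (n + k) t x) + norm (approx (n + k) t x - approx (Suc (n + k)) t x)"
    using norm_triangle_ineq[of "approx n t x - approx (n + k) t x" "approx (n + k) t x - approx (Suc (n + k)) t x"] by simp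
  also have "\<dots> \<le> t\<^sup>2 * (1 / 2 ^ (n + 1) - 1 / 2 ^ (n + k + 1)) * norm (A (A x)) + (t\<^sup>2 / 2 ^ (n + k + 2)) * norm (A (A x))"
    by (intro add_mono Suc.IH approx_succ assms)
  also have "\<dots> = t\<^sup>2 * (1 / 2 ^ (n + 1) - 1 / 2 ^ (n + Suc k + 1)) * norm (A (A x))"
    by (simp add: field_simps)
  finally show ?case .
qed simp

lemma approx_tail:
  assumes "x \<in> sq_dom D A" "n \<le> m"
  shows "norm (approx n t x - approx m t x) \<le> t\<^sup>2 / 2 ^ (n + 1) * norm (A (A x))"
proof -
  have "norm (approx n t x - approx m t x) \<le> t\<^sup>2 * (1 / 2 ^ (n + 1) - 1 / 2 ^ (n + (m - n) + 1)) * norm (A (A x))"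
    using approx_diff[OF assms(1), of n t "m - n"] assms(2) by simp
  also have "\<dots> \<le> t\<^sup>2 * (1 / 2 ^ (n + 1)) * norm (A (A x))"
    by (intro mult_right_mono mult_left_mono) auto
  finally show ?thesis by simp
qed

lemma sq_dom_dense: "e > 0 \<Longrightarrow> \<exists>y\<in>sq_dom D A. norm (x - y) < e"
proof -
  assume e: "e > 0"
  obtain y where y: "y \<in> D" "norm (x - y) < e / 2"
    using dense e by (metis UNIV_I closure_approachable dist_norm half_gt_zero norm_minus_commute)
  define b where "b = norm (A y) + 1"
  have b: "b > 0" unfolding b_def by (simp add: add_nonneg_pos)
  define d where "d = e / (2 * b)"
  have d: "d > 0" unfolding d_def using e b by simp
  have "res d y \<in> sq_dom D A"
    using res[of d y] d y commutingD(5)[OF commuting_res y(1)] res(1)[of d "A y"]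
    by (auto simp: sq_dom_def)
  moreover have "norm (y - res d y) < e / 2"
  proof -
    have "norm (y - res d y) \<le> d * norm (A y)" using res_near_id[OF y(1), of d] d by (simp add: norm_minus_commute)
    also have "\<dots> < d * b" using d by (simp add: b_def)
    also have "\<dots> = e / 2" unfolding d_def using b by simp
    finally show ?thesis .
  qed
  ultimately show ?thesis
    using norm_triangle_ineq[of "x - y" "y - res d y"] y(2) by (intro bexI[of _ "res d y"]) auto
qed

text \<open>On the domain of \<open>A\<^sup>2\<close> the approximants are Cauchy by the geometric tail bound; contractivity extends this to the
  closure, which is the whole space.\<close>

lemma approx_tendsto: "(\<lambda>n. approx n t x) \<longlonglongrightarrow> group t x"
proof -
  have "Cauchy (\<lambda>n. approx n t x)"
  proof (rule metric_CauchyI)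
    fix e :: real assume e: "0 < e"
    obtain y where y: "y \<in> sq_dom D A" "norm (x - y) < e / 4" using sq_dom_dense[of "e/4" x] e by auto
    have "(\<lambda>n. t\<^sup>2 * norm (A (A y)) * (1 / 2) ^ n) \<longlonglongrightarrow> t\<^sup>2 * norm (A (A y)) * 0"
      by (intro tendsto_intros LIMSEQ_power_zero) simp
    then have "\<forall>\<^sub>F n in sequentially. t\<^sup>2 * norm (A (A y)) * (1 / 2) ^ n < e / 4"
      using e by (intro order_tendstoD(2)) auto
    then obtain N where N: "t\<^sup>2 * norm (A (A y)) * (1 / 2) ^ N < e / 4"
      by (auto simp: eventually_sequentially)
    have tail: "norm (approx N t y - approx m t y) < e / 4" if "m \<ge> N" for m
    proof -
      have "norm (approx N t y - approx m t y) \<le> t\<^sup>2 * norm (A (A y)) * (1 / 2) ^ N / 2"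
        using approx_tail[OF y(1) that, of t] by (simp add: field_simps power_one_over)
      also have "\<dots> < e / 4" using N e by linarith
      finally show ?thesis .
    qed
    have near: "norm (approx m t x - approx m t y) < e / 4" for m
      using commutingD(3)[OF commuting_approx, of m t "x - y"] y(2)
      by (simp add: commutingD(6)[OF commuting_approx])
    have "dist (approx m t x) (approx n t x) < e" if mn: "m \<ge> N" "n \<ge> N" for m n
    proof -
      have tri4: "norm (a - b + c - d) \<le> norm a + norm b + norm c + norm d" for a b c d :: 'a
        using norm_triangle_ineq4[of "a - b + c" d] norm_triangle_ineq[of "a - b" c] norm_triangle_ineq4[of a b]
        by linarith
      have "norm (approx m t x - approx n t x) \<le> norm (approx m t x - approx m t y)
          + norm (approx N t y - approx m t y) + norm (approx N t y - approx n t y) + norm (approx n t x - approx n t y)"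
        using tri4[of "approx m t x - approx m t y" "approx N t y - approx m t y"
            "approx N t y - approx n t y" "approx n t x - approx n t y"] by simp
      then show ?thesis
        using tail[OF mn(1)] tail[OF mn(2)] near[of m] near[of n] by (simp add: dist_norm)
    qed
    then show "\<exists>M. \<forall>m\<ge>M. \<forall>n\<ge>M. dist (approx m t x) (approx n t x) < e" by blast
  qed
  then show ?thesis unfolding group_def by (simp add: Cauchy_convergent_iff convergent_LIMSEQ_iff)
qed

lemma commuting_group: "commuting (group t)"
  unfolding commuting_def
proof (intro conjI allI ballI)
  note cc = commutingD[OF commuting_approx]
  fix x y c
  have "(\<lambda>n. approx n t (x + y)) \<longlonglongrightarrow> group t x + group t y"
    unfolding cc by (intro tendsto_intros approx_tendsto)
  then show "group t (x + y) = group t x + group t y" using approx_tendsto LIMSEQ_unique by blast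
  have "(\<lambda>n. approx n t (c *\<^sub>C x)) \<longlonglongrightarrow> c *\<^sub>C group t x"
    unfolding cc by (intro tendsto_intros approx_tendsto)
  then show "group t (c *\<^sub>C x) = c *\<^sub>C group t x" using approx_tendsto LIMSEQ_unique by blast
  show "norm (group t x) \<le> norm x"
    by (rule Lim_bounded[OF tendsto_norm[OF approx_tendsto]]) (use cc(3) in blast)
next
  note cc = commutingD[OF commuting_approx]
  fix x assume x: "x \<in> D"
  have "(\<lambda>n. A (approx n t x)) \<longlonglongrightarrow> group t (A x)"
    using cc(5)[OF x] approx_tendsto by simp
  then have "group t x \<in> D \<and> A (group t x) = group t (A x)"
    using closed_graph[of "\<lambda>n. approx n t x"] cc(4)[OF x] approx_tendsto by blast
  then show "group t x \<in> D" "A (group t x) = group t (A x)" by auto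
qed

lemmas group_simps = commutingD[OF commuting_group]

lemma commuting_eqI:
  assumes "commuting S" "commuting T" "\<And>x. x \<in> sq_dom D A \<Longrightarrow> S x = T x"
  shows "S x = T x"
proof (rule ccontr)
  assume "S x \<noteq> T x"
  then obtain y where y: "y \<in> sq_dom D A" "norm (x - y) < norm (S x - T x) / 2"
    using sq_dom_dense[of "norm (S x - T x) / 2" x] by auto
  have "S x - T x = S (x - y) - T (x - y)"
    using assms(3)[OF y(1)] by (simp add: commutingD(6)[OF assms(1)] commutingD(6)[OF assms(2)])
  then have "norm (S x - T x) \<le> norm (S (x - y)) + norm (T (x - y))" by (metis norm_triangle_ineq4)
  also have "\<dots> \<le> norm (x - y) + norm (x - y)" by (intro add_mono commutingD(3) assms)
  finally show False using y(2) by simp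
qed

lemma funpow_commuting:
  assumes "\<And>x. f (g x) = g (f x)"
  shows "((\<lambda>x. f (g x)) ^^ k) x = (f ^^ k) ((g ^^ k) x)"
proof (induction k arbitrary: x)
  case (Suc k)
  have "g ((f ^^ j) y) = (f ^^ j) (g y)" for j y
    by (induction j) (simp_all only: funpow.simps id_apply comp_apply assms[symmetric])
  then show ?case by (simp only: funpow.simps comp_apply Suc)
qed simp

lemma res_commute: "res a (res b x) = res b (res a x)"
proof (rule commuting_eqI[of "\<lambda>x. res a (res b x)" "\<lambda>x. res b (res a x)"])
  show "commuting (\<lambda>x. res a (res b x))" "commuting (\<lambda>x. res b (res a x))"
    using commuting_comp[OF commuting_res commuting_res] by (auto simp: comp_def)
  fix x assume x: "x \<in> sq_dom D A"
  then have xD: "x \<in> D" by (simp add: sq_dom_def)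
  let ?w = "res a (res b x)"
  note cA = commutingD(4,5)[OF commuting_res]
  have w: "?w \<in> D" "?w - (\<i> * of_real a) *\<^sub>C A ?w = res b x"
    using res[OF disjI2[OF cA(1)[OF xD]]] by auto
  let ?v = "?w - (\<i> * of_real b) *\<^sub>C A ?w"
  have "?v = res a (res b x - (\<i> * of_real b) *\<^sub>C A (res b x))"
    by (simp add: commutingD(2,6)[OF commuting_res] cA xD)
  also have "\<dots> = res a x" using res(2)[of b x] xD by simp
  finally show "?w = res b (res a x)" using res_eqI[OF w(1)] by metis
qed

text \<open>One Euler step of length \<open>a + b\<close> differs from the product of steps \<open>a\<close> and \<open>b\<close> by a term of second order, and
  \<open>2\<^sup>n\<close> such terms with \<open>a\<close> and \<open>b\<close> of order \<open>2\<^sup>-\<^sup>n\<close> vanish in the limit.\<close>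

lemma group_add:
  "group (s + t) x = group s (group t x)"
proof (rule commuting_eqI[of "group (s + t)" "\<lambda>x. group s (group t x)"])
  show "commuting (\<lambda>x. group s (group t x))"
    using commuting_comp[OF commuting_group commuting_group] by (auto simp: comp_def)
  fix x assume x: "x \<in> sq_dom D A"
  have b1: "norm (approx n (s + t) x - approx n s (approx n t x)) \<le> \<bar>s * t\<bar> * norm (A (A x)) * (1 / 2) ^ n" for n
  proof -
    let ?a = "s / 2 ^ n" and ?b = "t / 2 ^ n"
    have pow: "((res ?a \<circ> res ?b) ^^ k) x = (res ?a ^^ k) ((res ?b ^^ k) x)" for k x
      unfolding comp_def by (rule funpow_commuting) (rule res_commute)
    have "norm ((res (?a + ?b) ^^ 2 ^ n) x - ((res ?a \<circ> res ?b) ^^ 2 ^ n) x) \<le> real (2 ^ n) * \<bar>?a * ?b\<bar> * norm (A (A x))"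
      by (rule power_comparison)
        (use x res_split[of _ ?a ?b] in \<open>auto intro!: commuting_comp commuting_res\<close>)
    also have "real (2 ^ n) * \<bar>?a * ?b\<bar> * norm (A (A x)) = \<bar>s * t\<bar> * norm (A (A x)) * (1 / 2) ^ n"
      by (simp add: abs_mult field_simps power_one_over)
    finally show ?thesis unfolding pow by (simp add: approx_def add_divide_distrib)
  qed
  have "(\<lambda>n. \<bar>s * t\<bar> * norm (A (A x)) * (1 / 2) ^ n) \<longlonglongrightarrow> \<bar>s * t\<bar> * norm (A (A x)) * 0"
    by (intro tendsto_intros LIMSEQ_power_zero) simp
  then have 1: "(\<lambda>n. approx n (s + t) x - approx n s (approx n t x)) \<longlonglongrightarrow> 0"
    by - (rule Lim_null_comparison[OF always_eventually[OF allI[OF b1]]], simp)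
  have b2: "norm (approx n s (approx n t x) - approx n s (group t x)) \<le> norm (approx n t x - group t x)" for n
    using commutingD(3,6)[OF commuting_approx] by metis
  have "(\<lambda>n. norm (approx n t x - group t x)) \<longlonglongrightarrow> 0"
    using approx_tendsto[of t x] by (simp add: LIM_zero_iff tendsto_norm_zero_iff)
  then have 2: "(\<lambda>n. approx n s (approx n t x) - approx n s (group t x)) \<longlonglongrightarrow> 0"
    by (rule Lim_null_comparison[OF always_eventually[OF allI[OF b2]]])
  have "(\<lambda>n. (approx n (s + t) x - approx n s (approx n t x)) + (approx n s (approx n t x) - approx n s (group t x))
       + approx n s (group t x)) \<longlonglongrightarrow> 0 + 0 + group s (group t x)"
    by (intro tendsto_add 1 2 approx_tendsto)
  then have "(\<lambda>n. approx n (s + t) x) \<longlonglongrightarrow> group s (group t x)" by simp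
  then show "group (s + t) x = group s (group t x)" using approx_tendsto LIMSEQ_unique by blast
qed (rule commuting_group)

lemma group_0: "group 0 x = x"
proof -
  have "(id ^^ k) x = x" for k and x :: 'a by (induction k) auto
  moreover have "res 0 = id" by (auto simp: res_def)
  ultimately have "approx n 0 x = x" for n by (simp add: approx_def)
  then show ?thesis by (simp add: group_def)
qed

lemma group_near_id:
  assumes "x \<in> D" shows "norm (group t x - x) \<le> \<bar>t\<bar> * norm (A x)"
proof -
  have pow: "norm ((res e ^^ k) x - x) \<le> real k * (\<bar>e\<bar> * norm (A x))" for e k
  proof (induction k)
    case (Suc k)
    have "(res e ^^ Suc k) x - x = res e ((res e ^^ k) x - x) + (res e x - x)"
      by (simp add: commutingD(6)[OF commuting_res])
    then have "norm ((res e ^^ Suc k) x - x) \<le> norm (res e ((res e ^^ k) x - x)) + norm (res e x - x)"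
      by (metis norm_triangle_ineq)
    also have "\<dots> \<le> real k * (\<bar>e\<bar> * norm (A x)) + \<bar>e\<bar> * norm (A x)"
      by (intro add_mono res_near_id[OF assms] order_trans[OF commutingD(3)[OF commuting_res] Suc.IH])
    finally show ?case by (simp add: algebra_simps)
  qed simp
  have "norm (approx n t x - x) \<le> \<bar>t\<bar> * norm (A x)" for n
    using pow[where k = "2 ^ n" and e = "t / 2 ^ n"] by (simp add: approx_def)
  then show ?thesis
    by (intro Lim_bounded[OF tendsto_norm[OF tendsto_diff[OF approx_tendsto tendsto_const]]]) auto
qed

text \<open>The whole limit differs from its first approximant, a single Euler step, only to second order in \<open>t\<close>.\<close>

lemma group_derivative_bound:
  assumes x: "x \<in> sq_dom D A"
  shows "norm (group t x - x - t *\<^sub>R (\<i> *\<^sub>C A x)) \<le> 2 * t\<^sup>2 * norm (A (A x))"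
proof -
  have xD: "x \<in> D" "A x \<in> D" using x by (auto simp: sq_dom_def)
  have "norm (approx 0 t x - approx m t x) \<le> t\<^sup>2 / 2 * norm (A (A x))" for m
    using approx_tail[OF x, of 0 m t] by simp
  then have 1: "norm (approx 0 t x - group t x) \<le> t\<^sup>2 / 2 * norm (A (A x))"
    by (intro Lim_bounded[OF tendsto_norm[OF tendsto_diff[OF tendsto_const approx_tendsto]]]) auto
  have "res t x - x = (\<i> * of_real t) *\<^sub>C res t (A x)"
    using res(2)[of t x] xD commutingD(5)[OF commuting_res xD(1)] by (simp add: algebra_simps)
  then have "res t x - x - t *\<^sub>R (\<i> *\<^sub>C A x) = (\<i> * of_real t) *\<^sub>C (res t (A x) - A x)"
    by (simp add: cscale_diff_right cscale_cscale cscale_of_real[symmetric] mult.commute)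
  then have "norm (res t x - x - t *\<^sub>R (\<i> *\<^sub>C A x)) \<le> \<bar>t\<bar> * (\<bar>t\<bar> * norm (A (A x)))"
    using res_near_id[OF xD(2), of t] by (simp add: norm_cscale norm_mult mult_left_mono)
  then have 2: "norm (res t x - x - t *\<^sub>R (\<i> *\<^sub>C A x)) \<le> t\<^sup>2 * norm (A (A x))"
    by (simp add: power2_eq_square mult.assoc[symmetric])
  have "group t x - x - t *\<^sub>R (\<i> *\<^sub>C A x) = (res t x - x - t *\<^sub>R (\<i> *\<^sub>C A x)) - (approx 0 t x - group t x)"
    by (simp add: approx_def)
  then have "norm (group t x - x - t *\<^sub>R (\<i> *\<^sub>C A x))
     \<le> norm (res t x - x - t *\<^sub>R (\<i> *\<^sub>C A x)) + norm (approx 0 t x - group t x)"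
    by (simp only: norm_triangle_ineq4)
  also have "\<dots> \<le> t\<^sup>2 * norm (A (A x)) + t\<^sup>2 / 2 * norm (A (A x))" by (intro add_mono 1 2)
  also have "\<dots> \<le> 2 * t\<^sup>2 * norm (A (A x))" by (simp add: algebra_simps)
  finally show ?thesis .
qed

end

section \<open>Strongly continuous semigroups\<close>

text \<open>The Banach--Steinhaus theorem for sequences: by the Baire category theorem one of the sets on which all operators
  are bounded by \<open>N\<close> contains a ball.\<close>

lemma uniform_boundedness:
  fixes F :: "nat \<Rightarrow> 'a::{real_normed_vector,complete_space} \<Rightarrow> 'b::real_normed_vector"
  assumes lin: "\<And>n. bounded_linear (F n)" and pw: "\<And>x. \<exists>B. \<forall>n. norm (F n x) \<le> B"
  shows "\<exists>B. \<forall>n x. norm (F n x) \<le> B * norm x"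
proof -
  define E where "E N = {x. \<forall>n. norm (F n x) \<le> real N}" for N :: nat
  have "closed (E N)" for N
  proof -
    have "E N = (\<Inter>n. {x. norm (F n x) \<le> real N})" by (auto simp: E_def)
    moreover have "closed {x. norm (F n x) \<le> real N}" for n
      by (intro closed_Collect_le continuous_on_norm linear_continuous_on lin continuous_on_const)
    ultimately show ?thesis by auto
  qed
  moreover have "(\<Union>N. E N) = UNIV"
  proof -
    have "x \<in> (\<Union>N. E N)" for x
    proof -
      obtain B where "\<forall>n. norm (F n x) \<le> B" using pw by blast
      moreover obtain N where "B \<le> real N" using real_arch_simple by blast
      ultimately show ?thesis by (auto simp: E_def intro: order_trans)
    qed
    then show ?thesis by auto
  qed
  ultimately have "\<exists>N. interior (E N) \<noteq> {}"
    using Met_TC.metric_Baire_category_alt[of "range E"]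
    by (force simp: Met_TC.mcomplete_def Met_TC.MCauchy_def complete_UNIV[unfolded complete_def] mcomplete_iff_complete)
  then obtain N x0 where "x0 \<in> interior (E N)" by blast
  then obtain r where r: "r > 0" "ball x0 r \<subseteq> E N" using mem_interior by blast
  have "norm (F n x) \<le> (4 * real N / r) * norm x" for n x
  proof (cases "x = 0")
    case True
    then show ?thesis using linear_simps(3)[OF lin] by simp
  next
    case False
    interpret F: bounded_linear "F n" by (rule lin)
    define s where "s = r / (2 * norm x)"
    have s: "s > 0" using r False by (simp add: s_def)
    have "norm (s *\<^sub>R x) < r" using r False by (simp add: s_def)
    then have "x0 + s *\<^sub>R x \<in> ball x0 r" "x0 \<in> ball x0 r" using r by (auto simp: dist_norm)
    then have b: "norm (F n (x0 + s *\<^sub>R x)) \<le> N" "norm (F n x0) \<le> N" using r(2) unfolding E_def by blast+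
    have "s *\<^sub>R F n x = F n (x0 + s *\<^sub>R x) - F n x0" by (simp add: F.add F.scaleR)
    then have "norm (s *\<^sub>R F n x) \<le> real N + real N"
      using norm_triangle_ineq4[of "F n (x0 + s *\<^sub>R x)" "F n x0"] b by simp
    then have "norm (F n x) \<le> 2 * real N / s" using s by (simp add: field_simps)
    also have "\<dots> = (4 * real N / r) * norm x" using False r by (simp add: s_def field_simps)
    finally show ?thesis .
  qed
  then show ?thesis by blast
qed

text \<open>If the operators were unbounded near time zero, a sequence of times tending to zero would contradict
  the uniform boundedness principle; the semigroup law then propagates the bound to every compact interval.\<close>

lemma c0_semigroup_locally_bounded:
  fixes T :: "real \<Rightarrow> 'a::complex_hilbert \<Rightarrow> 'a"
  assumes T: "c0_semigroup T"
  shows "\<exists>K. \<forall>s\<in>{0..t}. \<forall>x. norm (T s x) \<le> K * norm x"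
proof -
  have lin: "bounded_linear (T s)" if "s \<ge> 0" for s
    using T that unfolding c0_semigroup_def bounded_clinear_def by blast
  have T0: "T 0 x = x" for x using T unfolding c0_semigroup_def by blast
  have T_add: "T (s + u) x = T s (T u x)" if "s \<ge> 0" "u \<ge> 0" for s u x
    using T that unfolding c0_semigroup_def by blast
  have "\<exists>d>0. \<exists>K. \<forall>s\<in>{0..d}. \<forall>x. norm (T s x) \<le> K * norm x"
  proof (rule ccontr)
    assume "\<not> ?thesis"
    then have "\<exists>s\<in>{0..inverse (real (Suc n))}. \<exists>x. norm (T s x) > real n * norm x" for n
      by (meson not_le inverse_positive_iff_positive of_nat_0_less_iff zero_less_Suc)
    then obtain s where s: "\<And>n. s n \<in> {0..inverse (real (Suc n))}"
      "\<And>n. \<exists>x. norm (T (s n) x) > real n * norm x" by metis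
    have s_lim: "s \<longlonglongrightarrow> 0"
      by (rule tendsto_sandwich[OF _ _ tendsto_const LIMSEQ_inverse_real_of_nat])
        (use s(1) in \<open>auto intro!: always_eventually\<close>)
    have "\<exists>B. \<forall>n. norm (T (s n) x) \<le> B" for x
    proof -
      have lim0: "((\<lambda>t. T t x) \<longlongrightarrow> T 0 x) (at 0 within {0..})"
        using T unfolding c0_semigroup_def T0 by (simp add: at_within_Ici_at_right)
      have "(\<lambda>n. T (s n) x) \<longlonglongrightarrow> T 0 x"
        using continuous_within_tendsto_compose[of 0 "{0..}" "\<lambda>t. T t x" s sequentially] lim0 s(1) s_lim
        unfolding continuous_within by (auto intro!: always_eventually)
      then have "Bseq (\<lambda>n. T (s n) x)" using convergentI convergent_imp_Bseq by blast
      then show ?thesis by (auto simp: Bseq_def)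
    qed
    then obtain B where B: "\<And>n x. norm (T (s n) x) \<le> B * norm x"
      using uniform_boundedness[of "\<lambda>n. T (s n)"] lin s(1) by (auto simp del: of_nat_Suc)
    obtain n where "B \<le> real n" using real_arch_simple by blast
    then have "norm (T (s n) x) \<le> real n * norm x" for x
      using B[of n x] by (meson mult_right_mono norm_ge_zero order_trans)
    then show False using s(2)[of n] by (simp add: not_le[symmetric])
  qed
  then obtain d K where d: "d > 0" and K: "\<And>s x. s \<in> {0..d} \<Longrightarrow> norm (T s x) \<le> K * norm x" by blast
  have K0: "norm (T s x) \<le> \<bar>K\<bar> * norm x" if "s \<in> {0..d}" for s x
    using K[OF that, of x] by (meson abs_ge_self mult_right_mono norm_ge_zero order_trans)
  have step: "\<exists>K'\<ge>0. \<forall>s\<in>{0..real n * d}. \<forall>x. norm (T s x) \<le> K' * norm x" for n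
  proof (induction n)
    case 0
    show ?case by (rule exI[of _ 1]) (simp add: T0)
  next
    case (Suc n)
    then obtain K' where K': "K' \<ge> 0" "\<And>s x. s \<in> {0..real n * d} \<Longrightarrow> norm (T s x) \<le> K' * norm x" by blast
    have "norm (T s x) \<le> (K' + \<bar>K\<bar> * K' + \<bar>K\<bar>) * norm x" if s: "s \<in> {0..real (Suc n) * d}" for s x
    proof (cases "s \<le> real n * d")
      case True
      then have "norm (T s x) \<le> K' * norm x" using s by (intro K') auto
      also have "\<dots> \<le> (K' + \<bar>K\<bar> * K' + \<bar>K\<bar>) * norm x" using K'(1) by (intro mult_right_mono) auto
      finally show ?thesis .
    next
      case False
      let ?u = "s - real n * d"
      have u: "?u \<in> {0..d}" using s False by (auto simp: algebra_simps)
      have "norm (T s x) = norm (T ?u (T (real n * d) x))"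
        using T_add[of ?u "real n * d" x] u d by simp
      also have "\<dots> \<le> \<bar>K\<bar> * norm (T (real n * d) x)" by (rule K0[OF u])
      also have "\<dots> \<le> \<bar>K\<bar> * (K' * norm x)" by (intro mult_left_mono K'(2)) (use d in auto)
      also have "\<dots> \<le> (K' + \<bar>K\<bar> * K' + \<bar>K\<bar>) * norm x" using K'(1) by (simp add: algebra_simps)
      finally show ?thesis .
    qed
    moreover have "0 \<le> K' + \<bar>K\<bar> * K' + \<bar>K\<bar>" using K'(1) by simp
    ultimately show ?case by blast
  qed
  obtain n where "t / d \<le> real n" using real_arch_simple by blast
  then have "t \<le> real n * d" using d by (simp add: field_simps)
  then show ?thesis using step[of n] by (meson atLeastAtMost_iff order_trans)
qed

text \<open>The properties shared by a semigroup given through its generator and by the group constructed above. Only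
  boundedness on compact time intervals is assumed, because contractivity is deduced from the differentiability of
  orbits, which itself relies on such a bound.\<close>

locale generated_semigroup =
  fixes S :: "real \<Rightarrow> 'a::complex_hilbert \<Rightarrow> 'a" and D :: "'a set" and G :: "'a \<Rightarrow> 'a"
  assumes S_lin: "t \<ge> 0 \<Longrightarrow> bounded_linear (S t)"
    and S_0: "S 0 x = x"
    and S_add: "\<lbrakk>s \<ge> 0; t \<ge> 0\<rbrakk> \<Longrightarrow> S (s + t) x = S s (S t x)"
    and S_cont: "((\<lambda>t. S t x) \<longlongrightarrow> x) (at_right 0)"
    and S_bounded: "\<exists>K. \<forall>s\<in>{0..t}. \<forall>x. norm (S s x) \<le> K * norm x"
    and S_gen: "x \<in> D \<Longrightarrow> ((\<lambda>t. (1 / t) *\<^sub>R (S t x - x)) \<longlongrightarrow> G x) (at_right 0)"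
    and S_D: "\<lbrakk>x \<in> D; t \<ge> 0\<rbrakk> \<Longrightarrow> S t x \<in> D"
    and S_G: "\<lbrakk>x \<in> D; t \<ge> 0\<rbrakk> \<Longrightarrow> G (S t x) = S t (G x)"
begin

lemma S_diff: "t \<ge> 0 \<Longrightarrow> S t (x - y) = S t x - S t y"
  and S_scaleR: "t \<ge> 0 \<Longrightarrow> S t (r *\<^sub>R x) = r *\<^sub>R S t x"
  using linear_simps[OF S_lin] by auto

text \<open>The right derivative is the semigroup law applied to the generator limit at zero. For the left
  derivative the increment is written as \<open>S (t - h)\<close> applied to an increment at zero, which needs the bound
  on \<open>S\<close> over a whole interval.\<close>

lemma S_derivative:
  assumes x: "x \<in> D" and t: "t \<ge> 0"
  shows "((\<lambda>t. S t x) has_vector_derivative S t (G x)) (at t within {0..})"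
  unfolding has_vector_derivative_def has_derivative_within_alt
proof (intro conjI allI impI bounded_linear_scaleR_left)
  fix e :: real assume e: "e > 0"
  obtain K0 where K0: "\<And>s x. s \<in> {0..t + 1} \<Longrightarrow> norm (S s x) \<le> K0 * norm x"
    using S_bounded[of "t + 1"] by blast
  define K where "K = max K0 1"
  have K1: "K \<ge> 1" by (simp add: K_def)
  have K: "norm (S s x) \<le> K * norm x" if "s \<in> {0..t + 1}" for s x
    by (rule order_trans[OF K0[OF that] mult_right_mono]) (simp_all add: K_def)
  define e' where "e' = e / (2 * K)"
  have e': "e' > 0" "2 * K * e' = e" using e K1 by (auto simp: e'_def)
  have "\<forall>\<^sub>F h in at_right 0. dist ((1 / h) *\<^sub>R (S h x - x)) (G x) < e'"
    by (rule tendstoD[OF S_gen[OF x] e'(1)])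
  moreover have "\<forall>\<^sub>F h in at_right 0. dist (S h (G x)) (G x) < e'"
    by (rule tendstoD[OF S_cont e'(1)])
  ultimately have "\<forall>\<^sub>F h in at_right 0. dist ((1 / h) *\<^sub>R (S h x - x)) (G x) < e' \<and> dist (S h (G x)) (G x) < e'"
    by (rule eventually_conj)
  then obtain b where b: "b > 0"
    "\<And>h. 0 < h \<Longrightarrow> h < b \<Longrightarrow> dist ((1 / h) *\<^sub>R (S h x - x)) (G x) < e' \<and> dist (S h (G x)) (G x) < e'"
    unfolding eventually_at_right_field by auto
  have r: "norm (S h x - x - h *\<^sub>R G x) \<le> e' * h" if h: "0 < h" "h < b" for h
  proof -
    have "S h x - x - h *\<^sub>R G x = h *\<^sub>R ((1 / h) *\<^sub>R (S h x - x) - G x)"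
      using h by (simp add: scaleR_diff_right)
    then have "norm (S h x - x - h *\<^sub>R G x) = h * norm ((1 / h) *\<^sub>R (S h x - x) - G x)"
      using h by simp
    also have "\<dots> \<le> h * e'" using b(2)[OF h] h by (intro mult_left_mono) (auto simp: dist_norm)
    finally show ?thesis by (simp add: mult.commute)
  qed
  have main: "norm (S y x - S t x - (y - t) *\<^sub>R S t (G x)) \<le> e * norm (y - t)"
    if y: "y \<in> {0..}" "norm (y - t) < min b 1" for y
  proof (cases y t rule: linorder_cases)
    case equal
    then show ?thesis by simp
  next
    case greater
    let ?h = "y - t"
    have h: "0 < ?h" "?h < b" using greater y by auto
    have "S y x = S t (S ?h x)" using S_add[of t ?h x] t h by simp
    then have eq: "S y x - S t x - ?h *\<^sub>R S t (G x) = S t (S ?h x - x - ?h *\<^sub>R G x)"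
      using t by (simp add: S_diff S_scaleR)
    have "norm (S y x - S t x - ?h *\<^sub>R S t (G x)) \<le> K * (e' * ?h)"
      unfolding eq by (rule order_trans[OF K mult_left_mono[OF r[OF h]]]) (use t K1 in auto)
    also have "\<dots> \<le> (2 * K * e') * ?h" using h K1 e'(1) by simp
    finally show ?thesis using h e'(2) by simp
  next
    case less
    define h where "h = t - y"
    have h: "0 < h" "h < b" using less y by (auto simp: h_def)
    have y0: "0 \<le> y" "y \<in> {0..t + 1}" using y less by auto
    have St: "S t v = S y (S h v)" for v using S_add[of y h v] y0 h by (simp add: h_def)
    have yt: "y - t = - h" by (simp add: h_def)
    have eq: "S y x - S t x - (y - t) *\<^sub>R S t (G x)
       = h *\<^sub>R S y (S h (G x) - G x) - S y (S h x - x - h *\<^sub>R G x)"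
      unfolding St yt by (simp add: S_diff[OF y0(1)] S_scaleR[OF y0(1)] scaleR_diff_right)
    have near: "norm (S h (G x) - G x) \<le> e'" using b(2)[OF h] by (simp add: dist_norm)
    have "norm (S y (S h (G x) - G x)) \<le> K * e'"
      by (rule order_trans[OF K[OF y0(2)] mult_left_mono[OF near]]) (use K1 in simp)
    then have 1: "norm (h *\<^sub>R S y (S h (G x) - G x)) \<le> h * (K * e')"
      using h by simp
    have 2: "norm (S y (S h x - x - h *\<^sub>R G x)) \<le> K * (e' * h)"
      by (rule order_trans[OF K[OF y0(2)] mult_left_mono[OF r[OF h]]]) (use K1 in simp)
    have "norm (S y x - S t x - (y - t) *\<^sub>R S t (G x)) \<le> h * (K * e') + K * (e' * h)"
      unfolding eq by (rule order_trans[OF norm_triangle_ineq4 add_mono[OF 1 2]])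
    also have "\<dots> = (2 * K * e') * h" by (simp add: algebra_simps)
    finally show ?thesis using h e'(2) by (simp add: yt)
  qed
  show "\<exists>d>0. \<forall>y\<in>{0..}. norm (y - t) < d \<longrightarrow>
     norm (S y x - S t x - (y - t) *\<^sub>R S t (G x)) \<le> e * norm (y - t)"
    by (rule exI[of _ "min b 1"]) (use main b(1) in auto)
qed

end

text \<open>Applying \<open>T t\<close> to the difference quotient at \<open>x\<close> gives the difference quotient at \<open>T t x\<close>, so orbits stay in the
  domain and the generator commutes with the semigroup.\<close>

lemma generated_semigroup_intro:
  assumes "is_semigroup_generated_by T D G"
  shows "generated_semigroup T D G"
proof -
  have c0: "c0_semigroup T" and gen: "\<And>x w. ((\<lambda>t. (1 / t) *\<^sub>R (T t x - x)) \<longlongrightarrow> w) (at_right 0) \<longleftrightarrow> x \<in> D \<and> w = G x"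
    using assms unfolding is_semigroup_generated_by_def by blast+
  have lin: "bounded_linear (T s)" if "s \<ge> 0" for s
    using c0 that unfolding c0_semigroup_def bounded_clinear_def by blast
  have T_add: "T (s + u) x = T s (T u x)" if "s \<ge> 0" "u \<ge> 0" for s u x
    using c0 that unfolding c0_semigroup_def by blast
  have *: "T t x \<in> D \<and> T t (G x) = G (T t x)" if x: "x \<in> D" and t: "t \<ge> 0" for x t
  proof -
    interpret Tt: bounded_linear "T t" using lin[OF t] .
    have "((\<lambda>h. T t ((1 / h) *\<^sub>R (T h x - x))) \<longlongrightarrow> T t (G x)) (at_right 0)"
      using gen x by (intro Tt.tendsto) blast
    moreover have "\<forall>\<^sub>F h in at_right 0. T t ((1 / h) *\<^sub>R (T h x - x)) = (1 / h) *\<^sub>R (T h (T t x) - T t x)"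
    proof (rule eventually_at_right_less[THEN eventually_mono])
      fix h :: real assume "0 < h"
      then have "T t (T h x) = T h (T t x)" using T_add[of t h x] T_add[of h t x] t by (simp add: add.commute)
      then show "T t ((1 / h) *\<^sub>R (T h x - x)) = (1 / h) *\<^sub>R (T h (T t x) - T t x)"
        by (simp add: Tt.scaleR Tt.diff)
    qed
    ultimately have "((\<lambda>h. (1 / h) *\<^sub>R (T h (T t x) - T t x)) \<longlongrightarrow> T t (G x)) (at_right 0)"
      using tendsto_cong by fast
    then show ?thesis using gen by blast
  qed
  show ?thesis
  proof (rule generated_semigroup.intro)
    show "T 0 x = x" "((\<lambda>t. T t x) \<longlongrightarrow> x) (at_right 0)" for x using c0 unfolding c0_semigroup_def by blast+
    show "x \<in> D \<Longrightarrow> ((\<lambda>t. (1 / t) *\<^sub>R (T t x - x)) \<longlongrightarrow> G x) (at_right 0)" for x using gen by blast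
  qed (use lin T_add * c0_semigroup_locally_bounded[OF c0] in auto)
qed

lemma energy_derivative:
  fixes u :: "real \<Rightarrow> 'a::real_inner"
  assumes "(u has_vector_derivative v) (at t within T)"
  shows "((\<lambda>t. (norm (u t))\<^sup>2) has_real_derivative 2 * inner v (u t)) (at t within T)"
proof -
  have "((\<lambda>t. inner (u t) (u t)) has_vector_derivative (inner (u t) v + inner v (u t))) (at t within T)"
    by (rule bounded_bilinear.has_vector_derivative[OF bounded_bilinear_inner assms assms])
  then show ?thesis
    by (simp add: has_real_derivative_iff_has_vector_derivative power2_norm_eq_inner inner_commute)
qed

lemma nonincreasing_from_derivative:
  fixes f :: "real \<Rightarrow> real"
  assumes der: "\<And>t. t \<ge> 0 \<Longrightarrow> (f has_real_derivative f' t) (at t within {0..})"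
    and neg: "\<And>t. t \<ge> 0 \<Longrightarrow> f' t \<le> 0" and st: "0 \<le> s" "s \<le> t"
  shows "f t \<le> f s"
proof (rule DERIV_nonpos_imp_decreasing_open[OF st(2)])
  fix x assume x: "s < x" "x < t"
  then have "at x within {0..} = at x" using st by (intro at_within_interior) (auto simp: interior_real_atLeast)
  then show "\<exists>y. DERIV f x :> y \<and> y \<le> 0" using der[of x] neg[of x] x st by auto
next
  show "continuous_on {s..t} f"
    by (rule DERIV_continuous_on[where D = f'], rule DERIV_subset[OF der]) (use st in auto)
qed

locale contraction_semigroup = generated_semigroup +
  assumes contraction: "t \<ge> 0 \<Longrightarrow> norm (S t x) \<le> norm x"
begin

lemma S_lipschitz:
  assumes x: "x \<in> D" and st: "s \<ge> 0" "t \<ge> 0"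
  shows "norm (S t x - S s x) \<le> \<bar>t - s\<bar> * norm (G x)"
proof -
  have "norm (S t x - S s x) \<le> norm (G x) * norm (t - s)"
  proof (rule differentiable_bound[where S = "{0..}" and f' = "\<lambda>t h. h *\<^sub>R S t (G x)"])
    show "((\<lambda>t. S t x) has_derivative (\<lambda>h. h *\<^sub>R S u (G x))) (at u within {0..})" if "u \<in> {0..}" for u
      using S_derivative[OF x, of u] that by (simp add: has_vector_derivative_def)
    show "onorm (\<lambda>h. h *\<^sub>R S u (G x)) \<le> norm (G x)" if "u \<in> {0..}" for u
      by (rule onorm_bound) (use contraction[of u "G x"] that in \<open>auto simp: mult.commute intro: mult_left_mono\<close>)
  qed (use st in auto)
  then show ?thesis by (simp add: mult.commute)
qed

text \<open>The expansion is around \<open>t\<close>, the right end of a forward step, because the implicit scheme evaluates the equation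
  there; the case \<open>t < s\<close> is included for curves run backward. The derivative \<open>S u (G x)\<close> is Lipschitz in \<open>u\<close>
  since \<open>G x\<close> is in the domain.\<close>

lemma S_taylor:
  assumes x: "x \<in> D" "G x \<in> D" and st: "s \<ge> 0" "t \<ge> 0"
  shows "norm (S t x - S s x - (t - s) *\<^sub>R S t (G x)) \<le> (t - s)\<^sup>2 * norm (G (G x))"
proof -
  let ?I = "{min s t..max s t}"
  have I0: "u \<ge> 0" if "u \<in> ?I" for u using that st by auto
  have "norm (S s x - S t x - (\<lambda>h. h *\<^sub>R S t (G x)) (s - t)) \<le> norm (s - t) * (\<bar>t - s\<bar> * norm (G (G x)))"
  proof (rule differentiable_bound_linearization[where S = ?I and f = "\<lambda>t. S t x" and f' = "\<lambda>u h. h *\<^sub>R S u (G x)"])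
    show "t + r *\<^sub>R (s - t) \<in> ?I" if "r \<in> {0..1}" for r
    proof -
      have "t + r *\<^sub>R (s - t) = (1 - r) * t + r * s" by (simp add: algebra_simps)
      moreover have "(1 - r) * min s t + r * min s t \<le> (1 - r) * t + r * s"
        using that by (intro add_mono mult_left_mono) auto
      moreover have "(1 - r) * t + r * s \<le> (1 - r) * max s t + r * max s t"
        using that by (intro add_mono mult_left_mono) auto
      ultimately show ?thesis by (simp add: algebra_simps)
    qed
    show "((\<lambda>t. S t x) has_derivative (\<lambda>h. h *\<^sub>R S u (G x))) (at u within ?I)" if "u \<in> ?I" for u
    proof (rule has_derivative_subset[of _ _ _ "{0..}"])
      show "((\<lambda>t. S t x) has_derivative (\<lambda>h. h *\<^sub>R S u (G x))) (at u within {0..})"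
        using S_derivative[OF x(1) I0[OF that]] by (simp add: has_vector_derivative_def)
    qed (use I0 in auto)
    show "onorm ((\<lambda>h. h *\<^sub>R S u (G x)) - (\<lambda>h. h *\<^sub>R S t (G x))) \<le> \<bar>t - s\<bar> * norm (G (G x))" if u: "u \<in> ?I" for u
    proof (rule onorm_bound)
      fix h :: real
      have "norm (S u (G x) - S t (G x)) \<le> \<bar>u - t\<bar> * norm (G (G x))" by (rule S_lipschitz[OF x(2) st(2) I0[OF u]])
      also have "\<dots> \<le> \<bar>t - s\<bar> * norm (G (G x))" using u by (intro mult_right_mono) auto
      finally have "\<bar>h\<bar> * norm (S u (G x) - S t (G x)) \<le> \<bar>h\<bar> * (\<bar>t - s\<bar> * norm (G (G x)))" by (intro mult_left_mono) auto
      then show "norm (((\<lambda>h. h *\<^sub>R S u (G x)) - (\<lambda>h. h *\<^sub>R S t (G x))) h) \<le> \<bar>t - s\<bar> * norm (G (G x)) * norm h"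
        by (simp add: fun_diff_def scaleR_diff_right[symmetric] mult_ac)
    qed simp
  qed auto
  moreover have "S s x - S t x - (s - t) *\<^sub>R S t (G x) = - (S t x - S s x - (t - s) *\<^sub>R S t (G x))"
    by (simp add: algebra_simps)
  ultimately have "norm (S t x - S s x - (t - s) *\<^sub>R S t (G x)) \<le> norm (s - t) * (\<bar>t - s\<bar> * norm (G (G x)))"
    by (metis norm_minus_cancel)
  also have "\<dots> = (t - s)\<^sup>2 * norm (G (G x))"
    by (simp add: power2_eq_square abs_minus_commute[of s t] mult.assoc[symmetric])
  finally show ?thesis .
qed

end

lemma contraction_on_closure:
  fixes T :: "'a::real_normed_vector \<Rightarrow> 'b::real_normed_vector"
  assumes "bounded_linear T" "closure D = UNIV" "\<And>x. x \<in> D \<Longrightarrow> norm (T x) \<le> k * norm x"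
  shows "norm (T x) \<le> k * norm x"
proof -
  have "closed {x. norm (T x) \<le> k * norm x}"
    by (intro closed_Collect_le continuous_intros linear_continuous_on assms)
  then have "closure D \<subseteq> {x. norm (T x) \<le> k * norm x}" by (intro closure_minimal) (use assms in auto)
  then show ?thesis using assms(2) by auto
qed

text \<open>Along an orbit the squared norm has derivative \<open>2 * inner (G x) x\<close> at the current point \<open>x\<close>.\<close>

lemma (in generated_semigroup) contraction_if_dissipative:
  assumes "closure D = UNIV" "\<And>x. x \<in> D \<Longrightarrow> inner (G x) x \<le> 0"
  shows "contraction_semigroup S D G"
proof (rule contraction_semigroup.intro[OF generated_semigroup_axioms contraction_semigroup_axioms.intro])
  fix t :: real and x assume t: "t \<ge> 0"
  have "norm (S t x) \<le> norm x" if x: "x \<in> D" for x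
  proof -
    have "(norm (S t x))\<^sup>2 \<le> (norm (S 0 x))\<^sup>2"
    proof (rule nonincreasing_from_derivative[where f = "\<lambda>t. (norm (S t x))\<^sup>2" and f' = "\<lambda>s. 2 * inner (S s (G x)) (S s x)"])
      show "((\<lambda>t. (norm (S t x))\<^sup>2) has_real_derivative 2 * inner (S s (G x)) (S s x)) (at s within {0..})" if "s \<ge> 0" for s
        by (rule energy_derivative[OF S_derivative[OF x that]])
      show "2 * inner (S s (G x)) (S s x) \<le> 0" if "s \<ge> 0" for s
        using assms(2)[OF S_D[OF x that]] S_G[OF x that] by simp
    qed (use t in auto)
    from power2_le_imp_le[OF this norm_ge_zero] show ?thesis by (simp add: S_0)
  qed
  then show "norm (S t x) \<le> norm x"
    using contraction_on_closure[OF S_lin[OF t] assms(1), of 1] by simp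
qed

section \<open>The group as a semigroup and uniqueness of free motions\<close>

context selfadjoint
begin

lemma res_approximates_id:
  assumes e: "e > 0" shows "\<exists>d>0. norm (v - res d v) < e"
proof -
  obtain w where w: "w \<in> sq_dom D A" "norm (v - w) < e / 3" using sq_dom_dense[of "e / 3" v] e by auto
  then have wD: "w \<in> D" by (simp add: sq_dom_def)
  define b where "b = norm (A w) + 1"
  have b: "b > 0" unfolding b_def by (simp add: add_nonneg_pos)
  define d where "d = e / (3 * b)"
  have d: "d > 0" unfolding d_def using e b by simp
  have "norm (w - res d w) \<le> d * norm (A w)" using res_near_id[OF wD, of d] d by (simp add: norm_minus_commute)
  also have "\<dots> < d * b" using d by (simp add: b_def)
  finally have 1: "norm (w - res d w) < e / 3" using b by (simp add: d_def)
  have 2: "norm (res d (v - w)) < e / 3"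
    using commutingD(3)[OF commuting_res] w(2) by (rule le_less_trans)
  have eq: "v - res d v = (v - w) + (w - res d w) - res d (v - w)"
    by (simp add: commutingD(6)[OF commuting_res])
  have "norm (v - res d v) \<le> norm (v - w) + norm (w - res d w) + norm (res d (v - w))"
    unfolding eq by (rule order_trans[OF norm_triangle_ineq4 add_right_mono[OF norm_triangle_ineq]])
  then show ?thesis using d 1 2 w(2) by (intro exI[of _ d]) linarith
qed

text \<open>For vectors in the domain of \<open>A\<^sup>2\<close> the second-order bound gives the derivative. A general \<open>x\<close> in \<open>D\<close> is replaced
  by \<open>res d x\<close>, which is close to \<open>x\<close> in the graph norm, and increments of the group are controlled by that norm.\<close>

lemma group_generator:
  assumes x: "x \<in> D"
  shows "((\<lambda>h. (1 / h) *\<^sub>R (group h x - x)) \<longlongrightarrow> \<i> *\<^sub>C A x) (at_right 0)"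
proof (rule tendstoI)
  fix e :: real assume e: "e > 0"
  obtain d where d: "d > 0" "norm (A x - res d (A x)) < e / 3" using res_approximates_id[of "e / 3" "A x"] e by auto
  define y where "y = res d x"
  have y: "y \<in> D" "A y = res d (A x)" and y2: "y \<in> sq_dom D A"
    using res(1)[of d] d(1) commutingD(5)[OF commuting_res x, of d]
    by (auto simp: y_def sq_dom_def)
  have A: "norm (A (x - y)) < e / 3" using d(2) by (simp add: A_diff x y)
  define b where "b = 2 * norm (A (A y)) + 1"
  have b: "b > 0" unfolding b_def by (simp add: add_nonneg_pos)
  have "dist ((1 / h) *\<^sub>R (group h x - x)) (\<i> *\<^sub>C A x) < e" if h: "0 < h" "h < e / (3 * b)" for h
  proof -
    let ?u = "(1 / h) *\<^sub>R (group h (x - y) - (x - y))"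
      and ?v = "(1 / h) *\<^sub>R (group h y - y - h *\<^sub>R (\<i> *\<^sub>C A y))" and ?w = "\<i> *\<^sub>C A (x - y)"
    have "(1 / h) *\<^sub>R (group h x - x) - \<i> *\<^sub>C A x = ?u + ?v - ?w"
      using h by (simp add: group_simps(6) A_diff x y cscale_diff_right scaleR_diff_right)
    then have "dist ((1 / h) *\<^sub>R (group h x - x)) (\<i> *\<^sub>C A x) \<le> norm ?u + norm ?v + norm ?w"
      unfolding dist_norm using norm_triangle_ineq4[of "?u + ?v" ?w] norm_triangle_ineq[of ?u ?v] by simp
    moreover have "norm ?u \<le> norm (A (x - y))"
    proof -
      have "norm ?u = (1 / h) * norm (group h (x - y) - (x - y))" using h by simp
      also have "\<dots> \<le> (1 / h) * (\<bar>h\<bar> * norm (A (x - y)))"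
        using h by (intro mult_left_mono group_near_id D_diff x y) auto
      finally show ?thesis using h by simp
    qed
    moreover have "norm ?v < e / 3"
    proof -
      have "norm ?v = (1 / h) * norm (group h y - y - h *\<^sub>R (\<i> *\<^sub>C A y))" using h by simp
      also have "\<dots> \<le> (1 / h) * (2 * h\<^sup>2 * norm (A (A y)))"
        using h by (intro mult_left_mono group_derivative_bound y2) auto
      also have "\<dots> = h * (2 * norm (A (A y)))" using h by (simp add: power2_eq_square)
      also have "\<dots> < h * b" using h by (simp add: b_def)
      also have "\<dots> \<le> e / 3" using h b by (simp add: field_simps)
      finally show ?thesis .
    qed
    moreover have "norm ?w < e / 3" using A by (simp add: norm_cscale)
    ultimately show ?thesis using A by linarith
  qed
  moreover have "e / (3 * b) > 0" using e b by simp
  ultimately show "\<forall>\<^sub>F h in at_right 0. dist ((1 / h) *\<^sub>R (group h x - x)) (\<i> *\<^sub>C A x) < e"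
    unfolding eventually_at_right_field by blast
qed

lemma group_strongly_continuous: "((\<lambda>t. group t x) \<longlongrightarrow> x) (at_right 0)"
proof (rule tendstoI)
  fix e :: real assume e: "e > 0"
  obtain y where y2: "y \<in> sq_dom D A" "norm (x - y) < e / 3" using sq_dom_dense[of "e / 3" x] e by auto
  then have y: "y \<in> D" by (simp add: sq_dom_def)
  define b where "b = norm (A y) + 1"
  have b: "b > 0" unfolding b_def by (simp add: add_nonneg_pos)
  have "dist (group h x) x < e" if h: "0 < h" "h < e / (3 * b)" for h
  proof -
    have "group h x - x = group h (x - y) + (group h y - y) - (x - y)" by (simp add: group_simps(6))
    then have "dist (group h x) x \<le> norm (group h (x - y)) + norm (group h y - y) + norm (x - y)"
      unfolding dist_norm
      using norm_triangle_ineq4[of "group h (x - y) + (group h y - y)" "x - y"]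
        norm_triangle_ineq[of "group h (x - y)" "group h y - y"] by simp
    moreover have "norm (group h (x - y)) \<le> norm (x - y)" by (rule group_simps(3))
    moreover have "norm (group h y - y) \<le> h * norm (A y)" using group_near_id[OF y, of h] h by simp
    moreover have "h * norm (A y) \<le> h * b" using h by (simp add: b_def)
    moreover have "h * b < e / 3" using h b by (simp add: field_simps)
    ultimately show ?thesis using y2(2) by linarith
  qed
  moreover have "e / (3 * b) > 0" using e b by simp
  ultimately show "\<forall>\<^sub>F h in at_right 0. dist (group h x) x < e"
    unfolding eventually_at_right_field by blast
qed

lemma contraction_semigroup_group: "contraction_semigroup group D (\<lambda>x. \<i> *\<^sub>C A x)"
proof (rule contraction_semigroup.intro[OF generated_semigroup.intro contraction_semigroup_axioms.intro])
  show "bounded_linear (group t)" for t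
  proof (rule bounded_linear_intro[where K = 1])
    show "group t (r *\<^sub>R x) = r *\<^sub>R group t x" for r x
      using group_simps(2)[of t "of_real r" x] by (simp add: cscale_of_real)
  qed (simp_all add: group_simps(1,3))
  show "\<exists>K. \<forall>s\<in>{0..t}. \<forall>x. norm (group s x) \<le> K * norm x" for t
    by (rule exI[of _ 1]) (simp add: group_simps(3))
  show "group 0 x = x" "group (s + t) x = group s (group t x)" "norm (group t x) \<le> norm x" for s t x
    by (rule group_0, rule group_add, rule group_simps(3))
  show "((\<lambda>t. group t x) \<longlongrightarrow> x) (at_right 0)" for x by (rule group_strongly_continuous)
  show "((\<lambda>t. (1 / t) *\<^sub>R (group t x - x)) \<longlongrightarrow> \<i> *\<^sub>C A x) (at_right 0)" if "x \<in> D" for x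
    by (rule group_generator[OF that])
  show "group t x \<in> D" "\<i> *\<^sub>C A (group t x) = group t (\<i> *\<^sub>C A x)" if "x \<in> D" for t x
    using group_simps(2,4,5) that by auto
qed

lemma group_solves:
  assumes x: "x \<in> D" shows "solves_iA D A x (\<lambda>t. group t x)"
proof -
  interpret G: contraction_semigroup group D "\<lambda>x. \<i> *\<^sub>C A x" by (rule contraction_semigroup_group)
  have "((\<lambda>t. group t x) has_vector_derivative \<i> *\<^sub>C A (group t x)) (at t within {0..})" if "t \<ge> 0" for t
    using G.S_derivative[OF x that] unfolding group_simps(2) group_simps(5)[OF x] .
  then show ?thesis unfolding solves_iA_def using group_0 group_simps(4)[OF x] by blast
qed

text \<open>The norm of the difference of two solutions is conserved.\<close>

lemma solves_iA_unique:
  assumes z: "solves_iA D A z0 z" and t: "t \<ge> 0"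
  shows "z t = group t z0"
proof -
  have z0: "z 0 = z0" "z0 \<in> D" and zD: "\<And>t. t \<ge> 0 \<Longrightarrow> z t \<in> D"
    and z': "\<And>t. t \<ge> 0 \<Longrightarrow> (z has_vector_derivative \<i> *\<^sub>C A (z t)) (at t within {0..})"
    using z unfolding solves_iA_def by auto
  let ?e = "\<lambda>t. z t - group t z0"
  have "(norm (?e t))\<^sup>2 \<le> (norm (?e 0))\<^sup>2"
  proof (rule nonincreasing_from_derivative[where f = "\<lambda>t. (norm (?e t))\<^sup>2" and f' = "\<lambda>t. 2 * inner (\<i> *\<^sub>C A (?e t)) (?e t)"])
    fix s :: real assume s: "s \<ge> 0"
    have "((\<lambda>t. group t z0) has_vector_derivative \<i> *\<^sub>C A (group s z0)) (at s within {0..})"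
      using group_solves[OF z0(2)] s unfolding solves_iA_def by blast
    from has_vector_derivative_diff[OF z'[OF s] this]
    show "((\<lambda>t. (norm (?e t))\<^sup>2) has_real_derivative 2 * inner (\<i> *\<^sub>C A (?e s)) (?e s)) (at s within {0..})"
      by (intro energy_derivative) (simp add: A_diff zD[OF s] group_simps(4)[OF z0(2)] cscale_diff_right)
    show "2 * inner (\<i> *\<^sub>C A (?e s)) (?e s) \<le> 0"
      using inner_skew[OF D_diff[OF zD[OF s] group_simps(4)[OF z0(2)]], of \<i>] by simp
  qed (use t in auto)
  then show ?thesis by (simp add: z0(1) group_0)
qed

end

section \<open>Exact observability gives exponential decay\<close>

text \<open>Let \<open>w\<close> be the damped and \<open>z\<close> the free motion from \<open>x\<close>. The loss \<open>\<Delta>\<close> of squared norm of \<open>w\<close> is twice the integral of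
  the squared output of \<open>w\<close>, and a Gronwall argument bounds \<open>z - w\<close> by \<open>\<Delta>\<close>. So the squared output of \<open>z\<close> has integral
  at most a multiple of \<open>\<Delta>\<close>, while observability bounds it below by the squared norm of \<open>x\<close>.\<close>

lemma observable_decay:
  fixes C :: "'a::complex_hilbert \<Rightarrow> 'b::complex_hilbert"
  assumes sa: "selfadjoint_op D A" and C: "bounded_clinear C"
    and S: "contraction_semigroup S D (\<lambda>x. \<i> *\<^sub>C A x - cadjoint C (C x))"
    and \<tau>: "\<tau> > 0" and obs: "exactly_observable D A C \<tau>"
  shows "\<exists>r<1. r \<ge> 0 \<and> (\<forall>x. norm (S \<tau> x) \<le> r * norm x)"
proof -
  interpret selfadjoint D A by unfold_locales (rule sa)
  interpret S: contraction_semigroup S D "\<lambda>x. \<i> *\<^sub>C A x - cadjoint C (C x)" by (rule S)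
  interpret C: bounded_linear C by (rule bounded_clinear_imp[OF C])
  obtain K where K: "\<And>x. norm (C x) \<le> norm x * K" using C.bounded by blast
  define b where "b = K\<^sup>2"
  have Cb: "(norm (C x))\<^sup>2 \<le> b * (norm x)\<^sup>2" for x
    using power_mono[OF K[of x], of 2] by (simp add: power_mult_distrib b_def mult.commute)
  have b0: "b \<ge> 0" by (simp add: b_def)
  have Qinner: "inner (cadjoint C (C x)) y = inner (C x) (C y)" for x y
    using cinner_cadjoint[OF C, of y "C x"] by (metis Re_cinner inner_commute)
  obtain k where k: "k > 0" and obs': "\<And>z0 z. z0 \<in> D \<Longrightarrow> solves_iA D A z0 z \<Longrightarrow>
      integral {0..\<tau>} (\<lambda>t. (norm (C (z t)))\<^sup>2) \<ge> k\<^sup>2 * (norm z0)\<^sup>2"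
    using obs unfolding exactly_observable_def by blast
  define \<kappa> where "\<kappa> = k\<^sup>2 / (1 + \<tau> * b * exp (b * \<tau>))"
  have den: "1 + \<tau> * b * exp (b * \<tau>) > 0" using \<tau> b0 by (intro add_pos_nonneg) auto
  have \<kappa>: "\<kappa> > 0" unfolding \<kappa>_def using k den by simp
  have decay: "(norm (S \<tau> x))\<^sup>2 \<le> (1 - \<kappa>) * (norm x)\<^sup>2" if x: "x \<in> D" for x
  proof -
    define w where "w t = S t x" for t
    define z where "z t = group t x" for t
    define \<Delta> where "\<Delta> = (norm x)\<^sup>2 - (norm (w \<tau>))\<^sup>2"
    have wD: "w t \<in> D" and zD: "z t \<in> D" if "t \<ge> 0" for t
      using S.S_D[OF x that] group_simps(4)[OF x] by (auto simp: w_def z_def)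
    have w': "(w has_vector_derivative (\<i> *\<^sub>C A (w t) - cadjoint C (C (w t)))) (at t within {0..})" if "t \<ge> 0" for t
      using S.S_derivative[OF x that] S.S_G[OF x that] unfolding w_def by simp
    have z': "(z has_vector_derivative \<i> *\<^sub>C A (z t)) (at t within {0..})" if "t \<ge> 0" for t
      using group_solves[OF x] that unfolding solves_iA_def z_def by blast
    define e where "e t = z t - w t" for t
    have e': "(e has_vector_derivative (\<i> *\<^sub>C A (e t) + cadjoint C (C (w t)))) (at t within {0..})" if t: "t \<ge> 0" for t
      using has_vector_derivative_diff[OF z'[OF t] w'[OF t]] unfolding e_def
      by (simp add: A_diff[OF zD[OF t] wD[OF t]] cscale_diff_right algebra_simps)
    have ew: "((\<lambda>t. (norm (w t))\<^sup>2) has_real_derivative - 2 * (norm (C (w t)))\<^sup>2) (at t within {0..})" if t: "t \<ge> 0" for t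
    proof -
      have "inner (\<i> *\<^sub>C A (w t) - cadjoint C (C (w t))) (w t) = - (norm (C (w t)))\<^sup>2"
        using inner_skew[OF wD[OF t], of \<i>] by (simp add: inner_diff_left Qinner power2_norm_eq_inner)
      then show ?thesis using energy_derivative[OF w'[OF t]] by simp
    qed
    \<comment> \<open>The weight makes the difference of the free and the damped motion controllable by the energy
      that the damped motion has lost.\<close>
    define f where "f t = exp (- b * t) * (norm (e t))\<^sup>2 + (norm (w t))\<^sup>2 / 2" for t
    have f': "(f has_real_derivative (exp (- b * t) * (- b) * (norm (e t))\<^sup>2
        + (2 * inner (\<i> *\<^sub>C A (e t) + cadjoint C (C (w t))) (e t)) * exp (- b * t)) + (- 2 * (norm (C (w t)))\<^sup>2) / 2) (at t within {0..})"
      if t: "t \<ge> 0" for t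
    proof -
      have "((\<lambda>t. exp (- b * t)) has_real_derivative exp (- b * t) * (- b)) (at t within {0..})"
        by (auto intro!: derivative_eq_intros)
      from DERIV_mult[OF this energy_derivative[OF e'[OF t]]]
      show ?thesis unfolding f_def by (intro DERIV_add DERIV_cdivide ew t) simp
    qed
    have f_neg: "(exp (- b * t) * (- b) * (norm (e t))\<^sup>2
        + (2 * inner (\<i> *\<^sub>C A (e t) + cadjoint C (C (w t))) (e t)) * exp (- b * t)) + (- 2 * (norm (C (w t)))\<^sup>2) / 2 \<le> 0"
      if t: "t \<ge> 0" for t
    proof -
      let ?E = "exp (- b * t)" and ?c = "norm (C (w t))" and ?d = "norm (C (e t))"
      have eD: "e t \<in> D" unfolding e_def using D_diff[OF zD[OF t] wD[OF t]] .
      have "inner (\<i> *\<^sub>C A (e t) + cadjoint C (C (w t))) (e t) = inner (C (w t)) (C (e t))"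
        using inner_skew[OF eD, of \<i>] by (simp add: inner_add_left Qinner)
      also have "\<dots> \<le> ?c * ?d" by (rule norm_cauchy_schwarz)
      finally have 1: "2 * inner (\<i> *\<^sub>C A (e t) + cadjoint C (C (w t))) (e t) \<le> ?c\<^sup>2 + ?d\<^sup>2"
        using sum_squares_bound[of ?c ?d] by simp
      then have "2 * inner (\<i> *\<^sub>C A (e t) + cadjoint C (C (w t))) (e t) - b * (norm (e t))\<^sup>2 \<le> ?c\<^sup>2"
        using Cb[of "e t"] by linarith
      then have "?E * (2 * inner (\<i> *\<^sub>C A (e t) + cadjoint C (C (w t))) (e t) - b * (norm (e t))\<^sup>2) \<le> ?E * ?c\<^sup>2"
        by (intro mult_left_mono) auto
      also have "\<dots> \<le> 1 * ?c\<^sup>2" using b0 t by (intro mult_right_mono) auto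
      finally show ?thesis by (simp add: algebra_simps)
    qed
    have e_bound: "(norm (e t))\<^sup>2 \<le> exp (b * \<tau>) * \<Delta> / 2" if t: "t \<in> {0..\<tau>}" for t
    proof -
      have "f t \<le> f 0"
        by (rule nonincreasing_from_derivative[OF f' f_neg]) (use t in auto)
      then have "exp (- b * t) * (norm (e t))\<^sup>2 \<le> ((norm x)\<^sup>2 - (norm (w t))\<^sup>2) / 2"
        by (simp add: f_def e_def z_def w_def group_0 S.S_0 field_simps)
      also have "\<dots> \<le> \<Delta> / 2"
      proof -
        have "w \<tau> = S (\<tau> - t) (w t)" using S.S_add[of "\<tau> - t" t x] t by (simp add: w_def)
        then have "norm (w \<tau>) \<le> norm (w t)" using S.contraction[of "\<tau> - t" "w t"] t by simp
        then show ?thesis unfolding \<Delta>_def by (simp add: power_mono)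
      qed
      finally have "exp (b * t) * (exp (- b * t) * (norm (e t))\<^sup>2) \<le> exp (b * t) * (\<Delta> / 2)"
        by (intro mult_left_mono) auto
      then have "(norm (e t))\<^sup>2 \<le> exp (b * t) * (\<Delta> / 2)" by (simp add: mult.assoc[symmetric] flip: exp_add)
      also have "\<dots> \<le> exp (b * \<tau>) * (\<Delta> / 2)"
      proof (rule mult_right_mono)
        show "exp (b * t) \<le> exp (b * \<tau>)" using t b0 by (simp add: mult_left_mono)
        show "0 \<le> \<Delta> / 2" unfolding \<Delta>_def w_def using S.contraction[of \<tau> x] \<tau> by (simp add: power_mono)
      qed
      finally show ?thesis by simp
    qed
    have "((\<lambda>t. 2 * (norm (C (w t)))\<^sup>2) has_integral (- (norm (w \<tau>))\<^sup>2) - (- (norm (w 0))\<^sup>2)) {0..\<tau>}"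
    proof (rule fundamental_theorem_of_calculus)
      fix t assume t: "t \<in> {0..\<tau>}"
      have "((\<lambda>t. - (norm (w t))\<^sup>2) has_real_derivative - (- 2 * (norm (C (w t)))\<^sup>2)) (at t within {0..})"
        by (intro DERIV_minus ew) (use t in auto)
      then show "((\<lambda>t. - (norm (w t))\<^sup>2) has_vector_derivative 2 * (norm (C (w t)))\<^sup>2) (at t within {0..\<tau>})"
        unfolding has_real_derivative_iff_has_vector_derivative
        by (rule has_vector_derivative_within_subset[THEN has_vector_derivative_eq_rhs]) auto
    qed (use \<tau> in auto)
    then have int_w: "((\<lambda>t. 2 * (norm (C (w t)))\<^sup>2) has_integral \<Delta>) {0..\<tau>}"
      by (simp add: \<Delta>_def w_def S.S_0)
    have "((\<lambda>t. b * exp (b * \<tau>) * \<Delta>) has_integral (\<tau> - 0) *\<^sub>R (b * exp (b * \<tau>) * \<Delta>)) {0..\<tau>}"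
      using has_integral_const_real[of "b * exp (b * \<tau>) * \<Delta>" 0 \<tau>] \<tau> by simp
    from has_integral_add[OF int_w this]
    have int_bound: "((\<lambda>t. 2 * (norm (C (w t)))\<^sup>2 + b * exp (b * \<tau>) * \<Delta>) has_integral (1 + \<tau> * b * exp (b * \<tau>)) * \<Delta>) {0..\<tau>}"
      by (simp add: algebra_simps)
    have "continuous_on {0..\<tau>} z"
      unfolding continuous_on_eq_continuous_within
      by (auto intro: continuous_within_subset[OF has_vector_derivative_continuous[OF z']])
    then have "continuous_on {0..\<tau>} (\<lambda>t. (norm (C (z t)))\<^sup>2)"
      by (intro continuous_intros C.continuous_on)
    then have "(\<lambda>t. (norm (C (z t)))\<^sup>2) integrable_on {0..\<tau>}" by (rule integrable_continuous_real)
    then have "integral {0..\<tau>} (\<lambda>t. (norm (C (z t)))\<^sup>2) \<le> (1 + \<tau> * b * exp (b * \<tau>)) * \<Delta>"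
    proof (rule has_integral_le[OF integrable_integral int_bound])
      fix t assume t: "t \<in> {0..\<tau>}"
      have "C (z t) = C (w t) + C (e t)" by (simp add: e_def C.diff)
      then have "(norm (C (z t)))\<^sup>2 \<le> (norm (C (w t)) + norm (C (e t)))\<^sup>2"
        by (simp add: norm_triangle_ineq power_mono)
      also have "\<dots> \<le> 2 * (norm (C (w t)))\<^sup>2 + 2 * (norm (C (e t)))\<^sup>2"
        using sum_squares_bound[of "norm (C (w t))" "norm (C (e t))"] by (simp add: power2_sum)
      also have "(norm (C (e t)))\<^sup>2 \<le> b * (exp (b * \<tau>) * \<Delta> / 2)"
        using Cb[of "e t"] mult_left_mono[OF e_bound[OF t] b0] by linarith
      finally show "(norm (C (z t)))\<^sup>2 \<le> 2 * (norm (C (w t)))\<^sup>2 + b * exp (b * \<tau>) * \<Delta>"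
        by (simp add: algebra_simps)
    qed
    moreover have "k\<^sup>2 * (norm x)\<^sup>2 \<le> integral {0..\<tau>} (\<lambda>t. (norm (C (z t)))\<^sup>2)"
      unfolding z_def by (rule obs'[OF x group_solves[OF x]])
    ultimately have "k\<^sup>2 * (norm x)\<^sup>2 \<le> (1 + \<tau> * b * exp (b * \<tau>)) * \<Delta>" by linarith
    then have "\<kappa> * (norm x)\<^sup>2 \<le> \<Delta>" unfolding \<kappa>_def using den by (simp add: field_simps)
    then show ?thesis by (simp add: \<Delta>_def w_def algebra_simps)
  qed
  define r where "r = sqrt (max 0 (1 - \<kappa>))"
  have "r < 1" unfolding r_def using \<kappa> by simp
  moreover have "r \<ge> 0" by (simp add: r_def)
  moreover have "norm (S \<tau> x) \<le> r * norm x" for x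
  proof (rule contraction_on_closure[OF S.S_lin dense])
    fix x assume "x \<in> D"
    then have "(norm (S \<tau> x))\<^sup>2 \<le> max 0 (1 - \<kappa>) * (norm x)\<^sup>2"
      using decay by (meson max.cobounded2 mult_right_mono order_trans zero_le_power2)
    then have "(norm (S \<tau> x))\<^sup>2 \<le> (r * norm x)\<^sup>2" by (simp add: r_def power_mult_distrib)
    then show "norm (S \<tau> x) \<le> r * norm x" by (rule power2_le_imp_le) (simp add: r_def)
  qed (use \<tau> in simp)
  ultimately show ?thesis by blast
qed

section \<open>Graph norm estimates for the damped semigroups\<close>

text \<open>The bounds on the operator and the damping appear as explicit parameters because all later constants are built
  from them alone and hence do not depend on the final time.\<close>

locale damped_operator = selfadjoint D A
  for D :: "'a::complex_hilbert set" and A +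
  fixes Q :: "'a \<Rightarrow> 'a" and m \<kappa> q :: real
  assumes m: "m > 0" and lower: "x \<in> D \<Longrightarrow> m * norm x \<le> norm (A x)"
    and \<kappa>: "\<kappa> \<ge> 0" and Q_bound: "norm (Q x) \<le> \<kappa> * norm x"
    and Q_diff: "Q (x - y) = Q x - Q y"
    and Q_D: "x \<in> D \<Longrightarrow> Q x \<in> D"
    and q: "q \<ge> 0" and AQ_bound: "x \<in> D \<Longrightarrow> norm (A (Q x)) \<le> q * norm (A x)"
begin

lemma norm_le_A: "x \<in> D \<Longrightarrow> norm x \<le> norm (A x) / m"
  using lower[of x] m by (simp add: field_simps)

text \<open>For \<open>x\<close> in the domain of \<open>A\<^sup>2\<close>: \<open>g1\<close> bounds \<open>G x\<close> by \<open>A x\<close> and \<open>g2\<close> bounds \<open>G (G x)\<close> by \<open>A (A x)\<close>. Along an orbit,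
  \<open>k0\<close> bounds \<open>A (S t x)\<close> and \<open>k1\<close> the Lipschitz constant of \<open>A (S t x)\<close>, both by \<open>A (A x)\<close>, and \<open>k2\<close> bounds the commutator
  of \<open>S t\<close> with the square of \<open>A\<close> by \<open>A x\<close>. The constant \<open>c1\<close> is the resulting consistency constant of the scheme.\<close>

definition g1 where "g1 = 1 + \<kappa> / m"
definition g2 where "g2 = 1 + q / m + \<kappa> * g1 / m"
definition k0 where "k0 = g1 / m + \<kappa> / m\<^sup>2"
definition k1 where "k1 = g2 + \<kappa> * g1 / m"
definition k2 where "k2 = 2 * \<kappa> + q * (1 + 2 * \<kappa> / m) + q + 2 * \<kappa> * (\<kappa> / m)"

definition c1 where "c1 = k1 + \<kappa> * k0 + g2"

lemma g1_pos: "g1 > 0" and g2_pos: "g2 > 0" and k_nonneg: "k0 \<ge> 0" "k1 \<ge> 0" and k2_nonneg: "k2 \<ge> 0"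
proof -
  show "g1 > 0" unfolding g1_def using m \<kappa> by (intro add_pos_nonneg) auto
  then show "g2 > 0" unfolding g2_def using m \<kappa> q by (intro add_pos_nonneg) auto
  with \<open>g1 > 0\<close> show "k0 \<ge> 0" "k1 \<ge> 0" unfolding k0_def k1_def using m \<kappa> by simp_all
  show "k2 \<ge> 0" unfolding k2_def using m \<kappa> q by (intro add_nonneg_nonneg) auto
qed

lemma c1_nonneg: "c1 \<ge> 0"
  unfolding c1_def using g2_pos k_nonneg \<kappa> by simp

end

locale damped_semigroup =
  damped_operator D A Q m \<kappa> q + contraction_semigroup S D "\<lambda>x. c *\<^sub>C A x - Q x"
  for D :: "'a::complex_hilbert set" and A Q m \<kappa> q S c +
  assumes c_norm: "cmod c = 1" and S_cscale: "t \<ge> 0 \<Longrightarrow> S t (a *\<^sub>C x) = a *\<^sub>C S t x"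
begin

abbreviation "G x \<equiv> c *\<^sub>C A x - Q x"

lemma G_bound: "x \<in> D \<Longrightarrow> norm (G x) \<le> g1 * norm (A x)"
proof -
  assume x: "x \<in> D"
  have "norm (G x) \<le> norm (c *\<^sub>C A x) + norm (Q x)" by (rule norm_triangle_ineq4)
  also have "\<dots> \<le> norm (A x) + \<kappa> * (norm (A x) / m)"
    using c_norm Q_bound[of x] mult_left_mono[OF norm_le_A[OF x] \<kappa>] by (simp add: norm_cscale)
  finally show ?thesis by (simp add: g1_def algebra_simps)
qed

lemma A_bound: "norm (A x) \<le> norm (G x) + \<kappa> * norm x"
proof -
  have "norm (A x) = norm (c *\<^sub>C A x)" using c_norm by (simp add: norm_cscale)
  also have "\<dots> = norm (G x + Q x)" by simp
  also have "\<dots> \<le> norm (G x) + \<kappa> * norm x"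
    using Q_bound[of x] by (intro order_trans[OF norm_triangle_ineq]) simp
  finally show ?thesis .
qed

lemma G_D: "x \<in> sq_dom D A \<Longrightarrow> G x \<in> D"
  by (auto simp: sq_dom_def intro!: D_diff D_cscale Q_D)

lemma A_le_AA: "x \<in> sq_dom D A \<Longrightarrow> norm (A x) \<le> norm (A (A x)) / m"
  by (rule norm_le_A) (simp add: sq_dom_def)

lemma GG_bound:
  assumes x: "x \<in> sq_dom D A" shows "norm (G (G x)) \<le> g2 * norm (A (A x))"
proof -
  have xD: "x \<in> D" "A x \<in> D" using x by (auto simp: sq_dom_def)
  have "norm (G (G x)) \<le> norm (c *\<^sub>C A (G x)) + norm (Q (G x))" by (rule norm_triangle_ineq4)
  also have "norm (c *\<^sub>C A (G x)) = norm (c *\<^sub>C A (A x) - A (Q x))"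
    using c_norm by (simp add: norm_cscale A_diff A_cscale xD Q_D D_cscale)
  also have "\<dots> \<le> norm (A (A x)) + q * norm (A x)"
    using AQ_bound[OF xD(1)] c_norm by (intro order_trans[OF norm_triangle_ineq4]) (simp add: norm_cscale)
  also have "norm (Q (G x)) \<le> \<kappa> * (g1 * norm (A x))"
    by (rule order_trans[OF Q_bound mult_left_mono[OF G_bound[OF xD(1)] \<kappa>]])
  also have "norm (A (A x)) + q * norm (A x) + \<kappa> * (g1 * norm (A x))
     = norm (A (A x)) + (q + \<kappa> * g1) * norm (A x)" by (simp add: algebra_simps)
  also have "\<dots> \<le> norm (A (A x)) + (q + \<kappa> * g1) * (norm (A (A x)) / m)"
    using q \<kappa> g1_pos by (intro add_left_mono mult_left_mono A_le_AA x) simp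
  also have "\<dots> = g2 * norm (A (A x))" using m by (simp add: g2_def field_simps)
  finally show ?thesis by simp
qed

lemma G_le_AA: "x \<in> sq_dom D A \<Longrightarrow> norm (G x) \<le> g1 / m * norm (A (A x))"
  using order_trans[OF G_bound mult_left_mono[OF A_le_AA[of x]]] g1_pos by (simp add: sq_dom_def)

lemma taylor:
  assumes x: "x \<in> sq_dom D A" and "s \<ge> 0" "t \<ge> 0"
  shows "norm (S t x - S s x - (t - s) *\<^sub>R G (S t x)) \<le> (t - s)\<^sup>2 * (g2 * norm (A (A x)))"
proof -
  have xD: "x \<in> D" using x by (simp add: sq_dom_def)
  have "norm (S t x - S s x - (t - s) *\<^sub>R S t (G x)) \<le> (t - s)\<^sup>2 * norm (G (G x))"
    by (rule S_taylor[OF xD G_D[OF x] assms(2,3)])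
  also have "\<dots> \<le> (t - s)\<^sup>2 * (g2 * norm (A (A x)))" by (intro mult_left_mono GG_bound x) simp
  finally show ?thesis using S_G[OF xD assms(3)] by simp
qed

text \<open>\<open>A\<close> and \<open>G\<close> differ by the bounded \<open>Q\<close>, and \<open>G\<close> commutes with the semigroup; so Lipschitz bounds for \<open>S u (G x)\<close>
  and \<open>S u x\<close> in \<open>u\<close> suffice.\<close>

lemma A_lipschitz:
  assumes x: "x \<in> sq_dom D A" and st: "s \<ge> 0" "t \<ge> 0"
  shows "norm (A (S t x - S s x)) \<le> \<bar>t - s\<bar> * (k1 * norm (A (A x)))"
proof -
  have xD: "x \<in> D" using x by (simp add: sq_dom_def)
  have "G (S t x - S s x) = G (S t x) - G (S s x)"
    using S_D[OF xD st(1)] S_D[OF xD st(2)] by (simp add: A_diff Q_diff cscale_diff_right)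
  then have G: "G (S t x - S s x) = S t (G x) - S s (G x)"
    by (simp only: S_G[OF xD st(1)] S_G[OF xD st(2)])
  have "norm (S t (G x) - S s (G x)) \<le> \<bar>t - s\<bar> * (g2 * norm (A (A x)))"
    by (rule order_trans[OF S_lipschitz[OF G_D[OF x] st] mult_left_mono[OF GG_bound[OF x]]]) simp
  moreover have "norm (S t x - S s x) \<le> \<bar>t - s\<bar> * (g1 / m * norm (A (A x)))"
    by (rule order_trans[OF S_lipschitz[OF xD st] mult_left_mono[OF G_le_AA[OF x]]]) simp
  ultimately have "norm (A (S t x - S s x)) \<le> \<bar>t - s\<bar> * (g2 * norm (A (A x))) + \<kappa> * (\<bar>t - s\<bar> * (g1 / m * norm (A (A x))))"
    using A_bound[of "S t x - S s x"] mult_left_mono[OF _ \<kappa>] unfolding G by (meson add_mono order_trans)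
  then show ?thesis by (simp add: k1_def algebra_simps)
qed

lemma A_orbit:
  assumes x: "x \<in> sq_dom D A" and t: "t \<ge> 0"
  shows "norm (A (S t x)) \<le> k0 * norm (A (A x))"
proof -
  have xD: "x \<in> D" using x by (simp add: sq_dom_def)
  have "norm x \<le> norm (A (A x)) / m / m"
    by (rule order_trans[OF norm_le_A[OF xD] divide_right_mono[OF A_le_AA[OF x]]]) (use m in simp)
  then have "\<kappa> * norm (S t x) \<le> \<kappa> * (norm (A (A x)) / m / m)"
    using contraction[OF t, of x] by (intro mult_left_mono \<kappa>) simp
  moreover have "norm (G (S t x)) \<le> g1 / m * norm (A (A x))"
    unfolding S_G[OF xD t] by (rule order_trans[OF contraction[OF t] G_le_AA[OF x]])
  ultimately have "norm (A (S t x)) \<le> g1 / m * norm (A (A x)) + \<kappa> * (norm (A (A x)) / m / m)"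
    using A_bound[of "S t x"] by linarith
  then show ?thesis by (simp add: k0_def power2_eq_square algebra_simps)
qed

text \<open>Since \<open>S t\<close> commutes with \<open>G\<close>, its commutator with \<open>c A = G + Q\<close> is the one with \<open>Q\<close>, which is bounded
  uniformly in time.\<close>

lemma commutator:
  assumes x: "x \<in> D" and t: "t \<ge> 0"
  shows "A (S t x) = S t (A x) + inverse c *\<^sub>C (Q (S t x) - S t (Q x))"
proof -
  have c0: "c \<noteq> 0" using c_norm by auto
  have "c *\<^sub>C A (S t x) - Q (S t x) = c *\<^sub>C S t (A x) - S t (Q x)"
    using S_G[OF x t] by (simp add: S_diff[OF t] S_cscale[OF t])
  then have "c *\<^sub>C A (S t x) = c *\<^sub>C S t (A x) + (Q (S t x) - S t (Q x))" by (simp add: algebra_simps)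
  then have "inverse c *\<^sub>C c *\<^sub>C A (S t x) = inverse c *\<^sub>C (c *\<^sub>C S t (A x) + (Q (S t x) - S t (Q x)))" by simp
  then show ?thesis using c0 by (simp add: cscale_cscale cscale_add_right)
qed

lemma commutator_bound:
  assumes x: "x \<in> D" and t: "t \<ge> 0"
  shows "norm (A (S t x) - S t (A x)) \<le> 2 * \<kappa> * norm x"
proof -
  have "norm (A (S t x) - S t (A x)) = norm (Q (S t x) - S t (Q x))"
    unfolding commutator[OF assms] using c_norm by (simp add: norm_cscale norm_inverse)
  also have "\<dots> \<le> \<kappa> * norm x + \<kappa> * norm x"
  proof (rule order_trans[OF norm_triangle_ineq4 add_mono])
    show "norm (Q (S t x)) \<le> \<kappa> * norm x"
      by (rule order_trans[OF Q_bound mult_left_mono[OF contraction[OF t] \<kappa>]])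
    show "norm (S t (Q x)) \<le> \<kappa> * norm x" by (rule order_trans[OF contraction[OF t] Q_bound])
  qed
  finally show ?thesis by simp
qed

lemma A_S_bound: "x \<in> D \<Longrightarrow> t \<ge> 0 \<Longrightarrow> norm (A (S t x)) \<le> norm (A x) + 2 * \<kappa> * norm x"
  using commutator_bound[of x t] contraction[of t "A x"] norm_triangle_sub[of "A (S t x)" "S t (A x)"] by linarith

lemma S_sq_dom:
  assumes x: "x \<in> sq_dom D A" and t: "t \<ge> 0"
  shows "S t x \<in> sq_dom D A"
proof -
  have xD: "x \<in> D" "A x \<in> D" using x by (auto simp: sq_dom_def)
  have "A (S t x) \<in> D"
    unfolding commutator[OF xD(1) t] by (intro D_add D_diff D_cscale S_D Q_D xD t)
  then show ?thesis using S_D[OF xD(1) t] by (simp add: sq_dom_def)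
qed

text \<open>Applying \<open>A\<close> to the formula for the commutator leaves \<open>A\<close> next to \<open>Q\<close>, which is bounded in the graph norm. The
  commutator with the square of \<open>A\<close> therefore costs a single power of \<open>A\<close>.\<close>

lemma square_commutator_bound:
  assumes x: "x \<in> sq_dom D A" and t: "t \<ge> 0"
  shows "norm (A (A (S t x)) - S t (A (A x))) \<le> k2 * norm (A x)"
proof -
  have xD: "x \<in> D" "A x \<in> D" using x by (auto simp: sq_dom_def)
  let ?N = "norm (A x)"
  have nx: "2 * \<kappa> * norm x \<le> 2 * \<kappa> * (?N / m)" using norm_le_A[OF xD(1)] \<kappa> by (intro mult_left_mono) auto
  have D: "S t (A x) \<in> D" "Q (S t x) \<in> D" "S t (Q x) \<in> D" by (intro S_D Q_D xD t)+
  have "A (A (S t x)) - S t (A (A x))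
      = (A (S t (A x)) - S t (A (A x))) + inverse c *\<^sub>C (A (Q (S t x)) - A (S t (Q x)))"
    unfolding commutator[OF xD(1) t] using D by (simp add: A_add A_cscale A_diff D_cscale D_diff)
  also have "norm \<dots> \<le> norm (A (S t (A x)) - S t (A (A x))) + norm (A (Q (S t x)) - A (S t (Q x)))"
    using c_norm by (intro order_trans[OF norm_triangle_ineq]) (simp add: norm_cscale norm_inverse)
  also have "\<dots> \<le> 2 * \<kappa> * ?N + (q * (?N + 2 * \<kappa> * (?N / m)) + (q * ?N + 2 * \<kappa> * (\<kappa> * (?N / m))))"
  proof -
    have 1: "norm (A (S t (A x)) - S t (A (A x))) \<le> 2 * \<kappa> * ?N" by (rule commutator_bound[OF xD(2) t])
    have "norm (A (S t x)) \<le> ?N + 2 * \<kappa> * (?N / m)" using A_S_bound[OF xD(1) t] nx by linarith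
    then have 2: "norm (A (Q (S t x))) \<le> q * (?N + 2 * \<kappa> * (?N / m))"
      by (rule order_trans[OF AQ_bound[OF S_D[OF xD(1) t]] mult_left_mono]) (rule q)
    have "norm (Q x) \<le> \<kappa> * (?N / m)"
      by (rule order_trans[OF Q_bound mult_left_mono[OF norm_le_A[OF xD(1)] \<kappa>]])
    then have "2 * \<kappa> * norm (Q x) \<le> 2 * \<kappa> * (\<kappa> * (?N / m))" using \<kappa> by (intro mult_left_mono) auto
    then have 3: "norm (A (S t (Q x))) \<le> q * ?N + 2 * \<kappa> * (\<kappa> * (?N / m))"
      using A_S_bound[OF Q_D[OF xD(1)] t] AQ_bound[OF xD(1)] by linarith
    show ?thesis
      by (rule add_mono[OF 1 order_trans[OF norm_triangle_ineq4 add_mono[OF 2 3]]])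
  qed
  also have "\<dots> = k2 * ?N" by (simp add: k2_def algebra_simps)
  finally show ?thesis .
qed

lemma AA_S_bound:
  assumes x: "x \<in> sq_dom D A" and t: "t \<ge> 0"
  shows "norm (A (A (S t x))) \<le> (1 + k2 / m) * norm (A (A x))"
proof -
  have "k2 * norm (A x) \<le> k2 * (norm (A (A x)) / m)" by (intro mult_left_mono A_le_AA x k2_nonneg)
  then show ?thesis
    using square_commutator_bound[OF assms] contraction[OF t, of "A (A x)"]
      norm_triangle_sub[of "A (A (S t x))" "S t (A (A x))"] by (simp add: algebra_simps)
qed

end

section \<open>Powers of a contraction with bounded commutators\<close>

lemma geometric_recursion_sum:
  fixes f g :: "nat \<Rightarrow> real"
  assumes "\<And>n. f (Suc n) \<le> r * f n + g n" "\<And>n. f n \<ge> 0" "\<And>N. (\<Sum>n\<le>N. g n) \<le> B"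
    and "0 \<le> r" "r < 1"
  shows "(\<Sum>n\<le>N. f n) \<le> (f 0 + B) / (1 - r)"
proof -
  have "(\<Sum>n\<le>Suc N. f n) = f 0 + (\<Sum>n\<le>N. f (Suc n))" by (rule sum.atMost_Suc_shift)
  also have "(\<Sum>n\<le>N. f (Suc n)) \<le> (\<Sum>n\<le>N. r * f n + g n)" by (intro sum_mono assms)
  also have "\<dots> = r * (\<Sum>n\<le>N. f n) + (\<Sum>n\<le>N. g n)" by (simp add: sum.distrib sum_distrib_left)
  finally have "(\<Sum>n\<le>N. f n) + f (Suc N) \<le> f 0 + r * (\<Sum>n\<le>N. f n) + B" using assms(3)[of N] by simp
  then have "(1 - r) * (\<Sum>n\<le>N. f n) \<le> f 0 + B" using assms(2)[of "Suc N"] by (simp add: algebra_simps)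
  then show ?thesis using assms(5) by (simp add: field_simps)
qed

text \<open>The three nested geometric series that bound the orbit sum in the graph norm of \<open>A\<^sup>2\<close> below: one factor
  \<open>1 / (1 - r)\<close> for each order \<open>0\<close>, \<open>1\<close>, \<open>2\<close> of \<open>A\<close>.\<close>

definition orbit_const :: "real \<Rightarrow> real \<Rightarrow> real \<Rightarrow> real \<Rightarrow> real" where
  "orbit_const m b1 b2 r = (1 + b2 * ((1 / m + b1 * (1 / m\<^sup>2 / (1 - r))) / (1 - r))) / (1 - r)"

lemma orbit_const_mono:
  assumes "m > 0" "b1 \<ge> 0" "b2 \<ge> 0" "0 \<le> r" "r \<le> s" "s < 1"
  shows "orbit_const m b1 b2 r \<le> orbit_const m b1 b2 s" "orbit_const m b1 b2 r \<ge> 0"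
  unfolding orbit_const_def using assms
  by (intro frac_le mult_left_mono add_left_mono add_nonneg_nonneg mult_nonneg_nonneg divide_nonneg_nonneg; simp)+

text \<open>Each application of \<open>L\<close> contracts the leading order and feeds in the norm of one order less. Summing the
  recursions from the lowest order upward gives a bound independent of the number of iterations.\<close>

lemma (in damped_operator) power_orbit_sum:
  assumes L_dom: "\<And>y. y \<in> sq_dom D A \<Longrightarrow> L y \<in> sq_dom D A"
    and L0: "\<And>y. norm (L y) \<le> r * norm y"
    and L1: "\<And>y. y \<in> sq_dom D A \<Longrightarrow> norm (A (L y)) \<le> r * norm (A y) + b1 * norm y"
    and L2: "\<And>y. y \<in> sq_dom D A \<Longrightarrow> norm (A (A (L y))) \<le> r * norm (A (A y)) + b2 * norm (A y)"
    and r: "0 \<le> r" "r < 1" and b: "b1 \<ge> 0" "b2 \<ge> 0" and x: "x \<in> sq_dom D A"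
  shows "(L ^^ n) x \<in> sq_dom D A"
    and "(\<Sum>n\<le>N. norm (A (A ((L ^^ n) x)))) \<le> orbit_const m b1 b2 r * norm (A (A x))"
proof -
  show dom: "(L ^^ n) x \<in> sq_dom D A" for n by (induction n) (simp_all add: x L_dom)
  let ?Z = "norm (A (A x))"
  have xD: "x \<in> D" "A x \<in> D" using x by (auto simp: sq_dom_def)
  have Ax: "norm (A x) \<le> ?Z / m" by (rule norm_le_A[OF xD(2)])
  have nx: "norm x \<le> ?Z / m\<^sup>2"
    using order_trans[OF norm_le_A[OF xD(1)] divide_right_mono[OF Ax]] m by (simp add: power2_eq_square)
  have p: "(\<Sum>n\<le>N. norm ((L ^^ n) x)) \<le> ?Z / m\<^sup>2 / (1 - r)" for N
  proof -
    have "(\<Sum>n\<le>N. norm ((L ^^ n) x)) \<le> (norm ((L ^^ 0) x) + 0) / (1 - r)"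
      by (rule geometric_recursion_sum[where g = "\<lambda>_. 0"]) (use L0 r in auto)
    also have "\<dots> \<le> ?Z / m\<^sup>2 / (1 - r)" using nx r by (intro divide_right_mono) auto
    finally show ?thesis .
  qed
  have a: "(\<Sum>n\<le>N. norm (A ((L ^^ n) x))) \<le> (?Z / m + b1 * (?Z / m\<^sup>2 / (1 - r))) / (1 - r)" for N
  proof -
    have "(\<Sum>n\<le>N. norm (A ((L ^^ n) x))) \<le> (norm (A ((L ^^ 0) x)) + b1 * (?Z / m\<^sup>2 / (1 - r))) / (1 - r)"
    proof (rule geometric_recursion_sum[where g = "\<lambda>n. b1 * norm ((L ^^ n) x)"])
      show "(\<Sum>n\<le>N. b1 * norm ((L ^^ n) x)) \<le> b1 * (?Z / m\<^sup>2 / (1 - r))" for N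
        unfolding sum_distrib_left[symmetric] by (rule mult_left_mono[OF p b(1)])
    qed (use L1 dom r in auto)
    also have "\<dots> \<le> (?Z / m + b1 * (?Z / m\<^sup>2 / (1 - r))) / (1 - r)"
      using Ax r by (intro divide_right_mono add_right_mono) auto
    finally show ?thesis .
  qed
  have "(\<Sum>n\<le>N. norm (A (A ((L ^^ n) x))))
      \<le> (norm (A (A ((L ^^ 0) x))) + b2 * ((?Z / m + b1 * (?Z / m\<^sup>2 / (1 - r))) / (1 - r))) / (1 - r)"
  proof (rule geometric_recursion_sum[where g = "\<lambda>n. b2 * norm (A ((L ^^ n) x))"])
    show "(\<Sum>n\<le>N. b2 * norm (A ((L ^^ n) x))) \<le> b2 * ((?Z / m + b1 * (?Z / m\<^sup>2 / (1 - r))) / (1 - r))" for N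
      unfolding sum_distrib_left[symmetric] by (rule mult_left_mono[OF a b(2)])
  qed (use L2 dom r in auto)
  also have "\<dots> = orbit_const m b1 b2 r * ?Z"
    by (simp add: orbit_const_def add_divide_distrib distrib_left distrib_right mult_ac)
  finally show "(\<Sum>n\<le>N. norm (A (A ((L ^^ n) x)))) \<le> orbit_const m b1 b2 r * ?Z" .
qed

section \<open>Consistency of the scheme\<close>

locale observer_setting =
  damped_operator D A "\<lambda>x. cadjoint C (C x)" m \<kappa> q + definite_half_op Dh Ah +
  Tp: damped_semigroup D A "\<lambda>x. cadjoint C (C x)" m \<kappa> q Tp \<i> +
  Tm: damped_semigroup D A "\<lambda>x. cadjoint C (C x)" m \<kappa> q Tm "- \<i>"
  for D :: "'a::complex_hilbert set" and A and C :: "'a \<Rightarrow> 'b::complex_hilbert" and m \<kappa> q Dh Ah Tp Tm +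
  assumes C: "bounded_clinear C" and D_Dh: "D \<subseteq> Dh"
    and half_form: "\<lbrakk>x \<in> D; \<phi> \<in> Dh\<rbrakk> \<Longrightarrow> cinner (Ah x) (Ah \<phi>) = cinner (A x) \<phi>"

text \<open>The number \<open>\<epsilon>\<close> is the accuracy of the Galerkin space, measured against the norm of \<open>A x\<close>; it will be a multiple of
  \<open>h powr \<theta>\<close>.\<close>

locale discrete_observer = observer_setting D A C m \<kappa> q Dh Ah Tp Tm + galerkin Dh Ah V
  for D :: "'a::complex_hilbert set" and A and C :: "'a \<Rightarrow> 'b::complex_hilbert" and m \<kappa> q Dh Ah Tp Tm V +
  fixes dt \<epsilon> :: real
  assumes dt: "dt > 0" and \<epsilon>: "\<epsilon> \<ge> 0"
    and approx: "x \<in> D \<Longrightarrow> norm (half_proj Ah V x - x) \<le> \<epsilon> * norm (A x)"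
begin

abbreviation "Q x \<equiv> cadjoint C (C x)"
abbreviation "\<pi> x \<equiv> half_proj Ah V x"

lemma euler: "Re c = 0 \<Longrightarrow> euler_scheme Dh Ah V C dt c"
  by unfold_locales (simp_all add: C dt)

text \<open>What the error analysis needs to know of a smooth curve in \<open>D\<close> sampled at the time grid, with \<open>d\<close> in the
  role of the time derivative: a Taylor estimate at the right end of each time step and bounds in the graph norm.
  The constants are those of the damped semigroups, so that all bounds scale with the single number \<open>Z\<close>.\<close>

definition grid_curve :: "nat \<Rightarrow> real \<Rightarrow> (nat \<Rightarrow> 'a) \<Rightarrow> (nat \<Rightarrow> 'a) \<Rightarrow> bool" where
  "grid_curve K Z x d \<longleftrightarrow> Z \<ge> 0 \<and> (\<forall>k\<le>K. x k \<in> D) \<and> (\<forall>k\<in>{1..K}.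
     norm (x k - x (k - 1) - dt *\<^sub>R d k) \<le> dt\<^sup>2 * (g2 * Z) \<and>
     norm (A (x k - x (k - 1))) \<le> dt * (k1 * Z) \<and> norm (A (x k)) \<le> k0 * Z)"

lemma grid_curve_diff:
  assumes u: "grid_curve K Z1 u d" and v: "grid_curve K Z2 v e"
  shows "grid_curve K (Z1 + Z2) (\<lambda>k. u k - v k) (\<lambda>k. d k - e k)"
proof -
  have D: "u k \<in> D" "v k \<in> D" if "k \<le> K" for k using u v that unfolding grid_curve_def by auto
  have "norm (u k - v k - (u (k - 1) - v (k - 1)) - dt *\<^sub>R (d k - e k)) \<le> dt\<^sup>2 * (g2 * (Z1 + Z2)) \<and>
     norm (A (u k - v k - (u (k - 1) - v (k - 1)))) \<le> dt * (k1 * (Z1 + Z2)) \<and>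
     norm (A (u k - v k)) \<le> k0 * (Z1 + Z2)" if k: "k \<in> {1..K}" for k
  proof (intro conjI)
    have kK: "k \<le> K" "k - 1 \<le> K" using k by auto
    have U: "norm (u k - u (k - 1) - dt *\<^sub>R d k) \<le> dt\<^sup>2 * (g2 * Z1)"
        "norm (A (u k - u (k - 1))) \<le> dt * (k1 * Z1)" "norm (A (u k)) \<le> k0 * Z1"
      and W: "norm (v k - v (k - 1) - dt *\<^sub>R e k) \<le> dt\<^sup>2 * (g2 * Z2)"
        "norm (A (v k - v (k - 1))) \<le> dt * (k1 * Z2)" "norm (A (v k)) \<le> k0 * Z2"
      using u v k unfolding grid_curve_def by auto
    have eq: "u k - v k - (u (k - 1) - v (k - 1)) - dt *\<^sub>R (d k - e k)
      = (u k - u (k - 1) - dt *\<^sub>R d k) - (v k - v (k - 1) - dt *\<^sub>R e k)"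
      by (simp add: algebra_simps)
    show "norm (u k - v k - (u (k - 1) - v (k - 1)) - dt *\<^sub>R (d k - e k)) \<le> dt\<^sup>2 * (g2 * (Z1 + Z2))"
      unfolding eq distrib_left by (rule order_trans[OF norm_triangle_ineq4 add_mono[OF U(1) W(1)]])
    have eq2: "u k - v k - (u (k - 1) - v (k - 1)) = (u k - u (k - 1)) - (v k - v (k - 1))"
      by (simp add: algebra_simps)
    have eq3: "A (u k - v k - (u (k - 1) - v (k - 1))) = A (u k - u (k - 1)) - A (v k - v (k - 1))"
      unfolding eq2 by (intro A_diff D_diff D kK)
    show "norm (A (u k - v k - (u (k - 1) - v (k - 1)))) \<le> dt * (k1 * (Z1 + Z2))"
      unfolding eq3 distrib_left by (rule order_trans[OF norm_triangle_ineq4 add_mono[OF U(2) W(2)]])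
    show "norm (A (u k - v k)) \<le> k0 * (Z1 + Z2)"
      unfolding A_diff[OF D[OF kK(1)]] distrib_left
      by (rule order_trans[OF norm_triangle_ineq4 add_mono[OF U(3) W(3)]])
  qed
  then show ?thesis using u v D unfolding grid_curve_def by (auto intro: D_diff)
qed

lemma grid_step: "k \<in> {1..K} \<Longrightarrow> real k * dt - real (k - 1) * dt = dt"
  "k \<in> {1..K} \<Longrightarrow> real (K - k) * dt - real (K - (k - 1)) * dt = - dt"
  by (simp_all add: of_nat_diff algebra_simps)

text \<open>The second curve runs the semigroup backward from the final time; the Taylor estimate holds in both time
  directions, with the sign of the derivative reversed.\<close>

lemma grid_curve_semigroup:
  assumes S: "damped_semigroup D A R m \<kappa> q S c" and x: "x \<in> sq_dom D A"
  shows "grid_curve K (norm (A (A x))) (\<lambda>k. S (real k * dt) x)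
      (\<lambda>k. c *\<^sub>C A (S (real k * dt) x) - R (S (real k * dt) x))"
    and "grid_curve K (norm (A (A x))) (\<lambda>k. S (real (K - k) * dt) x)
      (\<lambda>k. - (c *\<^sub>C A (S (real (K - k) * dt) x) - R (S (real (K - k) * dt) x)))"
proof -
  interpret S: damped_semigroup D A R m \<kappa> q S c by (rule S)
  have t0: "real k * dt \<ge> 0" for k using dt by simp
  have SD: "S (real k * dt) x \<in> D" for k by (rule S.S_D[OF _ t0]) (use x in \<open>simp add: sq_dom_def\<close>)
  show "grid_curve K (norm (A (A x))) (\<lambda>k. S (real k * dt) x) (\<lambda>k. S.G (S (real k * dt) x))"
    unfolding grid_curve_def
  proof (intro conjI ballI allI impI SD S.A_orbit[OF x t0])
    fix k assume k: "k \<in> {1..K}"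
    show "norm (S (real k * dt) x - S (real (k - 1) * dt) x - dt *\<^sub>R S.G (S (real k * dt) x)) \<le> dt\<^sup>2 * (g2 * norm (A (A x)))"
      using S.taylor[OF x t0[of "k - 1"] t0[of k]] unfolding grid_step(1)[OF k] .
    show "norm (A (S (real k * dt) x - S (real (k - 1) * dt) x)) \<le> dt * (k1 * norm (A (A x)))"
      using S.A_lipschitz[OF x t0[of "k - 1"] t0[of k]] dt unfolding grid_step(1)[OF k] by simp
  qed simp
  show "grid_curve K (norm (A (A x))) (\<lambda>k. S (real (K - k) * dt) x) (\<lambda>k. - S.G (S (real (K - k) * dt) x))"
    unfolding grid_curve_def
  proof (intro conjI ballI allI impI SD S.A_orbit[OF x t0])
    fix k assume k: "k \<in> {1..K}"
    show "norm (S (real (K - k) * dt) x - S (real (K - (k - 1)) * dt) x - dt *\<^sub>R - S.G (S (real (K - k) * dt) x)) \<le> dt\<^sup>2 * (g2 * norm (A (A x)))"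
      using S.taylor[OF x t0[of "K - (k - 1)"] t0[of "K - k"]]
      unfolding grid_step(2)[OF k] scaleR_minus_left scaleR_minus_right power2_minus .
    show "norm (A (S (real (K - k) * dt) x - S (real (K - (k - 1)) * dt) x)) \<le> dt * (k1 * norm (A (A x)))"
      using S.A_lipschitz[OF x t0[of "K - (k - 1)"] t0[of "K - k"]] dt unfolding grid_step(2)[OF k] by simp
  qed simp
qed

text \<open>The projected exact values satisfy the scheme with a residual made of the time discretisation error of the
  derivative, the projection error of the difference quotient, and the projection error under the damping.
  Stability turns the sum of the residuals into an error bound.\<close>

lemma consistency:
  assumes c: "Re c = 0" and x: "grid_curve K Z x d"
    and d: "\<And>k. k \<in> {1..K} \<Longrightarrow> d k = c *\<^sub>C A (x k) - Q (x k) + F k"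
    and xh: "solves_scheme c Ah C V dt K Fh x0h xh"
  shows "norm (\<pi> (x K) - xh K) \<le> norm (\<pi> (x 0) - x0h) + real K * dt * ((\<epsilon> + dt) * (c1 * Z))
     + dt * (\<Sum>k=1..K. norm (F k - Fh k))"
proof -
  let ?a = "(\<epsilon> + dt) * (c1 * Z)"
  have Z: "Z \<ge> 0" and xD: "\<And>k. k \<le> K \<Longrightarrow> x k \<in> D"
    and tay: "\<And>k. k \<in> {1..K} \<Longrightarrow> norm (x k - x (k - 1) - dt *\<^sub>R d k) \<le> dt\<^sup>2 * (g2 * Z)"
    and lip: "\<And>k. k \<in> {1..K} \<Longrightarrow> norm (A (x k - x (k - 1))) \<le> dt * (k1 * Z)"
    and orb: "\<And>k. k \<in> {1..K} \<Longrightarrow> norm (A (x k)) \<le> k0 * Z"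
    using x unfolding grid_curve_def by auto
  interpret E: euler_scheme Dh Ah V C dt c by (rule euler[OF c])
  define R where "R k = ((1 / dt) *\<^sub>R (\<pi> (x k) - \<pi> (x (k - 1))) - d k) + Q (\<pi> (x k) - x k)" for k
  have xDh: "x k \<in> Dh" if "k \<le> K" for k using xD[OF that] D_Dh by blast
  have "solves_scheme c Ah C V dt K (\<lambda>k. R k + F k) (\<pi> (x 0)) (\<lambda>k. \<pi> (x k))"
    unfolding solves_scheme_def
  proof (intro conjI ballI allI impI)
    show "\<pi> (x k) \<in> V" if "k \<le> K" for k by (rule half_proj(1)[OF xDh[OF that]])
    fix k \<phi> assume k: "k \<in> {1..K}" and \<phi>: "\<phi> \<in> V"
    have kK: "k \<le> K" using k by simp
    have "c * cinner (Ah (\<pi> (x k))) (Ah \<phi>) = cinner (c *\<^sub>C A (x k)) \<phi>"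
      using half_proj_cinner[OF xDh[OF kK] \<phi>] half_form[OF xD[OF kK] VD[OF \<phi>]] by (simp add: cinner_cscale_left)
    moreover have "R k + F k = (1 / dt) *\<^sub>R (\<pi> (x k) - \<pi> (x (k - 1))) - c *\<^sub>C A (x k) + Q (\<pi> (x k))"
      unfolding R_def d[OF k] by (simp add: Q_diff)
    ultimately show "cinner ((1 / dt) *\<^sub>R (\<pi> (x k) - \<pi> (x (k - 1)))) \<phi> =
        c * cinner (Ah (\<pi> (x k))) (Ah \<phi>) - cinner (Q (\<pi> (x k))) \<phi> + cinner (R k + F k) \<phi>"
      by (simp add: cinner_diff_left cinner_add_left)
  qed simp
  from E.stability[OF E.solves_diff[OF this xh]]
  have "norm (\<pi> (x K) - xh K) \<le> norm (\<pi> (x 0) - x0h) + dt * (\<Sum>k=1..K. norm (R k + F k - Fh k))" .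
  also have "(\<Sum>k=1..K. norm (R k + F k - Fh k))
      \<le> (\<Sum>k=1..K. ?a + norm (F k - Fh k))"
  proof (rule sum_mono)
    fix k assume k: "k \<in> {1..K}"
    then have kK: "k \<le> K" "k - 1 \<le> K" by auto
    let ?w = "x k - x (k - 1)"
    have wD: "?w \<in> D" by (intro D_diff xD kK)
    have \<pi>w: "\<pi> (x k) - \<pi> (x (k - 1)) = \<pi> ?w" by (rule half_proj_diff[symmetric]) (intro xDh kK)+
    have "R k = (1 / dt) *\<^sub>R (\<pi> ?w - ?w) + (1 / dt) *\<^sub>R (?w - dt *\<^sub>R d k) + Q (\<pi> (x k) - x k)"
      unfolding R_def \<pi>w using dt by (simp add: scaleR_diff_right)
    then have "norm (R k) \<le> (1 / dt) * norm (\<pi> ?w - ?w) + (1 / dt) * norm (?w - dt *\<^sub>R d k) + norm (Q (\<pi> (x k) - x k))"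
      using norm_triangle_ineq[of "(1 / dt) *\<^sub>R (\<pi> ?w - ?w) + (1 / dt) *\<^sub>R (?w - dt *\<^sub>R d k)" "Q (\<pi> (x k) - x k)"]
        norm_triangle_ineq[of "(1 / dt) *\<^sub>R (\<pi> ?w - ?w)" "(1 / dt) *\<^sub>R (?w - dt *\<^sub>R d k)"] dt by simp
    also have "\<dots> \<le> (1 / dt) * (\<epsilon> * (dt * (k1 * Z))) + (1 / dt) * (dt\<^sup>2 * (g2 * Z)) + \<kappa> * (\<epsilon> * (k0 * Z))"
    proof (intro add_mono)
      show "(1 / dt) * norm (\<pi> ?w - ?w) \<le> (1 / dt) * (\<epsilon> * (dt * (k1 * Z)))"
        using dt by (intro mult_left_mono order_trans[OF approx[OF wD] mult_left_mono[OF lip[OF k] \<epsilon>]]) simp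
      show "(1 / dt) * norm (?w - dt *\<^sub>R d k) \<le> (1 / dt) * (dt\<^sup>2 * (g2 * Z))"
        using dt by (intro mult_left_mono tay[OF k]) simp
      show "norm (Q (\<pi> (x k) - x k)) \<le> \<kappa> * (\<epsilon> * (k0 * Z))"
        by (rule order_trans[OF Q_bound mult_left_mono[OF order_trans[OF approx[OF xD[OF kK(1)]] mult_left_mono[OF orb[OF k] \<epsilon>]] \<kappa>]])
    qed
    also have "\<dots> = \<epsilon> * ((k1 + \<kappa> * k0) * Z) + dt * (g2 * Z)"
      using dt by (simp add: power2_eq_square algebra_simps)
    also have "\<dots> \<le> \<epsilon> * (c1 * Z) + dt * (c1 * Z)"
      using g2_pos k_nonneg \<kappa> dt \<epsilon> Z by (intro add_mono mult_left_mono mult_right_mono) (auto simp: c1_def)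
    finally have "norm (R k) \<le> ?a" by (simp add: distrib_right)
    moreover have "norm (R k + F k - Fh k) \<le> norm (R k) + norm (F k - Fh k)"
      using norm_triangle_ineq[of "R k" "F k - Fh k"] by (simp add: algebra_simps)
    ultimately show "norm (R k + F k - Fh k) \<le> ?a + norm (F k - Fh k)" by linarith
  qed
  finally show ?thesis using dt by (simp add: sum.distrib algebra_simps mult_left_mono)
qed

end

section \<open>Commutator bounds for the iteration operator\<close>

context observer_setting
begin

text \<open>The free group satisfies the estimates of the damped semigroups, with damping zero and the same constants.\<close>

lemma damped_semigroup_group: "damped_semigroup D A (\<lambda>_. 0) m \<kappa> q group \<i>"
proof -
  interpret G: contraction_semigroup group D "\<lambda>x. \<i> *\<^sub>C A x" by (rule contraction_semigroup_group)
  have "damped_operator D A (\<lambda>_. 0) m \<kappa> q"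
    by unfold_locales (use m lower \<kappa> q in \<open>auto simp: D_zero A_zero\<close>)
  moreover have "contraction_semigroup group D (\<lambda>x. \<i> *\<^sub>C A x - 0)"
    using contraction_semigroup_group by simp
  moreover have "damped_semigroup_axioms group \<i>"
    by unfold_locales (simp_all add: group_simps(2))
  ultimately show ?thesis by (rule damped_semigroup.intro)
qed

abbreviation L :: "real \<Rightarrow> 'a \<Rightarrow> 'a" where "L \<tau> x \<equiv> Tm \<tau> (Tp \<tau> x)"

definition b1 where "b1 = 4 * \<kappa>"
definition b2 where "b2 = k2 * (1 + 2 * \<kappa> / m) + k2"

lemma b_nonneg: "b1 \<ge> 0" "b2 \<ge> 0"
  unfolding b1_def b2_def using \<kappa> k2_nonneg m by auto

lemma L_sq_dom: "x \<in> sq_dom D A \<Longrightarrow> \<tau> \<ge> 0 \<Longrightarrow> L \<tau> x \<in> sq_dom D A"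
  by (intro Tm.S_sq_dom Tp.S_sq_dom)

text \<open>\<open>A\<close> is moved through the two factors of \<open>L\<close> one after the other, each time at the cost of a bounded commutator.\<close>

lemma A_L_bound:
  assumes x: "x \<in> sq_dom D A" and \<tau>: "\<tau> \<ge> 0" and r: "\<And>y. norm (L \<tau> y) \<le> r * norm y"
  shows "norm (A (L \<tau> x)) \<le> r * norm (A x) + b1 * norm x"
proof -
  have xD: "x \<in> D" using x by (simp add: sq_dom_def)
  let ?y = "Tp \<tau> x"
  have eq: "A (L \<tau> x) = (A (Tm \<tau> ?y) - Tm \<tau> (A ?y)) + Tm \<tau> (A ?y - Tp \<tau> (A x)) + L \<tau> (A x)"
    by (simp add: Tm.S_diff[OF \<tau>])
  have "norm (A (L \<tau> x)) \<le> norm (A (Tm \<tau> ?y) - Tm \<tau> (A ?y)) + norm (Tm \<tau> (A ?y - Tp \<tau> (A x))) + norm (L \<tau> (A x))"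
    by (subst eq) (rule order_trans[OF norm_triangle_ineq add_right_mono[OF norm_triangle_ineq]])
  moreover have "norm (A (Tm \<tau> ?y) - Tm \<tau> (A ?y)) \<le> 2 * \<kappa> * norm x"
    using Tm.commutator_bound[OF Tp.S_D[OF xD \<tau>] \<tau>] mult_left_mono[OF Tp.contraction[OF \<tau>, of x], of "2 * \<kappa>"] \<kappa> by simp
  moreover have "norm (Tm \<tau> (A ?y - Tp \<tau> (A x))) \<le> 2 * \<kappa> * norm x"
    by (rule order_trans[OF Tm.contraction[OF \<tau>] Tp.commutator_bound[OF xD \<tau>]])
  ultimately show ?thesis using r[of "A x"] by (simp add: b1_def)
qed

lemma AA_L_bound:
  assumes x: "x \<in> sq_dom D A" and \<tau>: "\<tau> \<ge> 0" and r: "\<And>y. norm (L \<tau> y) \<le> r * norm y"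
  shows "norm (A (A (L \<tau> x))) \<le> r * norm (A (A x)) + b2 * norm (A x)"
proof -
  have xD: "x \<in> D" using x by (simp add: sq_dom_def)
  let ?y = "Tp \<tau> x"
  have y: "?y \<in> sq_dom D A" by (rule Tp.S_sq_dom[OF x \<tau>])
  have eq: "A (A (L \<tau> x)) = (A (A (Tm \<tau> ?y)) - Tm \<tau> (A (A ?y))) + Tm \<tau> (A (A ?y) - Tp \<tau> (A (A x))) + L \<tau> (A (A x))"
    by (simp add: Tm.S_diff[OF \<tau>])
  have "norm (A (A (L \<tau> x))) \<le> norm (A (A (Tm \<tau> ?y)) - Tm \<tau> (A (A ?y)))
      + norm (Tm \<tau> (A (A ?y) - Tp \<tau> (A (A x)))) + norm (L \<tau> (A (A x)))"
    by (subst eq) (rule order_trans[OF norm_triangle_ineq add_right_mono[OF norm_triangle_ineq]])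
  moreover have "norm (A (A (Tm \<tau> ?y)) - Tm \<tau> (A (A ?y))) \<le> k2 * ((1 + 2 * \<kappa> / m) * norm (A x))"
  proof -
    have "norm (A ?y) \<le> norm (A x) + 2 * \<kappa> * norm x" by (rule Tp.A_S_bound[OF xD \<tau>])
    also have "\<dots> \<le> norm (A x) + 2 * \<kappa> * (norm (A x) / m)"
      using \<kappa> by (intro add_left_mono mult_left_mono norm_le_A xD) simp
    finally have "norm (A ?y) \<le> (1 + 2 * \<kappa> / m) * norm (A x)" by (simp add: algebra_simps)
    then show ?thesis by (rule order_trans[OF Tm.square_commutator_bound[OF y \<tau>] mult_left_mono]) (rule k2_nonneg)
  qed
  moreover have "norm (Tm \<tau> (A (A ?y) - Tp \<tau> (A (A x)))) \<le> k2 * norm (A x)"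
    by (rule order_trans[OF Tm.contraction[OF \<tau>] Tp.square_commutator_bound[OF x \<tau>]])
  ultimately show ?thesis using r[of "A (A x)"] by (simp add: b2_def algebra_simps)
qed

end

section \<open>Errors of the discrete semigroups, observers and Neumann series\<close>

context discrete_observer
begin

lemma semigroup_error:
  assumes S: "damped_semigroup D A Q m \<kappa> q S c" and c: "Re c = 0" and x: "x \<in> sq_dom D A"
  shows "norm (\<pi> (S (real K * dt) x) - disc_semigroup c Ah C V dt K x)
    \<le> real K * dt * ((\<epsilon> + dt) * (c1 * norm (A (A x))))"
proof -
  interpret E: euler_scheme Dh Ah V C dt c by (rule euler[OF c])
  interpret S: damped_semigroup D A Q m \<kappa> q S c by (rule S)
  have "solves_scheme c Ah C V dt K (\<lambda>_. 0) (\<pi> x) (scheme_sol c Ah C V dt (\<lambda>_. 0) (\<pi> x))"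
    using x D_Dh by (intro E.sol_solves half_proj(1)) (auto simp: sq_dom_def)
  from consistency[OF c grid_curve_semigroup(1)[OF S x] _ this, of "\<lambda>_. 0"]
  show ?thesis by (simp add: disc_semigroup_def S.S_0)
qed

abbreviation "Lh K x \<equiv> disc_L Ah C V dt K x"

lemma disc_semigroup_proj: "x \<in> Dh \<Longrightarrow> disc_semigroup c Ah C V dt K (\<pi> x) = disc_semigroup c Ah C V dt K x"
  unfolding disc_semigroup_def by (simp add: half_proj_id half_proj(1))

lemma Lh_diff: "x \<in> V \<Longrightarrow> y \<in> V \<Longrightarrow> Lh K (x - y) = Lh K x - Lh K y"
  and Lh_in_V: "x \<in> Dh \<Longrightarrow> Lh K x \<in> V"
  and Lh_contraction: "x \<in> V \<Longrightarrow> norm (Lh K x) \<le> norm x"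
proof -
  interpret P: euler_scheme Dh Ah V C dt \<i> by (rule euler) simp
  interpret M: euler_scheme Dh Ah V C dt "- \<i>" by (rule euler) simp
  show "x \<in> V \<Longrightarrow> y \<in> V \<Longrightarrow> Lh K (x - y) = Lh K x - Lh K y"
    by (simp add: disc_L_def P.disc_semigroup_diff M.disc_semigroup_diff P.disc_semigroup_in_V VD)
  show "x \<in> Dh \<Longrightarrow> Lh K x \<in> V"
    by (simp add: disc_L_def P.disc_semigroup_in_V M.disc_semigroup_in_V VD)
  show "x \<in> V \<Longrightarrow> norm (Lh K x) \<le> norm x"
    unfolding disc_L_def comp_def
    by (rule order_trans[OF M.disc_semigroup_contraction P.disc_semigroup_contraction])
      (simp_all add: P.disc_semigroup_in_V VD)
qed

definition (in observer_setting) c2 where "c2 = c1 * (1 + k2 / m) + c1"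

text \<open>The error of the forward run is propagated by the contractive backward run, and the error of the backward run is
  evaluated at \<open>Tp \<tau> x\<close>, whose norm of order two is controlled by that of \<open>x\<close>.\<close>

lemma L_error:
  assumes x: "x \<in> sq_dom D A"
  shows "norm (\<pi> (L (real K * dt) x) - Lh K x) \<le> real K * dt * ((\<epsilon> + dt) * (c2 * norm (A (A x))))"
proof -
  interpret M: euler_scheme Dh Ah V C dt "- \<i>" by (rule euler) simp
  interpret P: euler_scheme Dh Ah V C dt \<i> by (rule euler) simp
  let ?\<tau> = "real K * dt" and ?Z = "norm (A (A x))"
  have \<tau>: "?\<tau> \<ge> 0" using dt by simp
  let ?y = "Tp ?\<tau> x" and ?yh = "disc_semigroup \<i> Ah C V dt K x"
  have y: "?y \<in> sq_dom D A" by (rule Tp.S_sq_dom[OF x \<tau>])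
  have Dh: "x \<in> Dh" "?y \<in> Dh" using x y D_Dh by (auto simp: sq_dom_def)
  have V: "\<pi> ?y \<in> V" "?yh \<in> V" using Dh half_proj(1) P.disc_semigroup_in_V by auto
  let ?d = "disc_semigroup (- \<i>) Ah C V dt K"
  have eq: "\<pi> (L ?\<tau> x) - Lh K x = (\<pi> (Tm ?\<tau> ?y) - ?d ?y) + ?d (\<pi> ?y - ?yh)"
    unfolding disc_L_def comp_def using M.disc_semigroup_diff[OF V] disc_semigroup_proj[OF Dh(2)] by simp
  have "norm (\<pi> (Tm ?\<tau> ?y) - ?d ?y) \<le> ?\<tau> * ((\<epsilon> + dt) * (c1 * norm (A (A ?y))))"
    by (rule semigroup_error[OF Tm.damped_semigroup_axioms _ y]) simp
  also have "\<dots> \<le> ?\<tau> * ((\<epsilon> + dt) * (c1 * ((1 + k2 / m) * ?Z)))"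
    using \<tau> dt \<epsilon> c1_nonneg by (intro mult_left_mono Tp.AA_S_bound x) auto
  finally have 1: "norm (\<pi> (Tm ?\<tau> ?y) - ?d ?y) \<le> ?\<tau> * ((\<epsilon> + dt) * (c1 * ((1 + k2 / m) * ?Z)))" .
  have 2: "norm (?d (\<pi> ?y - ?yh)) \<le> ?\<tau> * ((\<epsilon> + dt) * (c1 * ?Z))"
    by (rule order_trans[OF M.disc_semigroup_contraction[OF V_diff[OF V]] semigroup_error[OF Tp.damped_semigroup_axioms _ x]]) simp
  have "norm (\<pi> (L ?\<tau> x) - Lh K x) \<le> ?\<tau> * ((\<epsilon> + dt) * (c1 * ((1 + k2 / m) * ?Z))) + ?\<tau> * ((\<epsilon> + dt) * (c1 * ?Z))"
    unfolding eq by (rule order_trans[OF norm_triangle_ineq add_mono[OF 1 2]])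
  also have "\<dots> = ?\<tau> * ((\<epsilon> + dt) * (c2 * ?Z))" by (simp add: c2_def algebra_simps)
  finally show ?thesis .
qed

text \<open>The forward observer error equation has the exact solution \<open>group t z0 - Tp t z0\<close>: it starts at zero and
  the free motion satisfies the damped equation with source \<open>Q (group t z0)\<close>.\<close>

lemma observer_plus_error:
  assumes z0: "z0 \<in> sq_dom D A"
  shows "norm (\<pi> (group (real K * dt) z0 - Tp (real K * dt) z0) - observer_plus Ah C V dt yh K)
    \<le> real K * dt * ((\<epsilon> + dt) * (2 * c1 * norm (A (A z0))))
      + dt * (\<Sum>l=0..K. norm (cadjoint C (C (group (real l * dt) z0) - yh l)))"
proof -
  interpret P: euler_scheme Dh Ah V C dt \<i> by (rule euler) simp
  let ?Z = "norm (A (A z0))"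
  have D: "group (real k * dt) z0 \<in> D" "Tp (real k * dt) z0 \<in> D" for k
    using z0 dt by (auto simp: sq_dom_def intro: group_simps(4) Tp.S_D)
  have sol: "solves_scheme \<i> Ah C V dt K (\<lambda>j. cadjoint C (yh j)) 0 (observer_plus Ah C V dt yh)"
    unfolding observer_plus_def by (rule P.sol_solves[OF V_zero])
  have "norm (\<pi> (group (real K * dt) z0 - Tp (real K * dt) z0) - observer_plus Ah C V dt yh K)
     \<le> norm (\<pi> (group (real 0 * dt) z0 - Tp (real 0 * dt) z0) - 0) + real K * dt * ((\<epsilon> + dt) * (c1 * (?Z + ?Z)))
       + dt * (\<Sum>k=1..K. norm (Q (group (real k * dt) z0) - cadjoint C (yh k)))"
    by (rule consistency[OF _ grid_curve_diff[OF grid_curve_semigroup(1)[OF damped_semigroup_group z0]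
            grid_curve_semigroup(1)[OF Tp.damped_semigroup_axioms z0]] _ sol])
      (simp_all add: A_diff[OF D] Q_diff cscale_diff_right)
  also have "norm (\<pi> (group (real 0 * dt) z0 - Tp (real 0 * dt) z0) - 0) = 0"
    by (simp add: group_0 Tp.S_0 half_proj_id[OF V_zero])
  also have "dt * (\<Sum>k=1..K. norm (Q (group (real k * dt) z0) - cadjoint C (yh k)))
     \<le> dt * (\<Sum>l=0..K. norm (cadjoint C (C (group (real l * dt) z0) - yh l)))"
    unfolding cadjoint_diff[OF C] using dt by (intro mult_left_mono sum_mono2) auto
  also have "c1 * (?Z + ?Z) = 2 * c1 * ?Z" by simp
  finally show ?thesis by simp
qed

definition (in observer_setting) c3 where "c3 = 2 * c1 + c1 * (2 + k2 / m)"

text \<open>Backwards in time the error equation is solved by \<open>group (\<tau> - s) z0 - Tm s (Tp \<tau> z0)\<close>, whose value at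
  \<open>s = \<tau>\<close> is \<open>z0 - L \<tau> z0\<close>.\<close>

lemma observer_minus_error:
  assumes z0: "z0 \<in> sq_dom D A"
  shows "norm (\<pi> (z0 - L (real K * dt) z0) - observer_minus Ah C V dt K yh 0)
    \<le> real K * dt * ((\<epsilon> + dt) * (c3 * norm (A (A z0))))
      + 2 * dt * (\<Sum>l=0..K. norm (cadjoint C (C (group (real l * dt) z0) - yh l)))"
proof -
  interpret P: euler_scheme Dh Ah V C dt \<i> by (rule euler) simp
  interpret M: euler_scheme Dh Ah V C dt "- \<i>" by (rule euler) simp
  let ?Z = "norm (A (A z0))" and ?\<tau> = "real K * dt"
  let ?y = "Tp ?\<tau> z0"
  let ?N = "\<Sum>l=0..K. norm (cadjoint C (C (group (real l * dt) z0) - yh l))"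
  have t0: "real k * dt \<ge> 0" for k using dt by simp
  have y: "?y \<in> sq_dom D A" by (rule Tp.S_sq_dom[OF z0 t0])
  have D: "group (real k * dt) z0 \<in> D" "Tm (real j * dt) ?y \<in> D" for k j
    using z0 y t0 by (auto simp: sq_dom_def intro: group_simps(4) Tm.S_D)
  have Zy: "norm (A (A ?y)) \<le> (1 + k2 / m) * ?Z" by (rule Tp.AA_S_bound[OF z0 t0])
  let ?q0 = "observer_plus Ah C V dt yh K"
  let ?xh = "scheme_sol (- \<i>) Ah C V dt (\<lambda>j. cadjoint C (yh (K - j))) ?q0"
  have q0: "?q0 \<in> V" unfolding observer_plus_def by (rule P.sol_in_V[OF V_zero])
  have sol: "solves_scheme (- \<i>) Ah C V dt K (\<lambda>j. cadjoint C (yh (K - j))) ?q0 ?xh"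
    by (rule M.sol_solves[OF q0])
  have "norm (\<pi> (group (real (K - K) * dt) z0 - Tm (real K * dt) ?y) - ?xh K)
     \<le> norm (\<pi> (group (real (K - 0) * dt) z0 - Tm (real 0 * dt) ?y) - ?q0)
       + real K * dt * ((\<epsilon> + dt) * (c1 * (?Z + norm (A (A ?y)))))
       + dt * (\<Sum>k=1..K. norm (Q (group (real (K - k) * dt) z0) - cadjoint C (yh (K - k))))"
    by (rule consistency[OF _ grid_curve_diff[OF grid_curve_semigroup(2)[OF damped_semigroup_group z0]
            grid_curve_semigroup(1)[OF Tm.damped_semigroup_axioms y]] _ sol])
      (simp_all add: A_diff[OF D] Q_diff cscale_diff_right del: of_nat_diff)
  then have "norm (\<pi> (z0 - L ?\<tau> z0) - observer_minus Ah C V dt K yh 0)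
     \<le> norm (\<pi> (group ?\<tau> z0 - ?y) - ?q0) + ?\<tau> * ((\<epsilon> + dt) * (c1 * (?Z + norm (A (A ?y)))))
       + dt * (\<Sum>k=1..K. norm (Q (group (real (K - k) * dt) z0) - cadjoint C (yh (K - k))))"
    by (simp add: observer_minus_def group_0 Tm.S_0)
  also have "norm (\<pi> (group ?\<tau> z0 - ?y) - ?q0) \<le> ?\<tau> * ((\<epsilon> + dt) * (2 * c1 * ?Z)) + dt * ?N"
    by (rule observer_plus_error[OF z0])
  also have "?\<tau> * ((\<epsilon> + dt) * (c1 * (?Z + norm (A (A ?y))))) \<le> ?\<tau> * ((\<epsilon> + dt) * (c1 * (?Z + (1 + k2 / m) * ?Z)))"
    using dt \<epsilon> c1_nonneg by (intro mult_left_mono add_left_mono Zy) auto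
  also have "dt * (\<Sum>k=1..K. norm (Q (group (real (K - k) * dt) z0) - cadjoint C (yh (K - k)))) \<le> dt * ?N"
  proof (rule mult_left_mono)
    have "(\<Sum>k=1..K. norm (Q (group (real (K - k) * dt) z0) - cadjoint C (yh (K - k))))
      = (\<Sum>l\<in>{0..<K}. norm (cadjoint C (C (group (real l * dt) z0) - yh l)))"
      unfolding cadjoint_diff[OF C]
      by (rule sum.reindex_bij_witness[of _ "\<lambda>l. K - l" "\<lambda>k. K - k"]) auto
    also have "\<dots> \<le> ?N" by (intro sum_mono2) auto
    finally show "(\<Sum>k=1..K. norm (Q (group (real (K - k) * dt) z0) - cadjoint C (yh (K - k)))) \<le> ?N" .
  qed (use dt in simp)
  finally have "norm (\<pi> (z0 - L ?\<tau> z0) - observer_minus Ah C V dt K yh 0)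
     \<le> ?\<tau> * ((\<epsilon> + dt) * (2 * c1 * ?Z)) + dt * ?N + ?\<tau> * ((\<epsilon> + dt) * (c1 * (?Z + (1 + k2 / m) * ?Z))) + dt * ?N"
    by simp
  also have "\<dots> = ?\<tau> * ((\<epsilon> + dt) * (2 * c1 * ?Z + c1 * (?Z + (1 + k2 / m) * ?Z))) + 2 * dt * ?N"
    by (simp only: distrib_left mult_2 distrib_right ac_simps)
  also have "2 * c1 * ?Z + c1 * (?Z + (1 + k2 / m) * ?Z) = c3 * ?Z"
    by (simp add: c3_def algebra_simps)
  finally show ?thesis .
qed

lemma neumann_sum_in_V:
  assumes w: "w \<in> V"
  shows "(Lh K ^^ n) w \<in> V" "(\<Sum>n=0..N. (Lh K ^^ n) w) \<in> V"
proof -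
  show p: "(Lh K ^^ n) w \<in> V" for n
  proof (induction n)
    case (Suc n)
    show ?case unfolding funpow.simps comp_apply by (rule Lh_in_V[OF VD[OF Suc]])
  qed (simp add: w)
  show "(\<Sum>n=0..N. (Lh K ^^ n) w) \<in> V"
    by (rule cvec.subspace_sum[OF subspace_V p])
qed

lemma neumann_sum_Suc:
  assumes w: "w \<in> V"
  shows "(\<Sum>n=0..Suc N. (Lh K ^^ n) w) = w + Lh K (\<Sum>n=0..N. (Lh K ^^ n) w)"
proof (induction N)
  case (Suc N)
  let ?s = "\<Sum>n=0..N. (Lh K ^^ n) w" and ?p = "(Lh K ^^ Suc N) w"
  have V: "?s \<in> V" "?p \<in> V" by (rule neumann_sum_in_V[OF w])+
  have add: "Lh K (?s + ?p) = Lh K ?s + Lh K ?p"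
    using Lh_diff[OF V_add[OF V] V(2), of K] by simp
  have "(\<Sum>n=0..Suc (Suc N). (Lh K ^^ n) w) = w + Lh K ?s + Lh K ?p"
    unfolding sum.atLeast0_atMost_Suc[of _ "Suc N"] Suc by simp
  then show ?case unfolding sum.atLeast0_atMost_Suc[of _ N] add by (simp only: add.assoc)
qed simp

text \<open>The truncated series \<open>r N = z0 - L\<^sup>N\<^sup>+\<^sup>1 z0\<close> and its discrete counterpart satisfy the same affine recursion.
  Comparing the recursions, rather than powers of the two operators, evaluates the consistency error only at
  the \<open>r n\<close> and adds up \<open>N\<close> of them.\<close>

lemma reconstruction_error:
  assumes z0: "z0 \<in> sq_dom D A" and \<tau>: "\<tau> = real K * dt"
    and r: "\<And>y. norm (L \<tau> y) \<le> r * norm y"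
    and dom: "\<And>n. (L \<tau> ^^ n) z0 \<in> sq_dom D A"
    and S: "\<And>N. (\<Sum>n\<le>N. norm (A (A ((L \<tau> ^^ n) z0)))) \<le> S * norm (A (A z0))"
    and \<delta>: "norm (\<pi> (z0 - L \<tau> z0) - observer_minus Ah C V dt K yh 0) \<le> \<delta>" and r0: "r \<ge> 0"
  shows "norm (z0 - reconstruction Ah C V dt K yh N)
    \<le> r ^ (N + 1) * norm z0 + \<epsilon> * ((1 + S) * norm (A (A z0)) / m) + real (N + 1) * \<delta>
      + \<tau> * ((\<epsilon> + dt) * (c2 * ((real N + S) * norm (A (A z0)))))"
proof -
  interpret M: euler_scheme Dh Ah V C dt "- \<i>" by (rule euler) simp
  interpret P: euler_scheme Dh Ah V C dt \<i> by (rule euler) simp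
  let ?Z = "norm (A (A z0))" and ?w = "observer_minus Ah C V dt K yh 0"
  define rr where "rr n = z0 - (L \<tau> ^^ Suc n) z0" for n
  define rh where "rh n = (\<Sum>j=0..n. (Lh K ^^ j) ?w)" for n
  have \<tau>0: "\<tau> \<ge> 0" using \<tau> dt by simp
  have zD: "z0 \<in> D" "A z0 \<in> D" using z0 by (auto simp: sq_dom_def)
  have LD: "(L \<tau> ^^ n) z0 \<in> D" "A ((L \<tau> ^^ n) z0) \<in> D" for n using dom[of n] by (auto simp: sq_dom_def)
  have "observer_plus Ah C V dt yh K \<in> V" unfolding observer_plus_def by (rule P.sol_in_V[OF V_zero])
  then have w: "?w \<in> V" unfolding observer_minus_def by (rule M.sol_in_V)
  have rhV: "rh n \<in> V" for n unfolding rh_def by (rule neumann_sum_in_V[OF w])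
  have L_diff: "L \<tau> (x - y) = L \<tau> x - L \<tau> y" for x y by (simp add: Tp.S_diff[OF \<tau>0] Tm.S_diff[OF \<tau>0])
  have rrD: "rr n \<in> D" and Arr: "A (rr n) = A z0 - A ((L \<tau> ^^ Suc n) z0)"
    and AArr: "A (A (rr n)) = A (A z0) - A (A ((L \<tau> ^^ Suc n) z0))" for n
    unfolding rr_def using zD LD[of "Suc n"] by (simp_all add: D_diff A_diff del: funpow.simps)
  have rr2: "rr n \<in> sq_dom D A" for n
    unfolding sq_dom_def using rrD[of n] Arr[of n] D_diff[OF zD(2) LD(2)[of "Suc n"]] by simp
  have rr_Suc: "rr (Suc n) = (z0 - L \<tau> z0) + L \<tau> (rr n)" for n by (simp add: rr_def L_diff)
  have "\<pi> (rr n) \<in> V" for n using rrD D_Dh by (intro half_proj(1)) blast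
  note \<pi>V = this
  have err: "norm (\<pi> (rr n) - rh n) \<le> real (n + 1) * \<delta> + \<tau> * ((\<epsilon> + dt) * (c2 * (\<Sum>j<n. norm (A (A (rr j))))))" for n
  proof (induction n)
    case 0
    show ?case using \<delta> by (simp add: rr_def rh_def)
  next
    case (Suc n)
    have D1: "z0 - L \<tau> z0 \<in> Dh" "L \<tau> (rr n) \<in> Dh"
      using D_diff[OF zD(1) LD(1)[of 1]] L_sq_dom[OF rr2 \<tau>0, of n] D_Dh by (auto simp: sq_dom_def)
    have \<pi>_add: "\<pi> ((z0 - L \<tau> z0) + L \<tau> (rr n)) = \<pi> (z0 - L \<tau> z0) + \<pi> (L \<tau> (rr n))"
      using half_proj_diff[OF cvec.subspace_add[OF subspace_Dh D1] D1(2)] by simp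
    have rh_Suc: "rh (Suc n) = ?w + Lh K (rh n)" unfolding rh_def by (rule neumann_sum_Suc[OF w])
    have Lh_rr: "Lh K (\<pi> (rr n) - rh n) = Lh K (\<pi> (rr n)) - Lh K (rh n)" by (rule Lh_diff[OF \<pi>V rhV])
    have eq: "\<pi> (rr (Suc n)) - rh (Suc n) = (\<pi> (z0 - L \<tau> z0) - ?w) + (\<pi> (L \<tau> (rr n)) - Lh K (\<pi> (rr n)))
        + Lh K (\<pi> (rr n) - rh n)"
      unfolding rr_Suc rh_Suc \<pi>_add Lh_rr by simp
    have Lh\<pi>: "Lh K (\<pi> (rr n)) = Lh K (rr n)"
      unfolding disc_L_def comp_def using disc_semigroup_proj[OF subsetD[OF D_Dh rrD]] by simp
    have 1: "norm (\<pi> (L \<tau> (rr n)) - Lh K (\<pi> (rr n))) \<le> \<tau> * ((\<epsilon> + dt) * (c2 * norm (A (A (rr n)))))"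
      unfolding Lh\<pi> \<tau> by (rule L_error[OF rr2])
    have "norm (\<pi> (rr (Suc n)) - rh (Suc n)) \<le> \<delta> + \<tau> * ((\<epsilon> + dt) * (c2 * norm (A (A (rr n))))) + norm (\<pi> (rr n) - rh n)"
      unfolding eq
      by (intro order_trans[OF norm_triangle_ineq add_mono[OF order_trans[OF norm_triangle_ineq add_mono[OF \<delta> 1]]]]
          Lh_contraction V_diff \<pi>V rhV)
    then show ?case using Suc by (simp add: algebra_simps)
  qed
  have c2: "c2 \<ge> 0" unfolding c2_def using c1_nonneg k2_nonneg m by simp
  have AA_le: "norm (A (A (rr n))) \<le> ?Z + norm (A (A ((L \<tau> ^^ Suc n) z0)))" for n
    unfolding AArr by (rule norm_triangle_ineq4)
  have "(\<Sum>j<N. norm (A (A (rr j)))) \<le> (\<Sum>j<N. ?Z + norm (A (A ((L \<tau> ^^ Suc j) z0))))"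
    by (intro sum_mono AA_le)
  also have "\<dots> = real N * ?Z + (\<Sum>j<N. norm (A (A ((L \<tau> ^^ Suc j) z0))))" by (simp add: sum.distrib)
  also have "(\<Sum>j<N. norm (A (A ((L \<tau> ^^ Suc j) z0)))) \<le> (\<Sum>n\<le>N. norm (A (A ((L \<tau> ^^ n) z0))))"
  proof -
    have "(\<Sum>j<N. norm (A (A ((L \<tau> ^^ Suc j) z0)))) = (\<Sum>n\<in>{1..N}. norm (A (A ((L \<tau> ^^ n) z0))))"
      by (rule sum.reindex_bij_witness[of _ "\<lambda>n. n - 1" Suc]) auto
    also have "\<dots> \<le> (\<Sum>n\<le>N. norm (A (A ((L \<tau> ^^ n) z0))))" by (intro sum_mono2) auto
    finally show ?thesis .
  qed
  also have "\<dots> \<le> S * ?Z" by (rule S)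
  finally have sum_le: "(\<Sum>j<N. norm (A (A (rr j)))) \<le> (real N + S) * ?Z" by (simp add: distrib_right)
  have e1: "norm (\<pi> (rr N) - rh N) \<le> real (N + 1) * \<delta> + \<tau> * ((\<epsilon> + dt) * (c2 * ((real N + S) * ?Z)))"
    by (rule order_trans[OF err]) (use \<tau>0 \<epsilon> dt c2 sum_le in \<open>auto intro!: mult_left_mono\<close>)
  have e2: "norm (\<pi> (rr N) - rr N) \<le> \<epsilon> * ((1 + S) * ?Z / m)"
  proof -
    have "norm (A (A ((L \<tau> ^^ Suc N) z0))) \<le> (\<Sum>n\<le>Suc N. norm (A (A ((L \<tau> ^^ n) z0))))"
      by (rule member_le_sum) auto
    then have "norm (A (A (rr N))) \<le> (1 + S) * ?Z" using AA_le[of N] S[of "Suc N"] by (simp add: distrib_right)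
    moreover have "norm (A (rr N)) \<le> norm (A (A (rr N))) / m"
      using rr2[of N] by (intro norm_le_A) (simp add: sq_dom_def)
    ultimately have "norm (A (rr N)) \<le> (1 + S) * ?Z / m"
      using m by (meson divide_right_mono less_imp_le order_trans)
    then show ?thesis by (rule order_trans[OF approx[OF rrD] mult_left_mono]) (rule \<epsilon>)
  qed
  have e3: "norm ((L \<tau> ^^ n) z0) \<le> r ^ n * norm z0" for n
  proof (induction n)
    case (Suc n)
    have "norm ((L \<tau> ^^ Suc n) z0) \<le> r * norm ((L \<tau> ^^ n) z0)" using r by simp
    also have "\<dots> \<le> r * (r ^ n * norm z0)" by (intro mult_left_mono Suc r0)
    finally show ?case by simp
  qed simp
  have "z0 - rh N = (L \<tau> ^^ (N + 1)) z0 - (\<pi> (rr N) - rr N) + (\<pi> (rr N) - rh N)" by (simp add: rr_def)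
  then have "norm (z0 - rh N) \<le> norm ((L \<tau> ^^ (N + 1)) z0) + norm (\<pi> (rr N) - rr N) + norm (\<pi> (rr N) - rh N)"
    using norm_triangle_ineq[of "(L \<tau> ^^ (N + 1)) z0 - (\<pi> (rr N) - rr N)" "\<pi> (rr N) - rh N"]
      norm_triangle_ineq4[of "(L \<tau> ^^ (N + 1)) z0" "\<pi> (rr N) - rr N"] by simp
  then show ?thesis using e1 e2 e3[of "N + 1"] unfolding rh_def reconstruction_def by linarith
qed

end

section \<open>The error estimate\<close>

text \<open>In \<open>inner (G x) x\<close> the skew part contributes nothing and the damping contributes minus the squared output, so the
  generator is dissipative.\<close>

lemma damped_semigroup_if_generated:
  fixes C :: "'a::complex_hilbert \<Rightarrow> 'b::complex_hilbert"
  assumes op: "damped_operator D A (\<lambda>x. cadjoint C (C x)) m \<kappa> q" and C: "bounded_clinear C"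
    and c: "Re c = 0" "cmod c = 1"
    and T: "is_semigroup_generated_by T D (\<lambda>x. c *\<^sub>C A x - cadjoint C (C x))"
  shows "damped_semigroup D A (\<lambda>x. cadjoint C (C x)) m \<kappa> q T c"
proof -
  interpret op: damped_operator D A "\<lambda>x. cadjoint C (C x)" m \<kappa> q by (rule op)
  interpret T: generated_semigroup T D "\<lambda>x. c *\<^sub>C A x - cadjoint C (C x)"
    by (rule generated_semigroup_intro[OF T])
  have "inner (c *\<^sub>C A x - cadjoint C (C x)) x \<le> 0" if x: "x \<in> D" for x
  proof -
    have "inner (cadjoint C (C x)) x = inner (C x) (C x)"
      using cinner_cadjoint[OF C, of x "C x"] by (metis Re_cinner inner_commute)
    then show ?thesis using op.inner_skew[OF x c(1)] by (simp add: inner_diff_left)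
  qed
  then have "contraction_semigroup T D (\<lambda>x. c *\<^sub>C A x - cadjoint C (C x))"
    by (rule T.contraction_if_dissipative[OF op.dense])
  moreover have "damped_semigroup_axioms T c"
  proof
    show "T t (a *\<^sub>C x) = a *\<^sub>C T t x" if "t \<ge> 0" for t a x
      using T that unfolding is_semigroup_generated_by_def c0_semigroup_def bounded_clinear_def by blast
  qed (rule c(2))
  ultimately show ?thesis by (intro damped_semigroup.intro op)
qed

text \<open>The only loss of uniformity in \<open>\<tau>\<close> is the orbit sum \<open>S\<close>, which blows up as \<open>\<eta>\<close> tends to one. It is
  harmless for \<open>N \<ge> S\<close>, where it is dominated by \<open>N\<close>. For the finitely many smaller \<open>N\<close> the truncation term
  \<open>\<eta>\<^sup>N\<^sup>+\<^sup>1\<close> is bounded below, and it dominates as soon as the discretisation parameters, collected in \<open>w\<close>, are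
  below a threshold depending on \<open>\<eta>\<close>.\<close>

lemma orbit_sum_absorbed:
  fixes \<eta> S S0 C0 :: real
  assumes \<eta>: "0 \<le> \<eta>" "\<eta> < 1" and S: "S \<ge> 0" "\<eta> \<le> 1 / 2 \<Longrightarrow> S \<le> S0" and pos: "S0 \<ge> 0" "C0 \<ge> 0"
  shows "\<exists>w0>0. \<forall>w N. 0 \<le> w \<and> w < w0 \<and> N \<ge> 1 \<longrightarrow>
     C0 * w * (real N + S) \<le> \<eta> ^ (N + 1) / (1 - \<eta>) + C0 * (2 + S0) * w * (real N)\<^sup>2"
proof -
  have NN: "real N \<le> (real N)\<^sup>2" "1 \<le> (real N)\<^sup>2" if "N \<ge> 1" for N
    using that self_le_power[of "real N" 2] one_le_power[of "real N" 2] by auto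
  have X: "0 \<le> \<eta> ^ (N + 1) / (1 - \<eta>)" for N using \<eta> by simp
  have suff: "C0 * w * (real N + S) \<le> \<eta> ^ (N + 1) / (1 - \<eta>) + C0 * (2 + S0) * w * (real N)\<^sup>2"
    if "0 \<le> w" "real N + S \<le> (2 + S0) * (real N)\<^sup>2" for w N
  proof -
    have "C0 * w * (real N + S) \<le> C0 * w * ((2 + S0) * (real N)\<^sup>2)"
      using that pos by (intro mult_left_mono) auto
    then show ?thesis using X[of N] by (simp add: mult_ac)
  qed
  show ?thesis
  proof (cases "\<eta> \<le> 1 / 2")
    case True
    have "real N + S \<le> (2 + S0) * (real N)\<^sup>2" if "N \<ge> 1" for N
    proof -
      have "S0 * 1 \<le> S0 * (real N)\<^sup>2" using NN[OF that] pos by (intro mult_left_mono) auto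
      then show ?thesis unfolding distrib_right using S(2)[OF True] NN[OF that] by linarith
    qed
    then show ?thesis using suff by (intro exI[of _ 1]) auto
  next
    case False
    define n0 where "n0 = nat \<lceil>S\<rceil>"
    define w0 where "w0 = \<eta> ^ (n0 + 1) / (C0 * S + 1)"
    have den: "C0 * S + 1 > 0" using S(1) pos by (simp add: add_nonneg_pos)
    have w0: "w0 > 0" unfolding w0_def using False den by simp
    have "C0 * w * (real N + S) \<le> \<eta> ^ (N + 1) / (1 - \<eta>) + C0 * (2 + S0) * w * (real N)\<^sup>2"
      if w: "0 \<le> w" "w < w0" and N: "N \<ge> 1" for w N
    proof (cases "S \<le> real N")
      case True
      have "0 \<le> S0 * (real N)\<^sup>2" using pos by simp
      then have "real N + S \<le> (2 + S0) * (real N)\<^sup>2" unfolding distrib_right using True NN[OF N] by linarith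
      then show ?thesis using suff w(1) by blast
    next
      case small: False
      have Nn0: "N \<le> n0" using small unfolding n0_def by linarith
      have "C0 * S * w \<le> (C0 * S + 1) * w" using w(1) by (simp add: distrib_right)
      also have "\<dots> \<le> (C0 * S + 1) * w0" using w den by (intro mult_left_mono) auto
      also have "\<dots> = \<eta> ^ (n0 + 1)" using den by (simp add: w0_def)
      also have "\<dots> \<le> \<eta> ^ (N + 1)" using \<eta> Nn0 by (intro power_decreasing) auto
      also have "\<dots> \<le> \<eta> ^ (N + 1) / (1 - \<eta>)"
        using \<eta> mult_left_mono[of "1 - \<eta>" 1 "\<eta> ^ (N + 1)"] by (simp add: field_simps)
      finally have 1: "C0 * S * w \<le> \<eta> ^ (N + 1) / (1 - \<eta>)" .
      have "C0 * w * real N \<le> C0 * w * ((2 + S0) * (real N)\<^sup>2)"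
      proof (intro mult_left_mono)
        have "0 \<le> S0 * (real N)\<^sup>2" using pos by simp
        then show "real N \<le> (2 + S0) * (real N)\<^sup>2" unfolding distrib_right using NN[OF N] by linarith
      qed (use w pos in auto)
      also have "\<dots> = C0 * (2 + S0) * w * (real N)\<^sup>2" by (simp only: mult_ac)
      finally have 2: "C0 * w * real N \<le> C0 * (2 + S0) * w * (real N)\<^sup>2" .
      have "C0 * w * (real N + S) = C0 * w * real N + C0 * S * w" by (simp add: algebra_simps)
      then show ?thesis using 1 2 by linarith
    qed
    then show ?thesis using w0 by (intro exI[of _ w0]) auto
  qed
qed

lemma small_mesh:
  fixes \<theta> w0 \<tau> :: real
  assumes "\<theta> > 0" "w0 > 0" "\<tau> > 0"
  shows "\<exists>h0>0. \<exists>d0>0. \<forall>h d. 0 < h \<and> h < h0 \<and> 0 < d \<and> d < d0 \<longrightarrow> (h powr \<theta> + d) * (1 + \<tau>) < w0"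
proof -
  define s where "s = 1 + \<tau>"
  define e where "e = w0 / (2 * s)"
  have s: "s > 0" and e: "e > 0" unfolding e_def s_def using assms by simp_all
  have "(h powr \<theta> + d) * (1 + \<tau>) < w0" if "0 < h" "h < e powr (1 / \<theta>)" "d < e" for h d
  proof -
    have "h powr \<theta> < (e powr (1 / \<theta>)) powr \<theta>" using that assms by (intro powr_less_mono2) auto
    also have "\<dots> = e" using assms e by (simp add: powr_powr)
    finally have "h powr \<theta> + d < 2 * e" using that by simp
    then have "(h powr \<theta> + d) * s < 2 * e * s" using s by (intro mult_strict_right_mono) auto
    also have "\<dots> = w0" using s by (simp add: e_def)
    finally show ?thesis by (simp add: s_def)
  qed
  then show ?thesis using e by (intro exI[of _ "e powr (1 / \<theta>)"] conjI exI[of _ e]) auto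
qed

theorem theorem2p5:
  fixes D Dh :: "'a::complex_hilbert set"
    and A Ah :: "'a \<Rightarrow> 'a"
    and C :: "'a \<Rightarrow> 'b::complex_hilbert"
    and Tp Tm :: "real \<Rightarrow> 'a \<Rightarrow> 'a"
    and Xh :: "real \<Rightarrow> 'a set"
    and \<theta> :: real
  assumes "selfadjoint_op D A"
    and "strictly_positive_op D A"
    and "is_sqrt_op D A Dh Ah"
    and "bounded_clinear C"
    and "bounded_on_dom (sq_dom D A) (\<lambda>x. A (A x)) (\<lambda>x. cadjoint C (C x))"
    and "bounded_on_dom D A (\<lambda>x. cadjoint C (C x))"
    and "is_semigroup_generated_by Tp D (\<lambda>x. \<i> *\<^sub>C A x - cadjoint C (C x))"
    and "is_semigroup_generated_by Tm D (\<lambda>x. (- \<i>) *\<^sub>C A x - cadjoint C (C x))"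
    and "\<And>h. h > 0 \<Longrightarrow> galerkin_space Dh (Xh h)"
    and "\<theta> > 0"
    and "approximation_property Dh Ah Xh \<theta>"
  shows "\<exists>M>0. \<forall>\<tau>>0. exactly_observable D A C \<tau> \<longrightarrow>
    (\<exists>hs>0. \<exists>ds>0. \<forall>z0\<in>sq_dom D A. \<forall>z. solves_iA D A z0 z \<longrightarrow>
      (\<forall>(h::real) (dt::real) (K::nat) (N::nat) (yh :: nat \<Rightarrow> 'b).
        0 < h \<and> h < hs \<and> 0 < dt \<and> dt < ds \<and> K \<ge> 1 \<and> \<tau> = real K * dt \<and> N \<ge> 1 \<longrightarrow>
        (let \<eta> = onorm (\<lambda>x. Tm \<tau> (Tp \<tau> x)) in
         norm (z0 - reconstruction Ah C (Xh h) dt K yh N)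
         \<le> M * ((\<eta> ^ (N + 1) / (1 - \<eta>) + (h powr \<theta> + dt) * (1 + \<tau>) * (real N)\<^sup>2)
                   * norm (A (A z0))
               + real N * dt * (\<Sum>l=0..K. norm (cadjoint C (C (z (real l * dt)) - yh l)))))))"
proof -
  let ?Q = "\<lambda>x. cadjoint C (C x)"
  interpret sa: selfadjoint D A by unfold_locales (rule assms(1))
  have sqrt: "selfadjoint_op Dh Ah" "sq_dom Dh Ah = D" "\<And>x. x \<in> D \<Longrightarrow> Ah (Ah x) = A x"
    using assms(3) unfolding is_sqrt_op_def by auto
  interpret sh: selfadjoint Dh Ah by unfold_locales (rule sqrt(1))
  obtain m where m: "m > 0" and coercive: "\<And>x. x \<in> D \<Longrightarrow> Re (cinner (A x) x) \<ge> m * (norm x)\<^sup>2"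
    using assms(2) unfolding strictly_positive_op_def by blast
  have lower: "m * norm x \<le> norm (A x)" if x: "x \<in> D" for x
  proof (cases "x = 0")
    case False
    have "m * norm x * norm x \<le> inner (A x) x" using coercive[OF x] by (simp add: Re_cinner power2_eq_square mult.assoc)
    also have "\<dots> \<le> norm (A x) * norm x" by (rule norm_cauchy_schwarz)
    finally show ?thesis using False by simp
  qed simp
  have linC: "bounded_linear C" by (rule bounded_clinear_imp[OF assms(4)])
  have linQ: "bounded_linear ?Q"
    by (rule bounded_linear_compose[OF bounded_clinear_imp[OF bounded_clinear_cadjoint[OF assms(4)]] linC])
  obtain \<kappa> where \<kappa>: "\<kappa> \<ge> 0" "\<And>x. norm (?Q x) \<le> norm x * \<kappa>"
    using bounded_linear.nonneg_bounded[OF linQ] by blast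
  obtain q0 where QD: "\<And>x. x \<in> D \<Longrightarrow> ?Q x \<in> D" and q0: "\<And>x. x \<in> D \<Longrightarrow> norm (A (?Q x)) \<le> q0 * norm (A x)"
    using assms(6) unfolding bounded_on_dom_def by blast
  define q where "q = max q0 0"
  have q: "norm (A (?Q x)) \<le> q * norm (A x)" if "x \<in> D" for x
    by (rule order_trans[OF q0[OF that] mult_right_mono]) (simp_all add: q_def)
  interpret op: damped_operator D A ?Q m \<kappa> q
    by unfold_locales
      (use m lower \<kappa> QD q linear_simps(2)[OF linQ] in \<open>auto simp: mult.commute q_def\<close>)
  have D_Dh: "D \<subseteq> Dh" using sqrt(2) unfolding sq_dom_def by blast
  have half_form: "cinner (Ah x) (Ah \<phi>) = cinner (A x) \<phi>" if x: "x \<in> D" and \<phi>: "\<phi> \<in> Dh" for x \<phi>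
  proof -
    have "Ah x \<in> Dh" using x sqrt(2) unfolding sq_dom_def by blast
    then have "cinner (Ah (Ah x)) \<phi> = cinner (Ah x) (Ah \<phi>)" using sh.symmetric \<phi> by blast
    then show ?thesis using sqrt(3)[OF x] by simp
  qed
  have Ah_inj: "x = 0" if x: "x \<in> Dh" "Ah x = 0" for x
  proof -
    have "x \<in> D" using x sqrt(2) sh.D_zero unfolding sq_dom_def by auto
    then show ?thesis using lower[of x] sqrt(3)[of x] x(2) m by (simp add: sh.A_zero mult_le_0_iff)
  qed
  \<comment> \<open>The form norm is interpolated between the norm and the graph norm.\<close>
  have Ah_bound: "norm (Ah x) \<le> norm (A x) / sqrt m" if x: "x \<in> D" for x
  proof -
    have "(norm (Ah x))\<^sup>2 = inner (A x) x"
      using half_form[OF x subsetD[OF D_Dh x]] by (metis Re_cinner Re_complex_of_real cinner_self)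
    also have "\<dots> \<le> norm (A x) * norm x" by (rule norm_cauchy_schwarz)
    also have "\<dots> \<le> norm (A x) * (norm (A x) / m)" by (intro mult_left_mono op.norm_le_A x) simp
    also have "\<dots> = (norm (A x) / sqrt m)\<^sup>2" using m by (simp add: power_divide power2_eq_square)
    finally show ?thesis by (rule power2_le_imp_le) (use m in simp)
  qed
  have Tp: "damped_semigroup D A ?Q m \<kappa> q Tp \<i>" and Tm: "damped_semigroup D A ?Q m \<kappa> q Tm (- \<i>)"
    by (rule damped_semigroup_if_generated[OF op.damped_operator_axioms assms(4) _ _ assms(7)], simp, simp)
      (rule damped_semigroup_if_generated[OF op.damped_operator_axioms assms(4) _ _ assms(8)], simp, simp)
  have half: "definite_half_op Dh Ah"
    by unfold_locales (use sh.subspace_D sh.A_add sh.A_cscale Ah_inj in auto)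
  have setting: "observer_setting D A C m \<kappa> q Dh Ah Tp Tm"
    by (intro observer_setting.intro op.damped_operator_axioms half Tp Tm observer_setting_axioms.intro
        assms(4) D_Dh half_form)
  interpret obs: observer_setting D A C m \<kappa> q Dh Ah Tp Tm by (rule setting)
  obtain Ma hs0 where Ma: "Ma > 0" and hs0: "hs0 > 0"
    and approx: "\<And>\<phi> h. \<phi> \<in> Dh \<Longrightarrow> 0 < h \<Longrightarrow> h < hs0 \<Longrightarrow>
        norm (half_proj Ah (Xh h) \<phi> - \<phi>) \<le> Ma * h powr \<theta> * norm (Ah \<phi>)"
    using assms(11) unfolding approximation_property_def by blast
  \<comment> \<open>\<open>M1\<close> turns \<open>\<epsilon> + dt\<close> into \<open>h powr \<theta> + dt\<close>; \<open>S0\<close> bounds the orbit sum when \<open>\<eta> \<le> 1 / 2\<close>; \<open>C0\<close> collects the three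
    discretisation terms of the reconstruction error.\<close>
  define M1 where "M1 = max 1 (Ma / sqrt m)"
  have M1: "M1 \<ge> 1" by (simp add: M1_def)
  define S0 where "S0 = orbit_const m obs.b1 obs.b2 (1 / 2)"
  define C0 where "C0 = M1 * (1 / m + 2 * obs.c3 + obs.c2)"
  define M where "M = 1 / m\<^sup>2 + 1 + C0 * (2 + S0) + 4"
  have c3: "obs.c3 \<ge> 0" unfolding obs.c3_def using op.c1_nonneg op.k2_nonneg m by simp
  have c2: "obs.c2 \<ge> 0" unfolding obs.c2_def using op.c1_nonneg op.k2_nonneg m by simp
  have C0: "C0 \<ge> 0" unfolding C0_def using M1 m c2 c3 by simp
  have S0: "S0 \<ge> 0" unfolding S0_def by (rule orbit_const_mono(2)[OF m obs.b_nonneg, of _ "1 / 2"]) auto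
  have M: "M > 0" unfolding M_def using m C0 S0 by (intro add_nonneg_pos add_nonneg_nonneg) auto
  show ?thesis
  proof (rule exI[of _ M], intro conjI M allI impI)
    fix \<tau> :: real assume \<tau>: "\<tau> > 0" and observable: "exactly_observable D A C \<tau>"
    define \<eta> where "\<eta> = onorm (obs.L \<tau>)"
    have \<tau>0: "\<tau> \<ge> 0" using \<tau> by simp
    have linL: "bounded_linear (obs.L \<tau>)"
      by (rule bounded_linear_compose[OF obs.Tm.S_lin[OF \<tau>0] obs.Tp.S_lin[OF \<tau>0]])
    have \<eta>_bound: "norm (obs.L \<tau> y) \<le> \<eta> * norm y" for y unfolding \<eta>_def by (rule onorm[OF linL])
    have \<eta>0: "\<eta> \<ge> 0" unfolding \<eta>_def by (rule onorm_pos_le[OF linL])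
    have \<eta>1: "\<eta> < 1"
    proof -
      obtain r where r: "r < 1" "r \<ge> 0" "\<And>x. norm (Tp \<tau> x) \<le> r * norm x"
        using observable_decay[OF assms(1,4) obs.Tp.contraction_semigroup_axioms \<tau> observable] by blast
      have "\<eta> \<le> r" unfolding \<eta>_def
        by (rule onorm_bound[OF r(2)]) (rule order_trans[OF obs.Tm.contraction[OF \<tau>0] r(3)])
      then show ?thesis using r(1) by simp
    qed
    define S where "S = orbit_const m obs.b1 obs.b2 \<eta>"
    have S: "S \<ge> 0" "\<eta> \<le> 1 / 2 \<Longrightarrow> S \<le> S0"
      unfolding S_def S0_def
      using orbit_const_mono(2)[OF m obs.b_nonneg \<eta>0 order_refl \<eta>1]
        orbit_const_mono(1)[OF m obs.b_nonneg \<eta>0, of "1 / 2"] by auto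
    obtain w0 where w0: "w0 > 0" and absorb: "\<And>w N. 0 \<le> w \<Longrightarrow> w < w0 \<Longrightarrow> N \<ge> 1 \<Longrightarrow>
       C0 * w * (real N + S) \<le> \<eta> ^ (N + 1) / (1 - \<eta>) + C0 * (2 + S0) * w * (real N)\<^sup>2"
      using orbit_sum_absorbed[OF \<eta>0 \<eta>1 S S0 C0] by blast
    obtain h1 d1 where h1: "h1 > 0" and d1: "d1 > 0"
      and mesh: "\<And>h d. 0 < h \<Longrightarrow> h < h1 \<Longrightarrow> 0 < d \<Longrightarrow> d < d1 \<Longrightarrow> (h powr \<theta> + d) * (1 + \<tau>) < w0"
      using small_mesh[OF assms(10) w0 \<tau>] by blast
    define hmax where "hmax = min hs0 (min h1 d1)"
    have hmax: "hmax > 0" using hs0 h1 d1 by (simp add: hmax_def)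
    show "\<exists>hs>0. \<exists>ds>0. \<forall>z0\<in>sq_dom D A. \<forall>z. solves_iA D A z0 z \<longrightarrow>
      (\<forall>(h::real) (dt::real) (K::nat) (N::nat) (yh :: nat \<Rightarrow> 'b).
        0 < h \<and> h < hs \<and> 0 < dt \<and> dt < ds \<and> K \<ge> 1 \<and> \<tau> = real K * dt \<and> N \<ge> 1 \<longrightarrow>
        (let \<eta> = onorm (\<lambda>x. Tm \<tau> (Tp \<tau> x)) in
         norm (z0 - reconstruction Ah C (Xh h) dt K yh N)
         \<le> M * ((\<eta> ^ (N + 1) / (1 - \<eta>) + (h powr \<theta> + dt) * (1 + \<tau>) * (real N)\<^sup>2)
                   * norm (A (A z0))
               + real N * dt * (\<Sum>l=0..K. norm (cadjoint C (C (z (real l * dt)) - yh l))))))"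
    proof (intro exI[of _ hmax] conjI ballI allI impI hmax)
      fix z0 z and h dt :: real and K N :: nat and yh :: "nat \<Rightarrow> 'b"
      assume z0: "z0 \<in> sq_dom D A" and z: "solves_iA D A z0 z"
        and par: "0 < h \<and> h < hmax \<and> 0 < dt \<and> dt < hmax \<and> K \<ge> 1 \<and> \<tau> = real K * dt \<and> N \<ge> 1"
      then have h: "0 < h" "h < hs0" "h < h1" and dt: "0 < dt" "dt < d1" and \<tau>K: "\<tau> = real K * dt" and N: "N \<ge> 1"
        by (auto simp: hmax_def)
      define \<epsilon> where "\<epsilon> = Ma / sqrt m * h powr \<theta>"
      have \<epsilon>: "\<epsilon> \<ge> 0" unfolding \<epsilon>_def using Ma m by simp
      interpret d: discrete_observer D A C m \<kappa> q Dh Ah Tp Tm "Xh h" dt \<epsilon>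
      proof (intro discrete_observer.intro setting galerkin.intro half galerkin_axioms.intro
          discrete_observer_axioms.intro assms(9) h dt \<epsilon>)
        fix x assume x: "x \<in> D"
        have "norm (half_proj Ah (Xh h) x - x) \<le> Ma * h powr \<theta> * norm (Ah x)"
          using approx[of x h] x D_Dh h by blast
        also have "\<dots> \<le> Ma * h powr \<theta> * (norm (A x) / sqrt m)"
          using Ma by (intro mult_left_mono Ah_bound x) simp
        finally show "norm (half_proj Ah (Xh h) x - x) \<le> \<epsilon> * norm (A x)" by (simp add: \<epsilon>_def)
      qed
      let ?Z = "norm (A (A z0))"
      define \<Sigma> where "\<Sigma> = (\<Sum>l=0..K. norm (cadjoint C (C (z (real l * dt)) - yh l)))"
      have \<Sigma>0: "\<Sigma> \<ge> 0" unfolding \<Sigma>_def by (intro sum_nonneg) simp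
      \<comment> \<open>The observers are driven by the output of the given solution, which is the orbit of the group.\<close>
      have \<Sigma>_group: "\<Sigma> = (\<Sum>l=0..K. norm (cadjoint C (C (sa.group (real l * dt) z0) - yh l)))"
        unfolding \<Sigma>_def using sa.solves_iA_unique[OF z] dt by simp
      define w where "w = (h powr \<theta> + dt) * (1 + \<tau>)"
      have w: "0 \<le> w" "w < w0" unfolding w_def using dt \<tau> mesh[OF h(1,3) dt] by auto
      note orbit = op.power_orbit_sum[of "obs.L \<tau>" \<eta> obs.b1 obs.b2,
          OF obs.L_sq_dom[OF _ \<tau>0] \<eta>_bound obs.A_L_bound[OF _ \<tau>0 \<eta>_bound] obs.AA_L_bound[OF _ \<tau>0 \<eta>_bound]
            \<eta>0 \<eta>1 obs.b_nonneg z0, folded S_def]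
      define \<delta> where "\<delta> = \<tau> * ((\<epsilon> + dt) * (obs.c3 * ?Z)) + 2 * dt * \<Sigma>"
      have "norm (z0 - reconstruction Ah C (Xh h) dt K yh N)
        \<le> \<eta> ^ (N + 1) * norm z0 + \<epsilon> * ((1 + S) * ?Z / m) + real (N + 1) * \<delta>
          + \<tau> * ((\<epsilon> + dt) * (obs.c2 * ((real N + S) * ?Z)))"
      proof (rule d.reconstruction_error[OF z0 \<tau>K \<eta>_bound orbit _ \<eta>0])
        show "norm (half_proj Ah (Xh h) (z0 - obs.L \<tau> z0) - observer_minus Ah C (Xh h) dt K yh 0) \<le> \<delta>"
          unfolding \<delta>_def \<Sigma>_group \<tau>K by (rule d.observer_minus_error[OF z0])
      qed
      also have "\<dots> \<le> \<eta> ^ (N + 1) * (?Z / m\<^sup>2) + M1 * w * ((real N + S) * ?Z / m)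
          + (2 * (M1 * w * (obs.c3 * ((real N + S) * ?Z))) + 4 * real N * dt * \<Sigma>)
          + M1 * w * (obs.c2 * ((real N + S) * ?Z))"
      proof -
        have N1: "1 \<le> real N" using N by simp
        have e1: "\<epsilon> \<le> M1 * h powr \<theta>" unfolding \<epsilon>_def M1_def by (intro mult_right_mono) auto
        have e2: "\<epsilon> + dt \<le> M1 * (h powr \<theta> + dt)"
          unfolding distrib_left using e1 mult_right_mono[OF M1, of dt] dt by linarith
        have hd: "0 \<le> h powr \<theta> + dt" using dt by simp
        have e4: "\<tau> * (\<epsilon> + dt) \<le> M1 * w"
        proof -
          have "\<tau> * (\<epsilon> + dt) \<le> \<tau> * (M1 * (h powr \<theta> + dt))" by (intro mult_left_mono e2 \<tau>0)
          also have "\<dots> \<le> (1 + \<tau>) * (M1 * (h powr \<theta> + dt))" using M1 hd by (intro mult_right_mono) auto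
          finally show ?thesis by (simp add: w_def mult_ac)
        qed
        have e3: "\<epsilon> \<le> M1 * w"
        proof -
          have "M1 * h powr \<theta> \<le> M1 * (h powr \<theta> + dt)" using M1 dt by (intro mult_left_mono) auto
          also have "\<dots> = M1 * (h powr \<theta> + dt) * 1" by simp
          also have "\<dots> \<le> M1 * (h powr \<theta> + dt) * (1 + \<tau>)" using M1 hd \<tau>0 by (intro mult_left_mono) auto
          finally show ?thesis using e1 by (simp add: w_def mult_ac)
        qed
        have Mw: "0 \<le> M1 * w" using M1 w by simp
        have nz: "norm z0 \<le> ?Z / m\<^sup>2"
        proof -
          have "norm z0 \<le> norm (A z0) / m" by (rule op.norm_le_A) (use z0 in \<open>simp add: sq_dom_def\<close>)
          also have "\<dots> \<le> (?Z / m) / m"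
            using m z0 by (intro divide_right_mono op.norm_le_A) (auto simp: sq_dom_def)
          finally show ?thesis by (simp add: power2_eq_square)
        qed
        have t1: "\<eta> ^ (N + 1) * norm z0 \<le> \<eta> ^ (N + 1) * (?Z / m\<^sup>2)" using \<eta>0 by (intro mult_left_mono nz) auto
        have t2: "\<epsilon> * ((1 + S) * ?Z / m) \<le> M1 * w * ((real N + S) * ?Z / m)"
          using m S N1 Mw by (intro mult_mono e3 divide_right_mono mult_right_mono) auto
        have t4: "\<tau> * ((\<epsilon> + dt) * (obs.c2 * ((real N + S) * ?Z))) \<le> M1 * w * (obs.c2 * ((real N + S) * ?Z))"
          unfolding mult.assoc[of \<tau>, symmetric] using c2 S by (intro mult_right_mono e4) auto
        have "\<tau> * ((\<epsilon> + dt) * (obs.c3 * ?Z)) \<le> M1 * w * (obs.c3 * ?Z)"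
          unfolding mult.assoc[of \<tau>, symmetric] using c3 by (intro mult_right_mono e4) auto
        then have "\<delta> \<le> M1 * w * (obs.c3 * ?Z) + 2 * dt * \<Sigma>" by (simp add: \<delta>_def)
        then have "real (N + 1) * \<delta> \<le> (2 * real N) * (M1 * w * (obs.c3 * ?Z) + 2 * dt * \<Sigma>)"
          using N1 Mw c3 dt \<Sigma>0 by (intro order_trans[OF mult_left_mono mult_right_mono]) auto
        also have "\<dots> = 2 * (M1 * w * (obs.c3 * (real N * ?Z))) + 4 * real N * dt * \<Sigma>" by (simp add: algebra_simps)
        also have "\<dots> \<le> 2 * (M1 * w * (obs.c3 * ((real N + S) * ?Z))) + 4 * real N * dt * \<Sigma>"
          using Mw c3 S by (intro add_right_mono mult_left_mono mult_right_mono) auto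
        finally show ?thesis using t1 t2 t4 by linarith
      qed
      also have "\<dots> = (\<eta> ^ (N + 1) * (1 / m\<^sup>2) + C0 * w * (real N + S)) * ?Z + 4 * (real N * dt * \<Sigma>)"
        by (simp add: C0_def algebra_simps add_divide_distrib)
      also have "\<dots> \<le> M * ((\<eta> ^ (N + 1) / (1 - \<eta>) + w * (real N)\<^sup>2) * ?Z + real N * dt * \<Sigma>)"
      proof -
        let ?X = "\<eta> ^ (N + 1) / (1 - \<eta>)"
        have X: "\<eta> ^ (N + 1) \<le> ?X" "0 \<le> ?X"
          using \<eta>0 \<eta>1 mult_left_mono[of "1 - \<eta>" 1 "\<eta> ^ (N + 1)"] by (auto simp: field_simps)
        have "\<eta> ^ (N + 1) * (1 / m\<^sup>2) + C0 * w * (real N + S)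
          \<le> ?X * (1 / m\<^sup>2) + (?X + C0 * (2 + S0) * w * (real N)\<^sup>2)"
          by (intro add_mono mult_right_mono X absorb w N) simp
        also have "\<dots> = (1 / m\<^sup>2 + 1) * ?X + (C0 * (2 + S0)) * (w * (real N)\<^sup>2)"
          by (simp only: distrib_right mult_1_left mult.commute[of ?X] add.assoc mult.assoc)
        also have "\<dots> \<le> M * ?X + M * (w * (real N)\<^sup>2)"
          using X w C0 S0 m by (intro add_mono mult_right_mono) (auto simp: M_def)
        finally have "(\<eta> ^ (N + 1) * (1 / m\<^sup>2) + C0 * w * (real N + S)) * ?Z \<le> (M * ?X + M * (w * (real N)\<^sup>2)) * ?Z"
          by (intro mult_right_mono) auto
        moreover have "4 * (real N * dt * \<Sigma>) \<le> M * (real N * dt * \<Sigma>)"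
          using dt \<Sigma>0 C0 S0 m by (intro mult_right_mono) (auto simp: M_def)
        ultimately show ?thesis by (simp add: distrib_left distrib_right mult.assoc)
      qed
      finally show "let \<eta> = onorm (\<lambda>x. Tm \<tau> (Tp \<tau> x)) in
         norm (z0 - reconstruction Ah C (Xh h) dt K yh N)
         \<le> M * ((\<eta> ^ (N + 1) / (1 - \<eta>) + (h powr \<theta> + dt) * (1 + \<tau>) * (real N)\<^sup>2)
                   * norm (A (A z0))
               + real N * dt * (\<Sum>l=0..K. norm (cadjoint C (C (z (real l * dt)) - yh l))))"
        unfolding Let_def \<eta>_def[symmetric] w_def[symmetric] \<Sigma>_def[symmetric] .
    qed
  qed
qed

end
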